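(* Under the standing assumption below, for every $0<\epsilon<1$, $$\lim_{\beta\to\infty}\frac1\beta\log t^{mix}_\beta(\epsilon)=\Gamma^{Hex},$$ and there exist constants $0<c_1<c_2<\infty$ independent of $\beta$ and functions $\gamma_1(\beta),\gamma_2(\beta)\to0$ as $\beta\to\infty$ such that for every $\beta>0$ $$c_1e^{-\beta(\Gamma^{Hex}+\gamma_1)}\le\rho_\beta\le c_2e^{-\beta(\Gamma^{Hex}-\gamma_2)}.$$
   Context: Let $\mathbb{T}^2$ denote the triangular lattice embedded in $\mathbb{R}^2$ and $\mathbb{H}^2$ its dual, the hexagonal lattice; each vertex $i$ of $\mathbb{H}^2$ is the centre of a unique closed triangular face of $\mathbb{T}^2$ (the face centred at $i$), and $d$ denotes the graph distance on $\mathbb{H}^2$, so $d(i,j)=1$ iff the faces centred at $i$ and $j$ share an edge. Fix an integer $L\ge1$ and let $\Lambda\subset\mathbb{H}^2$ be the set of sites in a parallelogram of side length $L$ cut along two coordinate axes of $\mathbb{T}^2$, with periodic boundary conditions; thus $\Lambda$ is a discrete torus with $|\Lambda|=2L^2$ sites, each having 3 nearest neighbours. Let $\mathcal X=\{-1,+1\}^\Lambda$ and let $\underline{+1}$, $\underline{-1}$ be the configurations with all spins $+1$, resp. $-1$. For $J,h>0$ the Hamiltonian is $H(\sigma)=-\frac J2\sum_{\{i,j\}\subset\Lambda:\,d(i,j)=1}\sigma(i)\sigma(j)-\frac h2\sum_{i\in\Lambda}\sigma(i)$ (sum over unordered nearest-neighbour pairs), so that $H(\sigma)-H(\underline{-1})=J|\gamma(\sigma)|-hN^+(\sigma)$,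 where $|\gamma(\sigma)|$ is the number of nearest-neighbour pairs carrying opposite spins and $N^+(\sigma)$ is the number of sites with spin $+1$. For $x\in\Lambda$, $\sigma^{(x)}$ denotes $\sigma$ with the spin at $x$ reversed. For $\beta>0$, $(X_t)_{t\in\mathbb N}$ is the Metropolis chain on $\mathcal X$ with $P(\sigma,\sigma^{(x)})=|\Lambda|^{-1}e^{-\beta[H(\sigma^{(x)})-H(\sigma)]_+}$ for $x\in\Lambda$, $P(\sigma,\eta)=0$ if $\eta\neq\sigma$ is not of the form $\sigma^{(x)}$, and $P(\sigma,\sigma)=1-\sum_{\eta\ne\sigma}P(\sigma,\eta)$; it is reversible w.r.t. the Gibbs measure $\mu(\sigma)=e^{-\beta H(\sigma)}/Z$, $Z=\sum_{\eta}e^{-\beta H(\eta)}$. Standing assumption: $0<h<1$, $J\ge2h$, $\frac J{2h}-\frac12\notin\mathbb Z$, and $|\Lambda|\ge(4J/h)^2$. Set $r^*=\lfloor\frac J{2h}-\frac12\rfloor$, $\delta=\frac J{2h}-\frac12-r^*\in(0,1)$, and $\Gamma^{Hex}=-6(r^* )^2h+6r^*J-10r^*h+7J-5h$ if $0<\delta<\frac12$, $\Gamma^{Hex}=-6(r^*+1)^2h+6(r^*+1)J-2(r^*+1)h+3J-h$ if $\frac12<\delta<1$. The mixing time is $t^{mix}_\beta(\epsilon)=\min\{n\ge0:\ \max_{\sigma\in\mathcal X}\|P^n(\sigma,\cdot)-\mu\|_{TV}\le\epsilon\}$, and the spectral gap is $\rho_\beta=1-\lambda^{(2)}_\beta$,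 where $\lambda^{(2)}_\beta$ is the second largest eigenvalue of the transition matrix $P$. *)

theory Defs
  imports Complex_Main
begin

text \<open>Sites of the hexagonal torus: a site (a,b,s) is the centre of the triangular face of
  the triangular lattice (basis e1=(1,0), e2=(1/2,sqrt 3/2)) with lower-left vertex (a,b):
  s = False is the upward triangle {(a,b),(a+1,b),(a,b+1)}, s = True the downward triangle
  {(a+1,b),(a,b+1),(a+1,b+1)}; coordinates taken mod L.\<close>
type_synonym site = "nat \<times> nat \<times> bool"
type_synonym config = "site \<Rightarrow> int"

definition Lam :: "nat \<Rightarrow> site set" where
  "Lam L = {0..<L} \<times> {0..<L} \<times> (UNIV :: bool set)"

text \<open>Upward face (p,q) shares an edge with downward faces (p,q), (p,q-1), (p-1,q) (mod L).\<close>
definition up_down_adj :: "nat \<Rightarrow> nat \<times> nat \<Rightarrow> nat \<times> nat \<Rightarrow> bool" where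
  "up_down_adj L pq uv =
     (uv \<in> {pq, (fst pq, (snd pq + L - 1) mod L), ((fst pq + L - 1) mod L, snd pq)})"

definition hex_adj :: "nat \<Rightarrow> site \<Rightarrow> site \<Rightarrow> bool" where
  "hex_adj L x y =
     (case x of (a, b, s) \<Rightarrow> case y of (c, d, t) \<Rightarrow>
        (\<not> s \<and> t \<and> up_down_adj L (a, b) (c, d)) \<or> (s \<and> \<not> t \<and> up_down_adj L (c, d) (a, b)))"

definition edges :: "nat \<Rightarrow> site set set" where
  "edges L = {{x, y} | x y. x \<in> Lam L \<and> y \<in> Lam L \<and> hex_adj L x y}"

definition configs :: "nat \<Rightarrow> config set" where
  "configs L = {\<sigma>. (\<forall>x\<in>Lam L. \<sigma> x \<in> {-1, 1}) \<and> (\<forall>x. x \<notin> Lam L \<longrightarrow> \<sigma> x = 0)}"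

definition Ham :: "nat \<Rightarrow> real \<Rightarrow> real \<Rightarrow> config \<Rightarrow> real" where
  "Ham L J h \<sigma> = - (J / 2) * (\<Sum>e\<in>edges L. \<Prod>x\<in>e. real_of_int (\<sigma> x))
                  - (h / 2) * (\<Sum>x\<in>Lam L. real_of_int (\<sigma> x))"

definition flip :: "config \<Rightarrow> site \<Rightarrow> config" where
  "flip \<sigma> x = \<sigma>(x := - \<sigma> x)"

definition gibbs :: "nat \<Rightarrow> real \<Rightarrow> real \<Rightarrow> real \<Rightarrow> config \<Rightarrow> real" where
  "gibbs L J h \<beta> \<sigma> = exp (- \<beta> * Ham L J h \<sigma>) / (\<Sum>\<eta>\<in>configs L. exp (- \<beta> * Ham L J h \<eta>))"

definition metro_off :: "nat \<Rightarrow> real \<Rightarrow> real \<Rightarrow> real \<Rightarrow> config \<Rightarrow> config \<Rightarrow> real" where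
  "metro_off L J h \<beta> \<sigma> \<eta> =
     (if \<exists>x\<in>Lam L. \<eta> = flip \<sigma> x
      then exp (- \<beta> * max 0 (Ham L J h \<eta> - Ham L J h \<sigma>)) / real (card (Lam L))
      else 0)"

definition metro :: "nat \<Rightarrow> real \<Rightarrow> real \<Rightarrow> real \<Rightarrow> config \<Rightarrow> config \<Rightarrow> real" where
  "metro L J h \<beta> \<sigma> \<eta> =
     (if \<eta> = \<sigma> then 1 - (\<Sum>\<eta>'\<in>configs L - {\<sigma>}. metro_off L J h \<beta> \<sigma> \<eta>')
      else metro_off L J h \<beta> \<sigma> \<eta>)"

primrec metro_pow :: "nat \<Rightarrow> real \<Rightarrow> real \<Rightarrow> real \<Rightarrow> nat \<Rightarrow> config \<Rightarrow> config \<Rightarrow> real" where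
  "metro_pow L J h \<beta> 0 \<sigma> \<eta> = (if \<sigma> = \<eta> then 1 else 0)"
| "metro_pow L J h \<beta> (Suc n) \<sigma> \<eta> =
     (\<Sum>\<xi>\<in>configs L. metro_pow L J h \<beta> n \<sigma> \<xi> * metro L J h \<beta> \<xi> \<eta>)"

definition tv_dist :: "nat \<Rightarrow> real \<Rightarrow> real \<Rightarrow> real \<Rightarrow> nat \<Rightarrow> config \<Rightarrow> real" where
  "tv_dist L J h \<beta> n \<sigma> =
     (1 / 2) * (\<Sum>\<eta>\<in>configs L. \<bar>metro_pow L J h \<beta> n \<sigma> \<eta> - gibbs L J h \<beta> \<eta>\<bar>)"

definition tmix :: "nat \<Rightarrow> real \<Rightarrow> real \<Rightarrow> real \<Rightarrow> real \<Rightarrow> nat" where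
  "tmix L J h \<beta> \<epsilon> = (LEAST n. \<forall>\<sigma>\<in>configs L. tv_dist L J h \<beta> n \<sigma> \<le> \<epsilon>)"

definition metro_eigs :: "nat \<Rightarrow> real \<Rightarrow> real \<Rightarrow> real \<Rightarrow> real set" where
  "metro_eigs L J h \<beta> =
     {lam. \<exists>f :: config \<Rightarrow> real. (\<exists>\<sigma>\<in>configs L. f \<sigma> \<noteq> 0) \<and>
          (\<forall>\<sigma>\<in>configs L. (\<Sum>\<eta>\<in>configs L. metro L J h \<beta> \<sigma> \<eta> * f \<eta>) = lam * f \<sigma>)}"

definition spectral_gap :: "nat \<Rightarrow> real \<Rightarrow> real \<Rightarrow> real \<Rightarrow> real" where
  "spectral_gap L J h \<beta> =
     1 - Max (metro_eigs L J h \<beta> - {Max (metro_eigs L J h \<beta>)})"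

definition r_star :: "real \<Rightarrow> real \<Rightarrow> int" where
  "r_star J h = \<lfloor>J / (2 * h) - 1 / 2\<rfloor>"

definition delta_hex :: "real \<Rightarrow> real \<Rightarrow> real" where
  "delta_hex J h = J / (2 * h) - 1 / 2 - real_of_int (r_star J h)"

definition Gamma_hex :: "real \<Rightarrow> real \<Rightarrow> real" where
  "Gamma_hex J h =
     (let r = real_of_int (r_star J h) in
      if delta_hex J h < 1 / 2
      then - 6 * r\<^sup>2 * h + 6 * r * J - 10 * r * h + 7 * J - 5 * h
      else - 6 * (r + 1)\<^sup>2 * h + 6 * (r + 1) * J - 2 * (r + 1) * h + 3 * J - h)"

end

theory Submission
  imports Defs "HOL-Analysis.Function_Topology"
begin

text \<open>Let \<open>S\<close> be the set of plus sites; up to a constant the energy is \<open>J p(S) - h |S|\<close> with \<open>p\<close> the perimeter.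
  In the plane every nonempty strip in one of the three lattice directions contributes two boundary edges and every
  edge lies in two strips, so \<open>p(S)\<close> is at least the number \<open>a + b + c\<close> of strips met by \<open>S\<close>; counting pairs
  of strips as in Pollard's theorem bounds \<open>|S|\<close> by \<open>(a + b + c)\<^sup>2 / 6\<close>. On the torus a set of critical size with
  too small a perimeter misses a row and a column and can be unrolled, hence every path from minus to plus crosses
  the level \<open>\<Gamma>\<close>. Conversely a spiral grows through sets of minimal perimeter, and since the perimeter is submodular,
  adding a translate of the spiral to any configuration costs at most \<open>\<Gamma>\<close> before the energy drops below its initial
  value. So every configuration reaches the plus state with barrier at most \<open>\<Gamma>\<close>. Comparison along these paths gives a
  Poincare inequality, hence the lower bound on the gap and the upper bound on the mixing time (for the eigenvalues near
  \<open>-1\<close> one uses \<open>(f x + f y)\<^sup>2\<close> in place of \<open>(f x - f y)\<^sup>2\<close>). The other two bounds come from the flux out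
  of the set of configurations of subcritical size.\<close>

section \<open>Isoperimetry in the plane\<close>

text \<open>Adding a translated droplet \<open>W\<close> to a configuration \<open>S\<close> leaves,
  by submodularity, the energy of \<open>S \<inter> W\<close> as the error term. This overlap can be
  any piece of the droplet. The spiral must therefore minimise the perimeter at every length, not
  only at its completed shapes; if it is stopped at the first prefix of negative energy, every
  smaller piece has nonnegative energy. The droplet must also leave a free row and column of the
  torus. The smallest values of \<open>J / h\<close> are the tight ones here, and they decide which
  completed shape is used as the supercritical droplet.

  The state space is fixed while \<beta> grows, so path lengths and numbers of configurations enter
  only as prefactors, provided they are chosen before \<beta>. This is why both correction functions
  in the gap bounds can be taken to be zero. The eigenvalues near \<open>- 1\<close> matter only for
  mixing: they are kept away by the self-loop at all-plus, whose probability is at least one half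
  once \<beta> \<ge> \<open>ln 2 / h\<close>. The gap bounds avoid this restriction and hold for all
  \<beta> > 0.\<close>

lemma card_succ_stays_le:
  assumes "finite S" and lab: "\<And>v. lab (f v) = lab v"
  shows "card {v\<in>S. f v \<in> S} + card (lab ` {v\<in>S. \<exists>n. (f ^^ n) v \<notin> S}) \<le> card S"
proof -
  \<comment> \<open>An orbit that leaves \<open>S\<close> has an exit in \<open>S\<close>, and exits
    with different labels are different points. Orbits that stay in \<open>S\<close> are left out of
    the count: for finite sets in the plane there are none, on the torus they are the full
    strips.\<close>
  have "lab ` {v\<in>S. \<exists>n. (f ^^ n) v \<notin> S} \<subseteq> lab ` {v\<in>S. f v \<notin> S}"
  proof
    fix l assume "l \<in> lab ` {v\<in>S. \<exists>n. (f ^^ n) v \<notin> S}"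
    then obtain v n where v: "v \<in> S" "(f ^^ n) v \<notin> S" "l = lab v" by auto
    from v(2) have "\<exists>w\<in>S. f w \<notin> S \<and> lab w = lab v"
    proof (induction n)
      case 0 then show ?case using v(1) by simp
    next
      case (Suc n)
      show ?case
      proof (cases "(f ^^ n) v \<in> S")
        case True
        moreover have "lab ((f ^^ n) v) = lab v" by (induction n) (auto simp: lab)
        ultimately show ?thesis using Suc.prems by auto
      qed (use Suc.IH in auto)
    qed
    then show "l \<in> lab ` {v\<in>S. f v \<notin> S}" using v(3) by (metis (mono_tags, lifting) image_eqI mem_Collect_eq)
  qed
  then have "card (lab ` {v\<in>S. \<exists>n. (f ^^ n) v \<notin> S}) \<le> card (lab ` {v\<in>S. f v \<notin> S})"
    using assms(1) by (intro card_mono) auto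
  also have "\<dots> \<le> card {v\<in>S. f v \<notin> S}" using assms(1) by (intro card_image_le) auto
  finally have "card (lab ` {v\<in>S. \<exists>n. (f ^^ n) v \<notin> S}) \<le> card {v\<in>S. f v \<notin> S}" .
  moreover have "card {v\<in>S. f v \<in> S} + card {v\<in>S. f v \<notin> S} = card S"
  proof -
    have "S = {v\<in>S. f v \<in> S} \<union> {v\<in>S. f v \<notin> S}" by auto
    moreover have "card ({v\<in>S. f v \<in> S} \<union> {v\<in>S. f v \<notin> S}) = card {v\<in>S. f v \<in> S} + card {v\<in>S. f v \<notin> S}"
      using assms(1) by (intro card_Un_disjoint) auto
    ultimately show ?thesis by simp
  qed
  ultimately show ?thesis by linarith
qed

text \<open>Peels off \<open>j\<close> hooks, each with at most \<open>card C\<close> pairs, and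
  counts the remaining rectangle in full. Truncated subtraction keeps the bound valid for every
  \<open>j\<close>.\<close>

lemma card_sum_pairs_le:
  fixes A B C :: "int set"
  assumes "finite A" "finite B" "finite C"
  shows "card {(x, y) \<in> A \<times> B. x + y \<in> C} \<le> j * card C + (card A - j) * (card B - j)"
  using assms(1,2)
proof (induction j arbitrary: A B)
  case 0
  have "card {(x, y) \<in> A \<times> B. x + y \<in> C} \<le> card (A \<times> B)"
    using 0 by (intro card_mono) auto
  then show ?case by (simp add: card_cartesian_product)
next
  case (Suc j)
  show ?case
  proof (cases "A = {} \<or> B = {}")
    case True then show ?thesis by auto
  next
    case False
    define a b where "a = Min A" and "b = Max B"
    have a: "a \<in> A" "\<And>x. x \<in> A \<Longrightarrow> a \<le> x" and b: "b \<in> B" "\<And>y. y \<in> B \<Longrightarrow> y \<le> b"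
      using False Suc.prems by (auto simp: a_def b_def)
    define Hk where "Hk = {(x, y) \<in> A \<times> B. x + y \<in> C \<and> (x = a \<or> y = b)}"
    \<comment> \<open>along the hook formed by the row of \<open>a\<close> and the column of \<open>b\<close> the sums strictly increase\<close>
    have inj: "inj_on (\<lambda>(x, y). x + y) Hk"
    proof (rule inj_onI, clarify)
      fix x y x' y' assume H: "(x, y) \<in> Hk" "(x', y') \<in> Hk" "x + y = x' + y'"
      then have "a \<le> x" "a \<le> x'" "y \<le> b" "y' \<le> b" "x = a \<or> y = b" "x' = a \<or> y' = b"
        using a b by (auto simp: Hk_def)
      then show "x = x' \<and> y = y'" using H(3) by auto
    qed
    have hook: "card Hk \<le> card C"
      by (rule card_inj_on_le[OF inj _ assms(3)]) (auto simp: Hk_def)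
    have "{(x, y) \<in> A \<times> B. x + y \<in> C} = Hk \<union> {(x, y) \<in> (A - {a}) \<times> (B - {b}). x + y \<in> C}"
      using a b by (auto simp: Hk_def)
    then have "card {(x, y) \<in> A \<times> B. x + y \<in> C}
        \<le> card Hk + card {(x, y) \<in> (A - {a}) \<times> (B - {b}). x + y \<in> C}"
      by (metis (no_types, lifting) card_Un_le)
    also have "\<dots> \<le> card C + (j * card C + (card (A - {a}) - j) * (card (B - {b}) - j))"
      using hook Suc.IH[of "A - {a}" "B - {b}"] Suc.prems by simp
    also have "\<dots> = Suc j * card C + (card A - Suc j) * (card B - Suc j)"
      using a(1) b(1) Suc.prems by (simp add: card_Diff_singleton)
    finally show ?thesis .
  qed
qed

text \<open>The sharp bound would have no \<open>+ 3\<close>; since perimeter and area have the same parity, the weaker one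
  determines the same minimal perimeters.\<close>

lemma six_times_le_square:
  fixes a b c n :: nat
  assumes n: "\<And>i j. n \<le> i * c + (a - i) * (b - i) + (j * c + (a - j) * (b - j))"
  shows "6 * n \<le> (a + b + c)\<^sup>2 + 3"
proof -
  define m where "m = min a b"
  have n1: "n \<le> 2 * (m * c)" using n[of m m] by (auto simp: m_def min_def)
  have n2: "n \<le> 2 * (a * b)" using n[of 0 0] by simp
  \<comment> \<open>As a real function of \<open>i\<close>, the bound
    \<open>i * c + (a - i) * (b - i)\<close> is smallest at \<open>(a + b - c) / 2\<close>. In the
    first two cases this point lies outside the range from 0 to \<open>m\<close>, so the nearer end
    of the range is used.\<close>
  consider "a + b < c" | "c \<le> a + b" "a + b - c > 2 * m" | "c \<le> a + b" "a + b - c \<le> 2 * m"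
    by linarith
  then show ?thesis
  proof cases
    case 1
    have "12 * (int a * int b) \<le> 3 * (int a + int b)\<^sup>2"
      using zero_le_power2[of "int a - int b"] by (simp add: power2_eq_square algebra_simps)
    also have "\<dots> \<le> (int a + int b + int c)\<^sup>2"
    proof -
      have "(2 * (int a + int b))\<^sup>2 \<le> (int a + int b + int c)\<^sup>2" using 1 by (intro power_mono) auto
      moreover have "(2 * (int a + int b))\<^sup>2 = 3 * (int a + int b)\<^sup>2 + (int a + int b)\<^sup>2"
        by (simp add: power2_eq_square algebra_simps)
      ultimately show ?thesis using zero_le_power2[of "int a + int b"] by linarith
    qed
    finally have "12 * (a * b) \<le> (a + b + c)\<^sup>2"
      by (metis (mono_tags, lifting) of_nat_add of_nat_le_iff of_nat_mult of_nat_numeral of_nat_power)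
    then show ?thesis using n2 by linarith
  next
    case 2
    have "(4 * (int m * int c)) \<le> (int m + int c)\<^sup>2"
      using zero_le_power2[of "int m - int c"] by (simp add: power2_eq_square algebra_simps)
    then have "16 * (int m * int c) \<le> (2 * (int m + int c))\<^sup>2"
      by (simp add: power2_eq_square algebra_simps)
    also have "\<dots> \<le> (int a + int b + int c)\<^sup>2"
      using 2 by (intro power_mono) auto
    finally have "16 * (m * c) \<le> (a + b + c)\<^sup>2"
      by (metis (mono_tags, lifting) of_nat_add of_nat_le_iff of_nat_mult of_nat_numeral of_nat_power)
    then show ?thesis using n1 by linarith
  next
    case 3
    define d where "d = a + b - c"
    \<comment> \<open>The best point may be a half-integer; the two orientations of faces then round
      it in opposite directions, to \<open>k\<close> and \<open>k + e\<close>.\<close>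
    define k e where "k = d div 2" and "e = d mod 2"
    have d: "d = 2 * k + e" by (simp add: k_def e_def)
    have e: "e = 0 \<or> e = 1" by (auto simp: e_def)
    have le: "k + e \<le> m" using 3 d e by (auto simp: d_def)
    then have le': "k + e \<le> a" "k + e \<le> b" by (auto simp: m_def)
    have c: "int c = int a + int b - 2 * int k - int e" using 3 d by (auto simp: d_def)
    have "int n \<le> int (k * c + (a - k) * (b - k) + ((k + e) * c + (a - (k + e)) * (b - (k + e))))"
      using n[of k "k + e"] by (simp only: of_nat_le_iff)
    also have "\<dots> = int k * int c + (int a - int k) * (int b - int k)
        + ((int k + int e) * int c + (int a - (int k + int e)) * (int b - (int k + int e)))"
      using le' by (simp add: of_nat_diff)
    finally have "6 * int n \<le> 6 * (int k * int c + (int a - int k) * (int b - int k)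
        + ((int k + int e) * int c + (int a - (int k + int e)) * (int b - (int k + int e))))" by simp
    \<comment> \<open>Completion of squares: both squares vanish for \<open>a = b = c\<close>, the
      regular hexagon.\<close>
    also have "\<dots> = (int a + int b + int c)\<^sup>2 + 3 - 3 * (int a - int b)\<^sup>2
        - (int a + int b - 2 * (2 * int k + int e))\<^sup>2 - (3 - 3 * int e)"
      using e unfolding c by (auto simp: power2_eq_square algebra_simps)
    also have "\<dots> \<le> (int a + int b + int c)\<^sup>2 + 3"
      using zero_le_power2[of "int a - int b"] zero_le_power2[of "int a + int b - 2 * (2 * int k + int e)"] e
      by linarith
    finally have "int (6 * n) \<le> int ((a + b + c)\<^sup>2 + 3)" by simp
    then show ?thesis by (simp only: of_nat_le_iff)
  qed
qed

text \<open>A face of the planar lattice is given by the indices of the three strips containing it, normalised so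
  that they sum to \<open>-1\<close> for an upward and to \<open>-2\<close> for a downward face. Decreasing one index of an upward
  face leads to the neighbour across the corresponding edge.\<close>

type_synonym cell = "int \<times> int \<times> int"

definition cells :: "cell set" where
  "cells = {(x, y, z). x + y + z = -1 \<or> x + y + z = -2}"

definition dx :: "cell \<Rightarrow> cell" where "dx = (\<lambda>(x, y, z). (x - 1, y, z))"
definition dy :: "cell \<Rightarrow> cell" where "dy = (\<lambda>(x, y, z). (x, y - 1, z))"
definition dz :: "cell \<Rightarrow> cell" where "dz = (\<lambda>(x, y, z). (x, y, z - 1))"

lemmas d_defs = dx_def dy_def dz_def

definition links :: "cell set \<Rightarrow> nat" where
  "links S = card {v\<in>S. dx v \<in> S} + card {v\<in>S. dy v \<in> S} + card {v\<in>S. dz v \<in> S}"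

definition perim :: "cell set \<Rightarrow> int" where
  "perim S = 3 * int (card S) - 2 * int (links S)"

definition cyc :: "cell \<Rightarrow> cell" where "cyc = (\<lambda>(x, y, z). (y, z, x))"

lemma inj_cyc: "inj cyc" by (auto simp: inj_def cyc_def)

lemma cyc_cells: "cyc ` S \<subseteq> cells \<longleftrightarrow> S \<subseteq> cells"
  by (fastforce simp: cyc_def cells_def)

lemma card_image_steps:
  assumes "inj f" and "\<And>v. e (f v) = f (d v)"
  shows "card {v\<in>f ` S. e v \<in> f ` S} = card {v\<in>S. d v \<in> S}"
proof -
  have "{v\<in>f ` S. e v \<in> f ` S} = f ` {v\<in>S. e (f v) \<in> f ` S}" by blast
  also have "\<dots> = f ` {v\<in>S. d v \<in> S}" by (simp add: assms(2) inj_image_mem_iff[OF assms(1)])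
  finally show ?thesis by (simp add: card_image inj_on_subset[OF assms(1)])
qed

lemma links_cyc:
  "card {v\<in>cyc ` S. dx v \<in> cyc ` S} = card {v\<in>S. dy v \<in> S}"
  "card {v\<in>cyc ` S. dy v \<in> cyc ` S} = card {v\<in>S. dz v \<in> S}"
  "card {v\<in>cyc ` S. dz v \<in> cyc ` S} = card {v\<in>S. dx v \<in> S}"
  by (rule card_image_steps[OF inj_cyc], simp add: cyc_def d_defs split: prod.splits)+

text \<open>Walks along an \<open>x\<close>-strip in one direction, leaving upward faces through a
  \<open>z\<close>-edge and downward faces through a \<open>y\<close>-edge, so that each
  \<open>y\<close>- or \<open>z\<close>-link in the strip is one step.\<close>

definition zigzag :: "cell \<Rightarrow> cell" where
  "zigzag = (\<lambda>(x, y, z). if x + y + z = -1 then (x, y, z - 1) else (x, y + 1, z))"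

lemma x_strips_le:
  assumes "finite S" "S \<subseteq> cells"
  shows "card {v\<in>S. dy v \<in> S} + card {v\<in>S. dz v \<in> S} + card (fst ` S) \<le> card S"
proof -
  have fst_zig: "fst (zigzag v) = fst v" for v by (simp add: zigzag_def split: prod.splits)
  have iter: "\<exists>n. (zigzag ^^ n) v \<notin> S" for v
  proof (rule ccontr)
    assume "\<nexists>n. (zigzag ^^ n) v \<notin> S"
    then have sub: "range (\<lambda>n. (zigzag ^^ n) v) \<subseteq> S" by auto
    \<comment> \<open>This quantity grows by one per step, so every orbit is infinite and must leave
      the finite set \<open>S\<close>.\<close>
    define key :: "cell \<Rightarrow> int" where "key = (\<lambda>(x, y, z). y - z)"
    have "key (zigzag w) = key w + 1" for w by (auto simp: key_def zigzag_def split: prod.splits)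
    then have "key ((zigzag ^^ n) v) = key v + int n" for n by (induction n) auto
    then have "inj (\<lambda>n. (zigzag ^^ n) v)" by (metis (mono_tags, lifting) add_left_cancel injI of_nat_eq_iff)
    then show False using sub assms(1) by (meson finite_imageD finite_subset infinite_UNIV_nat)
  qed
  have up: "v \<in> S \<Longrightarrow> dy v \<in> S \<Longrightarrow> zigzag (dy v) = v" for v
  proof -
    assume "v \<in> S" "dy v \<in> S"
    then have "v \<in> cells" "dy v \<in> cells" using assms(2) by auto
    then show "zigzag (dy v) = v" by (cases v) (auto simp: cells_def dy_def zigzag_def)
  qed
  have "{v\<in>S. zigzag v \<in> S} = {v\<in>S. dz v \<in> S} \<union> dy ` {v\<in>S. dy v \<in> S}"
  proof (intro equalityI subsetI)
    fix v assume v: "v \<in> {v\<in>S. zigzag v \<in> S}"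
    obtain x y z where [simp]: "v = (x, y, z)" by (cases v)
    show "v \<in> {v\<in>S. dz v \<in> S} \<union> dy ` {v\<in>S. dy v \<in> S}"
    proof (cases "x + y + z = -1")
      case True
      then show ?thesis using v by (simp add: zigzag_def dz_def)
    next
      case False
      then have "(x, y + 1, z) \<in> {v\<in>S. dy v \<in> S}" using v by (simp add: zigzag_def dy_def)
      then have "dy (x, y + 1, z) \<in> dy ` {v\<in>S. dy v \<in> S}" by (rule imageI)
      then show ?thesis by (simp add: dy_def)
    qed
  next
    fix v assume v: "v \<in> {v\<in>S. dz v \<in> S} \<union> dy ` {v\<in>S. dy v \<in> S}"
    then show "v \<in> {v\<in>S. zigzag v \<in> S}"
    proof
      assume "v \<in> {v\<in>S. dz v \<in> S}"
      moreover from this have "v \<in> cells" "dz v \<in> cells" using assms(2) by auto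
      then have "zigzag v = dz v" by (cases v) (auto simp: cells_def dz_def zigzag_def)
      ultimately show ?thesis by simp
    qed (auto simp: up)
  qed
  moreover have "{v\<in>S. dz v \<in> S} \<inter> dy ` {v\<in>S. dy v \<in> S} = {}"
  proof -
    have False if "v \<in> cells" "dy v \<in> cells" "dz (dy v) \<in> cells" for v
      using that by (cases v) (auto simp: cells_def d_defs)
    then show ?thesis using assms(2) by blast
  qed
  moreover have "card (dy ` {v\<in>S. dy v \<in> S}) = card {v\<in>S. dy v \<in> S}"
    by (intro card_image) (auto simp: inj_on_def d_defs)
  ultimately have "card {v\<in>S. zigzag v \<in> S} = card {v\<in>S. dz v \<in> S} + card {v\<in>S. dy v \<in> S}"
    using assms(1) by (simp add: card_Un_disjoint)
  moreover have "{v\<in>S. \<exists>n. (zigzag ^^ n) v \<notin> S} = S" using iter by auto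
  ultimately show ?thesis
    using card_succ_stays_le[OF assms(1), of fst zigzag] fst_zig by simp
qed

lemma strips_le_perim:
  assumes "finite S" "S \<subseteq> cells"
  shows "int (card (fst ` S) + card ((fst \<circ> snd) ` S) + card ((snd \<circ> snd) ` S)) \<le> perim S"
proof -
  have "fst \<circ> cyc = fst \<circ> snd" "fst \<circ> cyc \<circ> cyc = snd \<circ> snd" by (auto simp: cyc_def)
  then have "fst ` cyc ` S = (fst \<circ> snd) ` S" "fst ` cyc ` cyc ` S = (snd \<circ> snd) ` S"
    by (metis image_comp)+
  moreover have "card (cyc ` S) = card S" "card (cyc ` cyc ` S) = card S"
    by (metis card_image inj_cyc inj_on_subset subset_UNIV)+
  ultimately have
    "card {v\<in>S. dz v \<in> S} + card {v\<in>S. dx v \<in> S} + card ((fst \<circ> snd) ` S) \<le> card S"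
    "card {v\<in>S. dx v \<in> S} + card {v\<in>S. dy v \<in> S} + card ((snd \<circ> snd) ` S) \<le> card S"
    using x_strips_le[of "cyc ` S"] x_strips_le[of "cyc ` cyc ` S"] assms
    by (simp_all add: links_cyc cyc_cells)
  then show ?thesis using x_strips_le[OF assms] by (simp add: perim_def links_def)
qed

lemma perim_nonneg: "finite S \<Longrightarrow> S \<subseteq> cells \<Longrightarrow> 0 \<le> perim S"
  using strips_le_perim[of S] by linarith

lemma even_perim: "even (perim S + int (card S))"
  by (simp add: perim_def)

text \<open>A face of given orientation is determined by two strip indices, and its third strip is
  met by \<open>S\<close> exactly if \<open>x + y\<close> lies in a reflected copy of
  \<open>C\<close>. Upward and downward faces are counted separately, with independent parameters
  \<open>i\<close> and \<open>j\<close>.\<close>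

lemma isoperimetric_cells:
  assumes "finite S" "S \<subseteq> cells"
  shows "6 * int (card S) \<le> (perim S)\<^sup>2 + 3"
proof -
  define A B C where "A = fst ` S" and "B = (fst \<circ> snd) ` S" and "C = (snd \<circ> snd) ` S"
  have fin: "finite A" "finite B" "finite C" using assms by (auto simp: A_def B_def C_def)
  let ?C = "\<lambda>k. (\<lambda>z. - k - z) ` C"
  have cC: "card (?C k) = card C" for k by (intro card_image) (auto simp: inj_on_def)
  have half: "card {v\<in>S. fst v + fst (snd v) + snd (snd v) = - k}
      \<le> i * card C + (card A - i) * (card B - i)" for k i
  proof -
    have "card {v\<in>S. fst v + fst (snd v) + snd (snd v) = - k}
        \<le> card {(x, y) \<in> A \<times> B. x + y \<in> ?C k}"
    proof (rule card_inj_on_le[of "\<lambda>(x, y, z). (x, y)"])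
      show "inj_on (\<lambda>(x, y, z). (x, y)) {v\<in>S. fst v + fst (snd v) + snd (snd v) = - k}"
        by (auto simp: inj_on_def)
      show "(\<lambda>(x, y, z). (x, y)) ` {v\<in>S. fst v + fst (snd v) + snd (snd v) = - k}
          \<subseteq> {(x, y) \<in> A \<times> B. x + y \<in> ?C k}"
        by (force simp: A_def B_def C_def image_iff)
      show "finite {(x, y) \<in> A \<times> B. x + y \<in> ?C k}"
        by (rule finite_subset[of _ "A \<times> B"]) (use fin in auto)
    qed
    also have "\<dots> \<le> i * card (?C k) + (card A - i) * (card B - i)"
      using fin by (intro card_sum_pairs_le) auto
    finally show ?thesis by (simp add: cC)
  qed
  have "S = {v\<in>S. fst v + fst (snd v) + snd (snd v) = - 1} \<union> {v\<in>S. fst v + fst (snd v) + snd (snd v) = - 2}"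
    using assms(2) by (auto simp: cells_def)
  then have "card S \<le> card {v\<in>S. fst v + fst (snd v) + snd (snd v) = - 1}
      + card {v\<in>S. fst v + fst (snd v) + snd (snd v) = - 2}"
    by (metis (no_types, lifting) card_Un_le)
  then have "card S \<le> i * card C + (card A - i) * (card B - i) + (j * card C + (card A - j) * (card B - j))" for i j
    using half[of 1 i] half[of 2 j] by linarith
  then have "6 * card S \<le> (card A + card B + card C)\<^sup>2 + 3" by (rule six_times_le_square)
  then have "6 * int (card S) \<le> (int (card A + card B + card C))\<^sup>2 + 3"
    by (metis (mono_tags, lifting) of_nat_add of_nat_le_iff of_nat_mult of_nat_numeral of_nat_power)
  also have "(int (card A + card B + card C))\<^sup>2 \<le> (perim S)\<^sup>2"
    using strips_le_perim[OF assms] by (intro power_mono) (auto simp: A_def B_def C_def)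
  finally show ?thesis by simp
qed

section \<open>Optimal growth along a spiral\<close>

lemma card_steps_insert:
  assumes "finite S" "v \<notin> S"
  shows "card {w\<in>S. d w \<in> S} + (if d v \<in> S then 1 else 0) + (if \<exists>u\<in>S. d u = v then 1 else 0)
    \<le> card {w\<in>insert v S. d w \<in> insert v S}"
proof -
  let ?A = "{w\<in>S. d w \<in> S}" and ?B = "if d v \<in> S then {v} else {}" and ?C = "{u\<in>S. d u = v}"
  have "card (?A \<union> ?B \<union> ?C) \<le> card {w\<in>insert v S. d w \<in> insert v S}"
    using assms by (intro card_mono) (auto split: if_splits)
  moreover have "card (?A \<union> ?B \<union> ?C) = card ?A + card ?B + card ?C"
    using assms by (subst card_Un_disjoint; auto)+
  moreover have "(if \<exists>u\<in>S. d u = v then 1 else 0) \<le> card ?C"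
    using assms card_gt_0_iff[of ?C] by (auto simp: Suc_le_eq)
  moreover have "card ?B = (if d v \<in> S then 1 else 0)" by simp
  ultimately show ?thesis by linarith
qed

text \<open>A new face brings three edges, and each link to an old face takes two off the
  balance.\<close>

lemma perim_insert_le:
  assumes "finite S" "v \<notin> S"
  shows "dx v \<in> S \<Longrightarrow> perim (insert v S) \<le> perim S + 1"
    and "dx v \<in> S \<Longrightarrow> dy v \<in> S \<Longrightarrow> perim (insert v S) \<le> perim S - 1"
    and "u \<in> S \<Longrightarrow> dz u = v \<Longrightarrow> perim (insert v S) \<le> perim S + 1"
  using card_steps_insert[OF assms, of dx] card_steps_insert[OF assms, of dy] card_steps_insert[OF assms, of dz]
    assms by (auto simp: perim_def links_def split: if_splits)

text \<open>Optimality is asked of every prefix because the part of a translated droplet already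
  occupied by a configuration may be any subset; it is compared with the prefix of the same
  length.\<close>

definition growth :: "real \<Rightarrow> real \<Rightarrow> real \<Rightarrow> cell list \<Rightarrow> bool" where
  "growth J h G cs \<longleftrightarrow> distinct cs \<and> set cs \<subseteq> cells \<and> (\<forall>k\<le>length cs.
     (\<forall>S\<subseteq>cells. finite S \<and> card S = k \<longrightarrow> perim (set (take k cs)) \<le> perim S) \<and>
     J * perim (set (take k cs)) - h * k \<le> G)"

text \<open>Lower bounds are stored negated, so that the rotation below merely permutes the six
  parameters.\<close>

definition hexbox :: "int \<Rightarrow> int \<Rightarrow> int \<Rightarrow> int \<Rightarrow> int \<Rightarrow> int \<Rightarrow> cell set" where
  "hexbox x0 x1 y0 y1 z0 z1 =
     {(x, y, z) \<in> cells. - x0 \<le> x \<and> x < x1 \<and> - y0 \<le> y \<and> y < y1 \<and> - z0 \<le> z \<and> z < z1}"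

text \<open>\<open>p\<close> is only an upper bound for the perimeter. The parity of
  \<open>n + p\<close> is recorded so that the isoperimetric bound can exclude smaller perimeters in
  steps of two.\<close>

definition grown :: "real \<Rightarrow> real \<Rightarrow> real \<Rightarrow> cell set \<Rightarrow> nat \<Rightarrow> int \<Rightarrow> bool" where
  "grown J h G S n p \<longleftrightarrow> (\<exists>cs. growth J h G cs \<and> set cs = S \<and> length cs = n) \<and> perim S \<le> p \<and> even (int n + p)"

text \<open>The row at level \<open>x\<close>, read from the side \<open>y = - y0\<close>: even
  \<open>k\<close> give upward faces, odd \<open>k\<close> downward ones, and consecutive cells
  share an edge.\<close>

definition bar :: "int \<Rightarrow> int \<Rightarrow> nat \<Rightarrow> cell" where
  "bar x y0 k = (x, - y0 + int (k div 2), - 1 - x + y0 - int ((k + 1) div 2))"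

text \<open>On the new row the bounds \<open>- y0 \<le> y\<close> and \<open>- z0 \<le> z\<close>
  leave \<open>l\<close> upward and \<open>l - 1\<close> downward faces. The inequalities for
  \<open>z0\<close> and \<open>y0\<close> keep the upper bounds from cutting the row.\<close>

lemma hexbox_extend:
  assumes "y0 + z0 = x1 + int l" "- x0 < x1" "z0 \<le> x1 + y1" "y0 \<le> x1 + z1" "1 \<le> l"
  shows "hexbox x0 (x1 + 1) y0 y1 z0 z1 = hexbox x0 x1 y0 y1 z0 z1 \<union> bar x1 y0 ` {..<2 * l - 1}"
proof (intro equalityI subsetI)
  fix v assume v: "v \<in> hexbox x0 (x1 + 1) y0 y1 z0 z1"
  obtain x y z where [simp]: "v = (x, y, z)" by (cases v)
  show "v \<in> hexbox x0 x1 y0 y1 z0 z1 \<union> bar x1 y0 ` {..<2 * l - 1}"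
  proof (cases "x = x1")
    case False
    then show ?thesis using v by (auto simp: hexbox_def)
  next
    case True
    define k where "k = (if x + y + z = -1 then 2 * nat (y + y0) else 2 * nat (y + y0) + 1)"
    have "v = bar x1 y0 k" "k < 2 * l - 1"
      using v True assms by (auto simp: bar_def k_def hexbox_def cells_def)
    then show ?thesis by auto
  qed
next
  fix v assume "v \<in> hexbox x0 x1 y0 y1 z0 z1 \<union> bar x1 y0 ` {..<2 * l - 1}"
  then show "v \<in> hexbox x0 (x1 + 1) y0 y1 z0 z1"
  proof
    assume "v \<in> bar x1 y0 ` {..<2 * l - 1}"
    then obtain k where k: "v = bar x1 y0 k" "k < 2 * l - 1" by auto
    then obtain i where "k = 2 * i \<or> k = 2 * i + 1" by (metis oddE evenE)
    then show ?thesis using k assms by (auto simp: hexbox_def bar_def cells_def)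
  qed (auto simp: hexbox_def)
qed

text \<open>Along the bar the perimeter is at most \<open>p + 1\<close> after an odd and
  \<open>p + 2\<close> after an even positive number of cells. The assumptions \<open>opt\<close>,
  together with parity, give the matching lower bound for every set of the same size, so each prefix
  stays optimal. The energy peaks after two cells, whence the assumption on
  \<open>G\<close>.\<close>

lemma grown_extend:
  assumes g: "grown J h G (hexbox x0 x1 y0 y1 z0 z1) n p"
    and geo: "y0 + z0 = x1 + int l" "- x0 < x1" "z0 \<le> x1 + y1" "y0 \<le> x1 + z1" "1 \<le> l"
    and opt: "6 * (int n + 2) > p\<^sup>2 + 3" "6 * (int n + 1) > (p - 1)\<^sup>2 + 3" "1 \<le> p"
    and en: "J * (p + 2) - h * (n + 2) \<le> G" "0 \<le> h" "h \<le> J"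
    and n': "n' = n + (2 * l - 1)" and p': "p' = p + 1"
  shows "grown J h G (hexbox x0 (x1 + 1) y0 y1 z0 z1) n' p'"
proof -
  let ?B = "hexbox x0 x1 y0 y1 z0 z1"
  obtain cs where cs: "growth J h G cs" "set cs = ?B" "length cs = n" and p: "perim ?B \<le> p" and ev: "even (int n + p)"
    using g by (auto simp: grown_def)
  have finB: "finite ?B" using cs(2) by (metis List.finite_set)
  define m where "m = 2 * l - 1"
  define B where "B k = ?B \<union> bar x1 y0 ` {..<k}" for k
  have BS: "B (Suc k) = insert (bar x1 y0 k) (B k)" for k by (auto simp: B_def lessThan_Suc)
  have inj: "inj (bar x1 y0)"
  proof (rule injI)
    fix i j assume "bar x1 y0 i = bar x1 y0 j"
    then have "i div 2 = j div 2" "(i + 1) div 2 = (j + 1) div 2" by (auto simp: bar_def)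
    moreover have "k = k div 2 + (k + 1) div 2" for k :: nat by simp
    ultimately show "i = j" by metis
  qed
  have notB: "bar x1 y0 k \<notin> ?B" for k by (auto simp: bar_def hexbox_def)
  have new: "bar x1 y0 k \<notin> B k" for k
    using notB[of k] inj by (auto simp: B_def dest: injD)
  have finBk: "finite (B k)" for k using finB by (simp add: B_def)
  have cells: "B k \<subseteq> cells" if "k \<le> m" for k
  proof -
    have "B k \<subseteq> hexbox x0 (x1 + 1) y0 y1 z0 z1"
      using that unfolding hexbox_extend[OF geo] B_def m_def by auto
    then show ?thesis by (auto simp: hexbox_def)
  qed
  have dxin: "dx (bar x1 y0 (2 * i)) \<in> ?B" if "2 * i < m" for i
    using that geo by (auto simp: bar_def dx_def hexbox_def cells_def m_def)
  have dyin: "dy (bar x1 y0 (2 * i + 2)) = bar x1 y0 (2 * i + 1)" for i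
    by (simp add: bar_def dy_def)
  have dzin: "dz (bar x1 y0 (2 * i)) = bar x1 y0 (2 * i + 1)" for i
    by (simp add: bar_def dz_def)
  have perimB: "perim (B k) \<le> p + (if k = 0 then 0 else if odd k then 1 else 2)" if "k \<le> m" for k
    using that
  proof (induction k)
    case 0 then show ?case using p by (simp add: B_def)
  next
    case (Suc k)
    show ?case
    proof (cases "odd k")
      case True
      then obtain i where i: "k = 2 * i + 1" by (elim oddE)
      have "bar x1 y0 (2 * i) \<in> B k" by (auto simp: B_def i)
      then have "perim (B (Suc k)) \<le> perim (B k) + 1"
        unfolding BS using perim_insert_le(3)[OF finBk new, where u = "bar x1 y0 (2 * i)"] dzin[of i] i by simp
      then show ?thesis using Suc True by (auto split: if_splits)
    next
      case False
      then obtain i where i: "k = 2 * i" by auto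
      have dx: "dx (bar x1 y0 k) \<in> B k" using dxin[of i] Suc.prems by (auto simp: B_def i)
      show ?thesis
      proof (cases i)
        case 0
        then show ?thesis using perim_insert_le(1)[OF finBk new dx] Suc i by (simp add: BS)
      next
        case (Suc j)
        then have "k = 2 * j + 2" using i by simp
        then have "dy (bar x1 y0 k) \<in> B k" using dyin[of j] by (auto simp: B_def)
        then show ?thesis
          using perim_insert_le(2)[OF finBk new dx] Suc.IH Suc.prems \<open>k = 2 * j + 2\<close> False by (simp add: BS)
      qed
    qed
  qed
  define ds where "ds = cs @ map (bar x1 y0) [0..<m]"
  have tk: "set (take k ds) = (if k \<le> n then set (take k cs) else B (k - n))" if "k \<le> n + m" for k
    using that cs(2,3) by (auto simp: ds_def B_def take_map)
  have "growth J h G ds" unfolding growth_def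
  proof (intro conjI allI impI ballI)
    show "distinct ds" using cs(1,2) notB inj
      by (auto simp: ds_def growth_def distinct_map intro: inj_on_subset[OF inj])
    show "set ds \<subseteq> cells" using tk[of "n + m"] cells[of m] cs by (auto simp: ds_def B_def)
  next
    fix k S assume k: "k \<le> length ds" and S: "S \<subseteq> cells" "finite S \<and> card S = k"
    show "perim (set (take k ds)) \<le> perim S"
    proof (cases "k \<le> n")
      case True
      then show ?thesis using cs S k tk[of k] by (simp add: growth_def ds_def)
    next
      case False
      define i where "i = k - n"
      have ki: "k = n + i" "1 \<le> i" "i \<le> m" using False k cs(3) by (auto simp: i_def ds_def)
      have iso: "6 * (int n + int i) \<le> (perim S)\<^sup>2 + 3" and ev': "even (perim S + int n + int i)" and nn: "0 \<le> perim S"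
        using isoperimetric_cells[of S] even_perim[of S] perim_nonneg[of S] S ki
        by (auto simp: add.assoc)
      have "p + (if odd i then 1 else 2) \<le> perim S"
      proof (rule ccontr)
        assume c: "\<not> ?thesis"
        show False
        proof (cases "odd i")
          case True
          then have "odd (perim S + p)" using ev ev' by simp
          then have "perim S \<noteq> p" by auto
          then have "perim S \<le> p - 1" using c True by simp
          then have "(perim S)\<^sup>2 \<le> (p - 1)\<^sup>2" using nn by (intro power_mono) auto
          moreover have "6 * (int n + 1) \<le> 6 * (int n + int i)" using ki by simp
          ultimately show False using iso opt(2) by linarith
        next
          case False
          then have "2 \<le> i" using ki by (cases "i = 1") auto
          have "even (perim S + p)" using ev ev' False by simp
          then have "perim S \<noteq> p + 1" by auto
          then have "perim S \<le> p" using c False by simp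
          then have "(perim S)\<^sup>2 \<le> p\<^sup>2" using nn by (intro power_mono) auto
          moreover have "6 * (int n + 2) \<le> 6 * (int n + int i)" using \<open>2 \<le> i\<close> by simp
          ultimately show False using iso opt(1) by linarith
        qed
      qed
      then show ?thesis using perimB[of i] ki tk[of k] by (auto split: if_splits)
    qed
  next
    fix k assume k: "k \<le> length ds"
    show "J * perim (set (take k ds)) - h * k \<le> G"
    proof (cases "k \<le> n")
      case True
      then show ?thesis using cs k tk[of k] by (simp add: growth_def ds_def)
    next
      case False
      define i where "i = k - n"
      have ki: "k = n + i" "1 \<le> i" "i \<le> m" using False k cs(3) by (auto simp: i_def ds_def)
      have P: "perim (set (take k ds)) \<le> p + (if odd i then 1 else 2)" using perimB[of i] ki tk[of k] by auto
      have "real_of_int (perim (set (take k ds))) \<le> real_of_int p + (if odd i then 1 else 2)"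
        using P by (auto split: if_splits)
      then have "J * perim (set (take k ds)) \<le> J * (real_of_int p + (if odd i then 1 else 2))"
        using en by (intro mult_left_mono) auto
      moreover have "J * (real_of_int p + (if odd i then 1 else 2)) - h * k \<le> J * (p + 2) - h * (n + 2)"
      proof (cases "odd i")
        case True
        have "h * (n + 1) \<le> h * k" using ki en by (intro mult_left_mono) auto
        then show ?thesis using True en by (simp add: algebra_simps)
      next
        case False
        then have "2 \<le> i" using ki by (cases "i = 1") auto
        then have "h * (n + 2) \<le> h * k" using ki en by (intro mult_left_mono) auto
        then show ?thesis using False by (simp add: algebra_simps)
      qed
      ultimately show ?thesis using en(1) by linarith
    qed
  qed
  moreover have "set ds = hexbox x0 (x1 + 1) y0 y1 z0 z1"
    unfolding hexbox_extend[OF geo] using cs(2) by (auto simp: ds_def m_def)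
  moreover have "length ds = n'" using cs(3) by (simp add: ds_def n' m_def)
  moreover have "perim (hexbox x0 (x1 + 1) y0 y1 z0 z1) \<le> p'"
    using perimB[of m] geo(5) unfolding hexbox_extend[OF geo] B_def p' by (auto simp: m_def)
  moreover have "even (int n' + p')" using ev geo(5) by (simp add: n' p' of_nat_diff)
  ultimately show ?thesis unfolding grown_def by blast
qed

section \<open>Rotation by sixty degrees\<close>

definition rot :: "cell \<Rightarrow> cell" where "rot = (\<lambda>(x, y, z). (- 1 - y, - 1 - z, - 1 - x))"

lemma inj_rot: "inj rot" by (auto simp: inj_def rot_def)

lemma rot_cells: "rot ` S \<subseteq> cells \<longleftrightarrow> S \<subseteq> cells"
  by (fastforce simp: rot_def cells_def)

text \<open>The rotation exchanges upward and downward faces, so its image traverses a link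
  backwards. One inequality suffices, since a rotated shape only has to inherit an upper bound on
  the perimeter.\<close>

lemma card_image_reversed_steps:
  assumes "inj f" and "inj d" and "\<And>v. e (f (d v)) = f v" and "finite S"
  shows "card {v\<in>S. d v \<in> S} \<le> card {v\<in>f ` S. e v \<in> f ` S}"
proof -
  have "f ` d ` {v\<in>S. d v \<in> S} \<subseteq> {v\<in>f ` S. e v \<in> f ` S}" by (auto simp: assms(3))
  then have "card (f ` d ` {v\<in>S. d v \<in> S}) \<le> card {v\<in>f ` S. e v \<in> f ` S}"
    using assms(4) by (intro card_mono) auto
  then show ?thesis by (simp add: card_image inj_on_subset[OF assms(1)] inj_on_subset[OF assms(2)])
qed

lemma perim_rot_le:
  assumes "finite S"
  shows "perim (rot ` S) \<le> perim S"
proof -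
  have "inj dx" "inj dy" "inj dz" by (auto simp: inj_def d_defs)
  moreover have "dz (rot (dx v)) = rot v" "dx (rot (dy v)) = rot v" "dy (rot (dz v)) = rot v" for v
    by (auto simp: rot_def d_defs split: prod.splits)
  ultimately have "links S \<le> links (rot ` S)"
    using card_image_reversed_steps[OF inj_rot, of dx dz S] card_image_reversed_steps[OF inj_rot, of dy dx S]
      card_image_reversed_steps[OF inj_rot, of dz dy S] assms
    unfolding links_def by simp
  then show ?thesis by (simp add: perim_def card_image inj_on_subset[OF inj_rot])
qed

lemma rot_hexbox: "rot ` hexbox x0 x1 y0 y1 z0 z1 = hexbox y1 y0 z1 z0 x1 x0"
proof (intro equalityI subsetI)
  fix v assume v: "v \<in> hexbox y1 y0 z1 z0 x1 x0"
  obtain x y z where [simp]: "v = (x, y, z)" by (cases v)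
  have "(- 1 - z, - 1 - x, - 1 - y) \<in> hexbox x0 x1 y0 y1 z0 z1" using v by (auto simp: hexbox_def cells_def)
  then have "rot (- 1 - z, - 1 - x, - 1 - y) \<in> rot ` hexbox x0 x1 y0 y1 z0 z1" by (rule imageI)
  then show "v \<in> rot ` hexbox x0 x1 y0 y1 z0 z1" by (simp add: rot_def)
qed (auto simp: rot_def hexbox_def cells_def)

lemma growth_rot:
  assumes "growth J h G cs" "0 \<le> J"
  shows "growth J h G (map rot cs)"
proof -
  have P: "perim (set (take k (map rot cs))) \<le> perim (set (take k cs))" for k
    using perim_rot_le[of "set (take k cs)"] by (simp add: take_map)
  have "J * perim (set (take k (map rot cs))) \<le> J * perim (set (take k cs))" for k
    using P[of k] assms(2) by (intro mult_left_mono) auto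
  then have "J * perim (set (take k (map rot cs))) - h * k \<le> G" if "k \<le> length cs" for k
    using assms(1) that unfolding growth_def by (smt (verit))
  moreover have "distinct (map rot cs)" "set (map rot cs) \<subseteq> cells"
    using assms(1) inj_on_subset[OF inj_rot] by (auto simp: growth_def distinct_map rot_cells)
  moreover have "perim (set (take k (map rot cs))) \<le> perim S"
    if "k \<le> length cs" "S \<subseteq> cells" "finite S \<and> card S = k" for k S
  proof -
    have "perim (set (take k cs)) \<le> perim S" using assms(1) that unfolding growth_def by blast
    then show ?thesis using P[of k] by linarith
  qed
  ultimately show ?thesis unfolding growth_def by (metis length_map)
qed

lemma grown_rot:
  assumes "grown J h G (hexbox x0 x1 y0 y1 z0 z1) n p" "0 \<le> J"
  shows "grown J h G (hexbox y1 y0 z1 z0 x1 x0) n p"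
proof -
  obtain cs where cs: "growth J h G cs" "set cs = hexbox x0 x1 y0 y1 z0 z1" "length cs = n"
    using assms by (auto simp: grown_def)
  have "growth J h G (map rot cs)" by (rule growth_rot[OF cs(1) assms(2)])
  moreover have "set (map rot cs) = hexbox y1 y0 z1 z0 x1 x0" by (simp add: cs(2) rot_hexbox)
  moreover have "perim (hexbox y1 y0 z1 z0 x1 x0) \<le> perim (hexbox x0 x1 y0 y1 z0 z1)"
    using perim_rot_le[of "hexbox x0 x1 y0 y1 z0 z1"] cs(2) by (metis List.finite_set rot_hexbox)
  ultimately show ?thesis using assms(1) cs(3) unfolding grown_def by (metis length_map order_trans)
qed

section \<open>The spiral through hexagons\<close>

definition hexagon :: "nat \<Rightarrow> cell set" where
  "hexagon r = hexbox r r r r r r"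

text \<open>The hexagon of side \<open>r\<close> with three consecutive sides moved out by one. For
  \<open>r = 0\<close> it is a single upward face, the seed of the spiral, whereas
  \<open>hexagon 0\<close> is empty.\<close>

definition trihex :: "nat \<Rightarrow> cell set" where
  "trihex r = hexbox r (r + 1) r (r + 1) (r + 1) r"

lemma trihex_0: "trihex 0 = {(0, 0, -1)}"
  by (auto simp: trihex_def hexbox_def cells_def)

lemma grown_triangle:
  assumes "0 < h" "h \<le> J" "3 * J - h \<le> G"
  shows "grown J h G (trihex 0) 1 3"
proof -
  have e: "{v. v = (0, 0, - 1) \<and> P v} = (if P (0,0,-1) then {(0,0,-1)} else {})" for P :: "cell \<Rightarrow> bool" by auto
  have p: "perim {(0, 0, -1)} = 3" by (simp add: perim_def links_def d_defs e)
  have "growth J h G [(0, 0, -1)]" unfolding growth_def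
  proof (intro conjI allI impI ballI)
    fix k S assume k: "k \<le> length [(0 :: int, 0 :: int, -1 :: int)]" and S: "S \<subseteq> cells" "finite S \<and> card S = k"
    show "perim (set (take k [(0, 0, -1)])) \<le> perim S"
    proof (cases "k = 0")
      case True then show ?thesis using S by (cases "S = {}") auto
    next
      case False
      then have k: "k = 1" using k by simp
      obtain v where "S = {v}" using S k card_1_singletonE by metis
      moreover have "dx v \<noteq> v" "dy v \<noteq> v" "dz v \<noteq> v" by (cases v; simp add: d_defs)+
      then have "links {v} = 0" by (auto simp: links_def)
      ultimately show ?thesis by (simp add: k p) (simp add: perim_def)
    qed
  next
    fix k assume k: "k \<le> length [(0 :: int, 0 :: int, -1 :: int)]"
    then have "k = 0 \<or> k = 1" by auto
    then show "J * perim (set (take k [(0, 0, -1)])) - h * k \<le> G"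
      using assms p by (auto simp: perim_def[of "{}"] links_def)
  qed (auto simp: cells_def)
  moreover have "set [(0, 0, -1)] = trihex 0" by (simp add: trihex_0)
  moreover have "perim (trihex 0) \<le> 3" by (simp add: trihex_0 p)
  ultimately show ?thesis unfolding grown_def by (metis (full_types) One_nat_def even_numeral length_Cons list.size(3) odd_numeral odd_one odd_even_add of_nat_1)
qed

context
  fixes J h G :: real
  assumes Jh: "0 < h" "h \<le> J"
begin

lemma grown_hexagon:
  assumes "grown J h G (trihex r) (6 * r^2 + 6 * r + 1) (6 * int r + 3)"
    and "J * (6 * r + 5) - h * (6 * r^2 + 6 * r + 3) \<le> G"
    and "J * (6 * r + 6) - h * (6 * r^2 + 8 * r + 4) \<le> G"
    and "J * (6 * r + 7) - h * (6 * r^2 + 10 * r + 5) \<le> G"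
  shows "grown J h G (hexagon (r + 1)) (6 * (r + 1)^2) (6 * int (r + 1))"
proof -
  let ?r = "int r"
  have J0: "0 \<le> J" "0 \<le> h" using Jh by auto
  \<comment> \<open>Only the side \<open>x = x1\<close> is ever extended; a rotation before each bar
    brings the next side into that position.\<close>
  have g0: "grown J h G (hexbox (?r + 1) ?r ?r (?r + 1) (?r + 1) ?r) (6 * r^2 + 6 * r + 1) (6 * ?r + 3)"
    using grown_rot[OF assms(1)[unfolded trihex_def] J0(1)] by (simp add: algebra_simps)
  have g1: "grown J h G (hexbox (?r + 1) (?r + 1) ?r (?r + 1) (?r + 1) ?r) (6 * r^2 + 8 * r + 2) (6 * ?r + 4)"
    by (rule grown_extend[OF g0, where l = "r + 1"])
      (use assms(2) Jh in \<open>simp_all add: power2_eq_square algebra_simps\<close>)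
  have g2: "grown J h G (hexbox (?r + 1) ?r ?r (?r + 1) (?r + 1) (?r + 1)) (6 * r^2 + 8 * r + 2) (6 * ?r + 4)"
    by (rule grown_rot[OF g1 J0(1)])
  have g3: "grown J h G (hexbox (?r + 1) (?r + 1) ?r (?r + 1) (?r + 1) (?r + 1)) (6 * r^2 + 10 * r + 3) (6 * ?r + 5)"
    by (rule grown_extend[OF g2, where l = "r + 1"])
      (use assms(3) Jh in \<open>simp_all add: power2_eq_square algebra_simps\<close>)
  have g4: "grown J h G (hexbox (?r + 1) ?r (?r + 1) (?r + 1) (?r + 1) (?r + 1)) (6 * r^2 + 10 * r + 3) (6 * ?r + 5)"
    by (rule grown_rot[OF g3 J0(1)])
  have "grown J h G (hexbox (?r + 1) (?r + 1) (?r + 1) (?r + 1) (?r + 1) (?r + 1)) (6 * (r + 1)^2) (6 * (?r + 1))"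
    by (rule grown_extend[OF g4, where l = "r + 2"])
      (use assms(4) Jh in \<open>simp_all add: power2_eq_square algebra_simps\<close>)
  then show ?thesis by (simp add: hexagon_def add.commute)
qed

lemma grown_trihex:
  assumes "grown J h G (hexagon r) (6 * r^2) (6 * int r)" "1 \<le> r"
    and "J * (6 * r + 2) - h * (6 * r^2 + 2) \<le> G"
    and "J * (6 * r + 3) - h * (6 * r^2 + 2 * r + 1) \<le> G"
    and "J * (6 * r + 4) - h * (6 * r^2 + 4 * r + 2) \<le> G"
  shows "grown J h G (trihex r) (6 * r^2 + 6 * r + 1) (6 * int r + 3)"
proof -
  let ?r = "int r"
  have J0: "0 \<le> J" "0 \<le> h" using Jh by auto
  have g1: "grown J h G (hexbox ?r (?r + 1) ?r ?r ?r ?r) (6 * r^2 + 2 * r - 1) (6 * ?r + 1)"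
    by (rule grown_extend[OF assms(1)[unfolded hexagon_def], where l = "r"])
      (use assms(2,3) Jh in \<open>simp_all add: power2_eq_square algebra_simps of_nat_diff\<close>)
  have g2: "grown J h G (hexbox ?r ?r ?r ?r (?r + 1) ?r) (6 * r^2 + 2 * r - 1) (6 * ?r + 1)"
    by (rule grown_rot[OF g1 J0(1)])
  have g3: "grown J h G (hexbox ?r (?r + 1) ?r ?r (?r + 1) ?r) (6 * r^2 + 4 * r) (6 * ?r + 2)"
    by (rule grown_extend[OF g2, where l = "r + 1"])
      (use assms(2,4) Jh in \<open>simp_all add: power2_eq_square algebra_simps of_nat_diff\<close>)
  have g4: "grown J h G (hexbox ?r ?r ?r (?r + 1) (?r + 1) ?r) (6 * r^2 + 4 * r) (6 * ?r + 2)"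
    by (rule grown_rot[OF g3 J0(1)])
  have "grown J h G (hexbox ?r (?r + 1) ?r (?r + 1) (?r + 1) ?r) (6 * r^2 + 6 * r + 1) (6 * ?r + 3)"
    by (rule grown_extend[OF g4, where l = "r + 1"])
      (use assms(2,5) Jh in \<open>simp_all add: power2_eq_square algebra_simps of_nat_diff\<close>)
  then show ?thesis by (simp add: trihex_def add.commute)
qed

end

section \<open>The highest energy along the spiral\<close>

lemma int_quadratics_nonneg:
  fixes d :: int
  defines "e \<equiv> real_of_int d"
  shows "0 \<le> e * e" "0 \<le> e * (e - 1)" "0 \<le> e * (e + 1)" "0 \<le> (e - 1) * (e - 1)" "0 \<le> (e - 1) * (e - 2)"
proof -
  \<comment> \<open>As real polynomials some of these products are negative between two consecutive
    integers; integrality of \<open>d\<close> excludes that range.\<close>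
  consider "e \<le> -1" | "e = 0" | "e = 1" | "2 \<le> e"
  proof -
    have "d \<le> -1 \<or> d = 0 \<or> d = 1 \<or> 2 \<le> d" by linarith
    then show thesis using that by (auto simp: e_def)
  qed
  then show "0 \<le> e * e" "0 \<le> e * (e - 1)" "0 \<le> e * (e + 1)" "0 \<le> (e - 1) * (e - 1)" "0 \<le> (e - 1) * (e - 2)"
    by (cases; force simp: mult_nonpos_nonpos)+
qed

text \<open>During the bar that follows the optimal shape of perimeter \<open>6r + s\<close>, whose area is
  \<open>6r\<^sup>2 + 2sr + m\<close>, the energy is largest after two cells.\<close>

definition bar_peak :: "real \<Rightarrow> real \<Rightarrow> nat \<Rightarrow> real \<Rightarrow> real \<Rightarrow> real" where
  "bar_peak J h r s m = J * (6 * r + s + 2) - h * (6 * r\<^sup>2 + 2 * s * r + m + 2)"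

text \<open>The six pairs \<open>(s, m)\<close> are the shapes met from one hexagon to the next.
  \<open>Gamma_hex\<close> is itself such a peak: \<open>(5, 3)\<close> with
  \<open>r = r_star\<close> in its first branch, \<open>(1, -1)\<close> with
  \<open>r = r_star + 1\<close> in its second.\<close>

lemma bar_peak_le_Gamma:
  assumes h: "0 < h" and sm: "(s, m) \<in> {(0, 0), (1, -1), (2, 0), (3, 1), (4, 2), (5, 3)}"
  shows "bar_peak J h r s m \<le> Gamma_hex J h"
proof -
  define q where "q = real_of_int (r_star J h)"
  define u where "u = J / h - 2 * q"
  define d where "d = int r - r_star J h"
  define e where "e = real_of_int d"
  have J: "J = h * (2 * q + u)" using h by (simp add: u_def field_simps)
  have del: "delta_hex J h = (u - 1) / 2"
    using h by (simp add: delta_hex_def u_def q_def[symmetric] field_simps)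
  have r: "real r = q + e" by (simp add: q_def e_def d_def)
  have u: "1 \<le> u" "u < 3"
  proof -
    have "J / (2 * h) = J / h / 2" by simp
    then show "1 \<le> u" "u < 3"
      using floor_correct[of "J / (2 * h) - 1 / 2"] unfolding u_def q_def r_star_def by linarith+
  qed
  note quad = int_quadratics_nonneg[of d, folded e_def]
  \<comment> \<open>On each of the intervals from 1 to 2 and from 2 to 3 the difference divided by
    \<open>h\<close> is affine in \<open>u\<close>. \<open>X1\<close>, \<open>X2\<close>,
    \<open>X3\<close> are its values at \<open>u = 1\<close>, \<open>2\<close>, \<open>3\<close>, so
    it is enough to know their signs; \<open>u = 2\<close> is the threshold
    \<open>delta_hex = 1 / 2\<close>.\<close>
  define X1 X2 X3 where
    "X1 = 2 - s - 6 * e + 6 * (e * e) + 2 * (s * e) + m" and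
    "X2 = 7 - 2 * s - 12 * e + 6 * (e * e) + 2 * (s * e) + m" and
    "X3 = 14 - 3 * s - 18 * e + 6 * (e * e) + 2 * (s * e) + m"
  have X: "0 \<le> X1" "0 \<le> X2" "0 \<le> X3"
    using sm quad by (auto simp: X1_def X2_def X3_def algebra_simps)
  show ?thesis
  proof (cases "delta_hex J h < 1 / 2")
    case True
    then have u2: "u < 2" by (simp add: del)
    have G: "Gamma_hex J h = - 6 * q\<^sup>2 * h + 6 * q * J - 10 * q * h + 7 * J - 5 * h"
      using True by (simp add: Gamma_hex_def q_def Let_def)
    have "Gamma_hex J h - bar_peak J h r s m = h * ((2 - u) * X1 + (u - 1) * X2)"
      unfolding G unfolding bar_peak_def J r X1_def X2_def
      by (simp add: power2_eq_square algebra_simps)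
    moreover have "0 \<le> h * ((2 - u) * X1 + (u - 1) * X2)" using X u u2 h by simp
    ultimately show ?thesis by linarith
  next
    case False
    then have u2: "2 \<le> u" by (simp add: del)
    have G: "Gamma_hex J h = - 6 * (q + 1)\<^sup>2 * h + 6 * (q + 1) * J - 2 * (q + 1) * h + 3 * J - h"
      using False by (simp add: Gamma_hex_def q_def Let_def)
    have "Gamma_hex J h - bar_peak J h r s m = h * ((3 - u) * X2 + (u - 2) * X3)"
      unfolding G unfolding bar_peak_def J r X2_def X3_def
      by (simp add: power2_eq_square algebra_simps)
    moreover have "0 \<le> h * ((3 - u) * X2 + (u - 2) * X3)" using X u u2 h by simp
    ultimately show ?thesis by linarith
  qed
qed

lemma three_J_le_Gamma:
  assumes "0 < h" "2 * h \<le> J"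
  shows "3 * J - h \<le> Gamma_hex J h"
  using bar_peak_le_Gamma[OF assms(1), of 1 "-1" J 0] bar_peak_le_Gamma[OF assms(1), of 2 0 J 0] assms
  by (simp add: bar_peak_def)

lemma grown_spiral:
  assumes "0 < h" "2 * h \<le> J"
  shows "grown J h (Gamma_hex J h) (trihex r) (6 * r^2 + 6 * r + 1) (6 * int r + 3)"
    and "grown J h (Gamma_hex J h) (hexagon (r + 1)) (6 * (r + 1)^2) (6 * int (r + 1))"
proof -
  have hJ: "h \<le> J" using assms by simp
  note peak = bar_peak_le_Gamma[OF assms(1), of _ _ J, unfolded bar_peak_def]
  have hex: "grown J h (Gamma_hex J h) (hexagon (r + 1)) (6 * (r + 1)^2) (6 * int (r + 1))"
    if "grown J h (Gamma_hex J h) (trihex r) (6 * r^2 + 6 * r + 1) (6 * int r + 3)" for r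
    by (rule grown_hexagon[OF assms(1) hJ that])
      (use peak[of 3 1 r] peak[of 4 2 r] peak[of 5 3 r] in \<open>simp_all add: algebra_simps\<close>)
  have tri: "grown J h (Gamma_hex J h) (trihex r) (6 * r^2 + 6 * r + 1) (6 * int r + 3)" for r
  proof (induction r)
    case 0
    then show ?case using grown_triangle[OF assms(1) hJ three_J_le_Gamma[OF assms]] by simp
  next
    case (Suc r)
    have g: "grown J h (Gamma_hex J h) (hexagon (Suc r)) (6 * (Suc r)^2) (6 * int (Suc r))"
      using hex[OF Suc] by (simp only: Suc_eq_plus1)
    show ?case
      by (rule grown_trihex[OF assms(1) hJ g])
        (use peak[of 0 0 "Suc r"] peak[of 1 "-1" "Suc r"] peak[of 2 0 "Suc r"] in
          \<open>simp_all add: algebra_simps power2_eq_square\<close>)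
  qed
  show "grown J h (Gamma_hex J h) (trihex r) (6 * r^2 + 6 * r + 1) (6 * int r + 3)" by (rule tri)
  show "grown J h (Gamma_hex J h) (hexagon (r + 1)) (6 * (r + 1)^2) (6 * int (r + 1))" by (rule hex[OF tri])
qed

section \<open>Critical and supercritical droplets that fit on the torus\<close>

lemma card_Lam: "card (Lam L) = 2 * L\<^sup>2"
  by (simp add: Lam_def card_cartesian_product power2_eq_square)

context
  fixes L :: nat and J h :: real
  assumes h: "0 < h" and J: "2 * h \<le> J"
    and delta: "delta_hex J h \<noteq> 1 / 2"
    and large: "(4 * J / h)\<^sup>2 \<le> real (card (Lam L))"
begin

lemma J_gt: "2 < J / h"
proof -
  have "J / h \<noteq> 2"
  proof
    assume "J / h = 2"
    then have "J / (2 * h) = 1" using h by (simp add: divide_simps)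
    then have "r_star J h = 0" "delta_hex J h = 1 / 2" by (simp_all add: r_star_def delta_hex_def)
    then show False using delta by simp
  qed
  moreover have "2 \<le> J / h" using J h by (simp add: field_simps)
  ultimately show ?thesis by simp
qed

lemma L_square: "8 * (J / h)\<^sup>2 \<le> (real L)\<^sup>2"
  using large by (simp add: card_Lam power2_eq_square)

lemma L_ge:
  assumes "0 \<le> x" "x \<le> J / h" "y\<^sup>2 < 8 * x\<^sup>2"
  shows "y < real L"
proof -
  have "x\<^sup>2 \<le> (J / h)\<^sup>2" using assms by (intro power_mono) auto
  then have "y\<^sup>2 < (real L)\<^sup>2" using L_square assms(3) by linarith
  then show ?thesis by (rule power_less_imp_less_base) simp
qed

text \<open>The side \<open>L - 1\<close> leaves a free row and column. With
  \<open>r = \<lfloor>J / h\<rfloor>\<close> the shape \<open>hexagon (r + 1)\<close> always has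
  negative energy, but it needs \<open>2 * r + 3 \<le> L\<close>. For \<open>r = 2\<close> the torus
  may have \<open>L = 6\<close>; there \<open>trihex 2\<close> is already supercritical and
  fits.\<close>

lemma supercritical_shape:
  obtains S :: "cell set" and n :: nat and p w :: int where
    "grown J h (Gamma_hex J h) S n p" "J * p < h * n"
    "S \<subseteq> {(x, y, z). - w \<le> x \<and> x < - w + (int L - 1) \<and> - w \<le> y \<and> y < - w + (int L - 1)}"
proof -
  define r where "r = nat \<lfloor>J / h\<rfloor>"
  have fl: "2 \<le> \<lfloor>J / h\<rfloor>" using J_gt by linarith
  then have r2: "2 \<le> r" unfolding r_def by linarith
  have rJ: "real r \<le> J / h" "J / h < real r + 1" using fl by (auto simp: r_def)
  have Jrh: "r * h \<le> J" "J < (r + 1) * h" using rJ h by (simp_all add: field_simps)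
  have big: "2 * r + 3 \<le> L" if "3 \<le> r"
  proof -
    have "(2 * real r + 2)\<^sup>2 < 8 * (real r)\<^sup>2"
    proof -
      have "3 * real r \<le> real r * real r" using that by (intro mult_right_mono) auto
      moreover have "(2 * real r + 2)\<^sup>2 = 4 * (real r * real r) + 8 * real r + 4"
        by (simp add: power2_eq_square algebra_simps)
      moreover have "3 \<le> real r" using that by simp
      ultimately show ?thesis unfolding power2_eq_square[of "real r"] by linarith
    qed
    also have "8 * (real r)\<^sup>2 \<le> 8 * (J / h)\<^sup>2" using rJ by (intro mult_left_mono power_mono) auto
    also have "\<dots> \<le> (real L)\<^sup>2" by (rule L_square)
    finally have "2 * real r + 2 < real L" by (rule power_less_imp_less_base) simp
    then show ?thesis by linarith
  qed
  show ?thesis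
  proof (cases "J * (6 * r + 3) < h * (6 * r^2 + 6 * r + 1)")
    case True
    have "2 * r + 2 \<le> L"
    proof (cases "r = 2")
      case True
      have "5 < real L" by (rule L_ge[of 2]) (use J_gt in auto)
      then show ?thesis using True by simp
    qed (use big r2 in auto)
    then show ?thesis
      by (intro that[OF grown_spiral(1)[OF h J, of r], of "int r"])
        (use True in \<open>auto simp: trihex_def hexbox_def algebra_simps\<close>)
  next
    case False
    have "2 * r + 3 \<le> L"
    proof (cases "r = 2")
      case True
      have "37 * h \<le> 15 * J" using False True by simp
      then have *: "37 / 15 \<le> J / h" using h by (simp add: field_simps)
      \<comment> \<open>\<open>12 / 5\<close> is a convenient value below \<open>37 / 15\<close>
        with \<open>8 * (12 / 5)\<^sup>2\<close> above \<open>6\<^sup>2\<close>.\<close>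
      have "6 < real L" by (rule L_ge[of "12/5"], simp, use * in linarith, simp add: power2_eq_square)
      then show ?thesis using True by simp
    qed (use big r2 in auto)
    moreover have "J * (6 * (r + 1)) < h * (6 * (r + 1)^2)"
    proof -
      have "J * (6 * (real r + 1)) < ((r + 1) * h) * (6 * (real r + 1))"
        using Jrh(2) by (intro mult_strict_right_mono) auto
      then show ?thesis by (simp add: power2_eq_square algebra_simps)
    qed
    ultimately show ?thesis
      by (intro that[OF grown_spiral(2)[OF h J, of r], of "int r + 1"])
        (auto simp: hexagon_def hexbox_def algebra_simps)
  qed
qed

text \<open>Here \<open>n\<close> and \<open>k\<close> are the area and the perimeter of a critical droplet, and \<open>g\<close> bounds the number
  of full strips per direction that a set of area \<open>n\<close> can contain.\<close>

lemma critical_size: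
  obtains n k g :: nat where "Gamma_hex J h = J * k - h * n" "even (n + k)" "1 \<le> k"
    "6 * int n > (int k - 2)\<^sup>2 + 3" "n \<le> 2 * L * g" "k + 2 * g \<le> 2 * L"
    "\<And>m. L + m < k + g \<Longrightarrow> m\<^sup>2 < 2 * n" "n < 2 * L\<^sup>2" "1 \<le> n"
proof -
  have q0: "0 \<le> r_star J h" using J_gt by (simp add: r_star_def)
  define q where "q = nat (r_star J h)"
  have q: "r_star J h = int q" using q0 by (simp add: q_def)
  have Jq: "J / h = 2 * q + 1 + 2 * delta_hex J h" using h by (simp add: delta_hex_def q)
  have d01: "0 \<le> delta_hex J h" "delta_hex J h < 1" by (simp_all add: delta_hex_def r_star_def) linarith+
  show ?thesis
  proof (cases "delta_hex J h < 1 / 2")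
    case True
    have "0 < real q" using Jq J_gt True by linarith
    then have q1: "1 \<le> q" by simp
    then have qq: "q \<le> q * q" by (cases q) simp_all
    \<comment> \<open>\<open>14 / 5\<close> is a rational just below the square root of 8.\<close>
    have "14 / 5 * real (2 * q + 1) < real L"
    proof (rule L_ge[of "2 * q + 1"])
      show "(14 / 5 * real (2 * q + 1))\<^sup>2 < 8 * (real (2 * q + 1))\<^sup>2"
        by (subst power_mult_distrib) (simp add: power_divide)
    qed (use Jq d01 in auto)
    then have "14 * real (2 * q + 1) < 5 * real L" by simp
    then have "real (14 * (2 * q + 1)) < real (5 * L)" by (simp only: of_nat_mult of_nat_numeral)
    then have "14 * (2 * q + 1) < 5 * L" by (simp only: of_nat_less_iff)
    then have L: "28 * q + 15 \<le> 5 * L" by simp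
    have gL: "q + 1 < L" using L by simp
    have n: "6 * q^2 + 10 * q + 5 \<le> 2 * L * (q + 1)"
    proof -
      have "(28 * q + 15) * (q + 1) \<le> 5 * L * (q + 1)" using L by (rule mult_right_mono) simp
      then show ?thesis by (simp add: power2_eq_square algebra_simps)
    qed
    show ?thesis
    \<comment> \<open>The hexagon of side \<open>q\<close> with five bars and two further
      cells.\<close>
    proof (rule that[of "6 * q + 7" "6 * q^2 + 10 * q + 5" "q + 1"])
      show "Gamma_hex J h = J * real (6 * q + 7) - h * real (6 * q^2 + 10 * q + 5)"
        unfolding Gamma_hex_def Let_def q of_int_of_nat_eq if_P[OF True]
        by (simp add: algebra_simps)
      fix m assume "L + m < 6 * q + 7 + (q + 1)"
      then have "5 * L + 5 * m \<le> 35 * q + 35" by simp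
      then have "5 * m \<le> 7 * q + 24" using L by simp
      then have "(5 * m) * (5 * m) \<le> (7 * q + 24) * (7 * q + 24)" by (intro mult_mono) simp_all
      then have "25 * (m * m) \<le> 49 * (q * q) + 336 * q + 576" by (simp add: algebra_simps)
      then have "25 * (m * m) < 300 * (q * q) + 500 * q + 250" using qq q1 by linarith
      then show "m\<^sup>2 < 2 * (6 * q^2 + 10 * q + 5)" unfolding power2_eq_square by (simp add: distrib_left)
    next
      have "L * (q + 1) < L * L" using gL by (intro mult_strict_left_mono) simp_all
      then have "2 * L * (q + 1) < 2 * L\<^sup>2" by (simp only: power2_eq_square mult.assoc)
      then show "6 * q\<^sup>2 + 10 * q + 5 < 2 * L\<^sup>2" using n by linarith
    next
      show "(int (6 * q + 7) - 2)\<^sup>2 + 3 < 6 * int (6 * q\<^sup>2 + 10 * q + 5)"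
        by (simp add: power2_eq_square algebra_simps)
      show "6 * q + 7 + 2 * (q + 1) \<le> 2 * L" using q1 L by simp
      show "even (6 * q\<^sup>2 + 10 * q + 5 + (6 * q + 7))" by simp
    qed (use n in simp_all)
  next
    case False
    define r where "r = q + 1"
    have r1: "1 \<le> r" by (simp add: r_def)
    then have rr: "r \<le> r * r" by simp
    have "14 / 5 * real (2 * r) < real L"
    proof (rule L_ge[of "2 * r"])
      show "(14 / 5 * real (2 * r))\<^sup>2 < 8 * (real (2 * r))\<^sup>2"
        using r1 by (subst power_mult_distrib) (simp add: power_divide)
      show "real (2 * r) \<le> J / h" using Jq False by (simp add: r_def)
    qed simp
    then have "28 * real r < 5 * real L" by simp
    then have L: "28 * r + 1 \<le> 5 * L" by linarith
    have gL: "r < L" using L by simp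
    have n: "6 * r^2 + 2 * r + 1 \<le> 2 * L * r"
    proof -
      have "(28 * r + 1) * r \<le> 5 * L * r" using L by (rule mult_right_mono) simp
      then have "28 * (r * r) + r \<le> 5 * (L * r)" by (simp add: algebra_simps)
      then have "6 * (r * r) + 2 * r + 1 \<le> 2 * (L * r)" using rr r1 by linarith
      then show ?thesis by (simp add: power2_eq_square algebra_simps)
    qed
    show ?thesis
    \<comment> \<open>The hexagon of side \<open>r = q + 1\<close> with one bar and two further
      cells.\<close>
    proof (rule that[of "6 * r + 3" "6 * r^2 + 2 * r + 1" "r"])
      show "Gamma_hex J h = J * real (6 * r + 3) - h * real (6 * r^2 + 2 * r + 1)"
        unfolding Gamma_hex_def Let_def q of_int_of_nat_eq if_not_P[OF False] r_def
        by (simp add: power2_eq_square algebra_simps)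
      fix m assume "L + m < 6 * r + 3 + r"
      then have "5 * m \<le> 7 * r + 13" using L by linarith
      then have "(5 * m) * (5 * m) \<le> (7 * r + 13) * (7 * r + 13)" by (intro mult_mono) simp_all
      then have "25 * (m * m) \<le> 49 * (r * r) + 182 * r + 169" by (simp add: algebra_simps)
      then have "25 * (m * m) < 300 * (r * r) + 100 * r + 50" using rr r1 by linarith
      then show "m\<^sup>2 < 2 * (6 * r^2 + 2 * r + 1)" unfolding power2_eq_square by (simp add: distrib_left)
    next
      have "2 * L * r < 2 * L\<^sup>2" using gL r1 by (simp add: power2_eq_square)
      then show "6 * r\<^sup>2 + 2 * r + 1 < 2 * L\<^sup>2" using n by linarith
    next
      show "(int (6 * r + 3) - 2)\<^sup>2 + 3 < 6 * int (6 * r\<^sup>2 + 2 * r + 1)"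
        using r1 by (simp add: power2_eq_square algebra_simps)
      show "6 * r + 3 + 2 * r \<le> 2 * L" using r1 L by linarith
      show "even (6 * r\<^sup>2 + 2 * r + 1 + (6 * r + 3))" by simp
    qed (use n in simp_all)
  qed
qed

end

section \<open>Strips on the torus\<close>

abbreviation down :: "site \<Rightarrow> bool" where "down v \<equiv> snd (snd v)"

definition xT :: "nat \<Rightarrow> site \<Rightarrow> site" where "xT L = (\<lambda>(p, q, s). ((p + L - 1) mod L, q, True))"
definition yT :: "nat \<Rightarrow> site \<Rightarrow> site" where "yT L = (\<lambda>(p, q, s). (p, (q + L - 1) mod L, True))"
definition zT :: "nat \<Rightarrow> site \<Rightarrow> site" where "zT L = (\<lambda>(p, q, s). (p, q, True))"

lemmas T_defs = xT_def yT_def zT_def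

text \<open>Listing only links that start at an upward face counts each adjacency once per
  direction.\<close>

definition uplinks :: "(site \<Rightarrow> site) \<Rightarrow> site set \<Rightarrow> site set" where
  "uplinks d S = {v\<in>S. \<not> down v \<and> d v \<in> S}"

definition linksT :: "nat \<Rightarrow> site set \<Rightarrow> nat" where
  "linksT L S = card (uplinks (xT L) S) + card (uplinks (yT L) S) + card (uplinks (zT L) S)"

definition perimT :: "nat \<Rightarrow> site set \<Rightarrow> int" where
  "perimT L S = 3 * int (card S) - 2 * int (linksT L S)"

lemma finite_Lam: "finite (Lam L)" by (simp add: Lam_def)

lemma finite_sites: "S \<subseteq> Lam L \<Longrightarrow> finite S" using finite_Lam finite_subset by blast

lemma pred_mod: "(p :: nat) < L \<Longrightarrow> (p + L - 1) mod L = (if p = 0 then L - 1 else p - 1)"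
  by (cases p) auto

lemma suc_pred_mod: "(p :: nat) < L \<Longrightarrow> Suc ((p + L - Suc 0) mod L) mod L = p"
  using pred_mod[of p L] by (auto simp: mod_Suc)

lemma pred_suc_mod: "(p :: nat) < L \<Longrightarrow> (Suc p mod L + L - Suc 0) mod L = p"
  using pred_mod[of 0 L] pred_mod[of "Suc p" L] by (auto simp: mod_Suc)

text \<open>A strip is a cyclic orbit of \<open>f\<close> of length \<open>2 * L\<close>:
  \<open>lab\<close> names the strip, \<open>co\<close> and \<open>down\<close> give the position in
  it, and two steps advance \<open>co\<close> by one.\<close>

locale strip_family =
  fixes L :: nat and f :: "site \<Rightarrow> site" and lab co :: "site \<Rightarrow> nat"
  assumes f_Lam: "v \<in> Lam L \<Longrightarrow> f v \<in> Lam L"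
    and lab_f: "lab (f v) = lab v"
    and down_f: "down (f v) \<longleftrightarrow> \<not> down v"
    and co_f: "v \<in> Lam L \<Longrightarrow> co (f (f v)) = (co v + 1) mod L"
    and co_less: "v \<in> Lam L \<Longrightarrow> co v < L"
    and inj: "inj_on (\<lambda>v. (lab v, co v, down v)) (Lam L)"
begin

lemma funpow_Lam: "v \<in> Lam L \<Longrightarrow> (f ^^ n) v \<in> Lam L"
  by (induction n) (auto simp: f_Lam)

lemma lab_funpow: "lab ((f ^^ n) v) = lab v"
  by (induction n) (auto simp: lab_f)

lemma even_funpow:
  assumes "v \<in> Lam L"
  shows "co ((f ^^ (2 * k)) v) = (co v + k) mod L \<and> down ((f ^^ (2 * k)) v) = down v"
proof (induction k)
  case 0 then show ?case using co_less[OF assms] by simp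
next
  case (Suc k)
  have "(f ^^ (2 * Suc k)) v = f (f ((f ^^ (2 * k)) v))" by simp
  then show ?case using Suc co_f[OF funpow_Lam[OF assms, of "2 * k"]] by (simp add: down_f mod_simps)
qed

lemma reach_coordinates:
  assumes v: "v \<in> Lam L" and "c < L"
  obtains n where "co ((f ^^ n) v) = c" "down ((f ^^ n) v) = s"
proof -
  have *: "\<exists>n. co ((f ^^ n) w) = c \<and> down ((f ^^ n) w) = down w" if "w \<in> Lam L" for w
  proof (intro exI)
    have "(co w + (c + L - co w)) mod L = c" using co_less[OF that] assms(2) by simp
    then show "co ((f ^^ (2 * (c + L - co w))) w) = c \<and> down ((f ^^ (2 * (c + L - co w))) w) = down w"
      using even_funpow[OF that, of "c + L - co w"] by simp
  qed
  show ?thesis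
  proof (cases "down v = s")
    case True
    then show ?thesis using *[OF v] that by auto
  next
    case False
    obtain n where "co ((f ^^ n) (f v)) = c" "down ((f ^^ n) (f v)) = down (f v)" using *[OF f_Lam[OF v]] by auto
    then show ?thesis using False by (intro that[of "Suc n"]) (auto simp: down_f funpow_swap1)
  qed
qed

lemma reach:
  assumes "v \<in> Lam L" "w \<in> Lam L" "lab v = lab w"
  obtains n where "(f ^^ n) v = w"
proof -
  obtain n where "co ((f ^^ n) v) = co w" "down ((f ^^ n) v) = down w"
    using reach_coordinates[OF assms(1) co_less[OF assms(2)]] .
  then have "(f ^^ n) v = w"
    using inj assms funpow_Lam[OF assms(1)] by (auto simp: inj_on_def lab_funpow)
  then show ?thesis by (rule that)
qed

lemma card_strip_ge:
  assumes v: "v \<in> Lam L"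
  shows "2 * L \<le> card {w\<in>Lam L. lab w = lab v}"
proof -
  have "{0..<L} \<times> (UNIV :: bool set) \<subseteq> (\<lambda>w. (co w, down w)) ` {w\<in>Lam L. lab w = lab v}"
  proof clarify
    fix c s assume "c \<in> {0..<L}"
    then obtain n where "co ((f ^^ n) v) = c" "down ((f ^^ n) v) = s"
      using reach_coordinates[OF v] by auto
    then show "(c, s) \<in> (\<lambda>w. (co w, down w)) ` {w\<in>Lam L. lab w = lab v}"
      using funpow_Lam[OF v] by (intro image_eqI[of _ _ "(f ^^ n) v"]) (auto simp: lab_funpow)
  qed
  then have "card ({0..<L} \<times> (UNIV :: bool set)) \<le> card {w\<in>Lam L. lab w = lab v}"
    by (rule surj_card_le[rotated]) (simp add: finite_Lam)
  then show ?thesis by (simp add: card_cartesian_product)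
qed

definition full :: "site set \<Rightarrow> nat set" where
  "full S = {l \<in> lab ` S. {w\<in>Lam L. lab w = l} \<subseteq> S}"

text \<open>In a strip that is not full the walk reaches a missing site and so leaves
  \<open>S\<close>. Only full strips meet \<open>S\<close> without providing an exit.\<close>

lemma strips_le:
  assumes S: "S \<subseteq> Lam L"
  shows "card {v\<in>S. f v \<in> S} + card (lab ` S) \<le> card S + card (full S)"
proof -
  let ?P = "{v\<in>S. \<exists>n. (f ^^ n) v \<notin> S}"
  have fin: "finite S" using finite_sites[OF S] .
  have "lab ` S \<subseteq> lab ` ?P \<union> full S"
  proof clarify
    fix v assume v: "v \<in> S" "lab v \<notin> full S"
    then have "\<not> {w\<in>Lam L. lab w = lab v} \<subseteq> S" by (simp add: full_def)
    then obtain w where w: "w \<in> Lam L" "lab v = lab w" "w \<notin> S" by fastforce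
    obtain n where "(f ^^ n) v = w" using reach[of v w] w v S by auto
    then show "lab v \<in> lab ` ?P" using v w by blast
  qed
  then have "card (lab ` S) \<le> card (lab ` ?P \<union> full S)"
    using fin by (intro card_mono) (auto simp: full_def)
  also have "\<dots> \<le> card (lab ` ?P) + card (full S)" by (rule card_Un_le)
  finally show ?thesis using card_succ_stays_le[of S lab f, OF fin lab_f] by linarith
qed

lemma full_le:
  assumes S: "S \<subseteq> Lam L"
  shows "2 * L * card (full S) \<le> card S"
proof -
  have fin: "finite S" "finite (full S)" using finite_sites[OF S] by (auto simp: full_def)
  have "2 * L * card (full S) = (\<Sum>l\<in>full S. 2 * L)" by simp
  also have "\<dots> \<le> (\<Sum>l\<in>full S. card {w\<in>Lam L. lab w = l})"
    using S card_strip_ge by (intro sum_mono) (auto simp: full_def)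
  also have "\<dots> = card (\<Union>l\<in>full S. {w\<in>Lam L. lab w = l})"
    using fin finite_Lam by (subst card_UN_disjoint) auto
  also have "\<dots> \<le> card S" using fin by (intro card_mono) (auto simp: full_def)
  finally show ?thesis .
qed

text \<open>Along the strip \<open>f\<close> crosses the \<open>d\<close>-links from the upward to
  the downward face and the \<open>e\<close>-links the other way round.\<close>

lemma card_links:
  assumes S: "S \<subseteq> Lam L"
    and d: "\<And>v. \<not> down v \<Longrightarrow> f v = d v"
    and e: "\<And>v. v \<in> Lam L \<Longrightarrow> \<not> down v \<Longrightarrow> down (e v) \<and> f (e v) = v"
    and e': "\<And>v. v \<in> Lam L \<Longrightarrow> down v \<Longrightarrow> e (f v) = v"
  shows "card {v\<in>S. f v \<in> S} = card (uplinks d S) + card (uplinks e S)"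
proof -
  have fin: "finite S" using finite_sites[OF S] .
  have "{v\<in>S. f v \<in> S} = uplinks d S \<union> e ` uplinks e S"
  proof (intro equalityI subsetI)
    fix v assume v: "v \<in> {v\<in>S. f v \<in> S}"
    show "v \<in> uplinks d S \<union> e ` uplinks e S"
    proof (cases "down v")
      case True
      moreover have "v \<in> Lam L" using v S by auto
      ultimately have "e (f v) = v" by (rule e'[rotated])
      then show ?thesis using v True by (intro UnI2 image_eqI[of _ _ "f v"]) (auto simp: uplinks_def down_f)
    qed (use v d in \<open>auto simp: uplinks_def\<close>)
  qed (use S d e in \<open>auto simp: uplinks_def subset_iff\<close>)
  moreover have "uplinks d S \<inter> e ` uplinks e S = {}" using S e by (auto simp: uplinks_def)
  moreover have "card (e ` uplinks e S) = card (uplinks e S)"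
    by (rule card_image, rule inj_on_inverseI[of _ f]) (use S e in \<open>auto simp: uplinks_def\<close>)
  moreover have "finite (uplinks d S)" "finite (uplinks e S)" using fin by (auto simp: uplinks_def)
  ultimately show ?thesis by (simp add: card_Un_disjoint)
qed

end

definition fX :: "nat \<Rightarrow> site \<Rightarrow> site" where
  "fX L = (\<lambda>(p, q, s). if s then (p, (q + 1) mod L, False) else (p, q, True))"
definition fY :: "nat \<Rightarrow> site \<Rightarrow> site" where
  "fY L = (\<lambda>(p, q, s). if s then ((p + 1) mod L, q, False) else (p, q, True))"
definition fZ :: "nat \<Rightarrow> site \<Rightarrow> site" where
  "fZ L = (\<lambda>(p, q, s). if s then (p, (q + 1) mod L, False) else ((p + L - 1) mod L, q, True))"
text \<open>This is \<open>- 1 - z\<close> modulo \<open>L\<close>, with \<open>z\<close> the third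
  strip index of the planar face.\<close>

definition labZ :: "nat \<Rightarrow> site \<Rightarrow> nat" where
  "labZ L = (\<lambda>(p, q, s). (p + q + of_bool s) mod L)"

lemma mod_add_right_cancel:
  assumes "(p + q) mod L = (p' + q) mod L" "p < L" "p' < (L :: nat)"
  shows "p = p'"
proof -
  have "int p mod int L = int p' mod int L"
  proof -
    have "(int p + int q) mod int L = (int p' + int q) mod int L"
      using assms(1) by (metis of_nat_add of_nat_mod)
    then have "(int p + int q - int q) mod int L = (int p' + int q - int q) mod int L"
      by (rule mod_diff_cong) simp
    then show ?thesis by simp
  qed
  then show ?thesis using assms by simp
qed

definition swap :: "site \<Rightarrow> site" where "swap = (\<lambda>(p, q, s). (q, p, s))"

lemma inj_swap: "inj swap" by (auto simp: inj_def swap_def)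

lemma swap_Lam: "S \<subseteq> Lam L \<Longrightarrow> swap ` S \<subseteq> Lam L"
  by (auto simp: swap_def Lam_def)

lemma perimT_swap: "perimT L (swap ` S) = perimT L S"
proof -
  have "uplinks d (swap ` S) = swap ` uplinks e S" if "\<And>v. d (swap v) = swap (e v)" for d e
  proof -
    have "uplinks d (swap ` S) = swap ` {v\<in>S. \<not> down (swap v) \<and> d (swap v) \<in> swap ` S}" by (auto simp: uplinks_def)
    also have "\<dots> = swap ` uplinks e S"
      by (simp add: that inj_image_mem_iff[OF inj_swap] uplinks_def) (simp add: swap_def split_beta)
    finally show ?thesis .
  qed
  moreover have "xT L (swap v) = swap (yT L v)" "yT L (swap v) = swap (xT L v)" "zT L (swap v) = swap (zT L v)" for v
    by (auto simp: T_defs swap_def split: prod.splits)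
  ultimately have "uplinks (xT L) (swap ` S) = swap ` uplinks (yT L) S" "uplinks (yT L) (swap ` S) = swap ` uplinks (xT L) S"
    "uplinks (zT L) (swap ` S) = swap ` uplinks (zT L) S" by blast+
  then show ?thesis
    by (simp add: perimT_def linksT_def card_image inj_on_subset[OF inj_swap])
qed

context
  fixes L :: nat
  assumes L: "0 < L"
begin

interpretation X: strip_family L "fX L" fst "fst \<circ> snd"
  using L by unfold_locales (auto simp: fX_def Lam_def inj_on_def split: prod.splits)

interpretation Y: strip_family L "fY L" "fst \<circ> snd" fst
  using L by unfold_locales (auto simp: fY_def Lam_def inj_on_def split: prod.splits)

interpretation Z: strip_family L "fZ L" "labZ L" "fst \<circ> snd"
proof
  show "labZ L (fZ L v) = labZ L v" for v
  proof -
    obtain p q s where v: "v = (p, q, s)" by (cases v)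
    have "((p + L - 1) mod L + (q + 1)) mod L = ((p + L - 1) + (q + 1)) mod L"
      by (rule mod_add_left_eq)
    also have "(p + L - 1) + (q + 1) = (p + q) + L" using L by simp
    finally have "((p + L - 1) mod L + (q + 1)) mod L = (p + q) mod L" by simp
    then show ?thesis by (cases s) (simp_all add: v fZ_def labZ_def mod_simps)
  qed
  show "inj_on (\<lambda>v. (labZ L v, (fst \<circ> snd) v, down v)) (Lam L)"
  proof (rule inj_onI)
    fix v w assume vw: "v \<in> Lam L" "w \<in> Lam L"
      "(labZ L v, (fst \<circ> snd) v, down v) = (labZ L w, (fst \<circ> snd) w, down w)"
    obtain p q s p' where *: "v = (p, q, s)" "w = (p', q, s)" using vw(3) by (cases v; cases w) auto
    then have "(p + (q + of_bool s)) mod L = (p' + (q + of_bool s)) mod L"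
      using vw(3) by (simp add: labZ_def add.assoc)
    then have "p = p'" by (rule mod_add_right_cancel) (use vw * in \<open>auto simp: Lam_def\<close>)
    then show "v = w" using * by simp
  qed
qed (use L in \<open>auto simp: fZ_def Lam_def split: prod.splits\<close>)

lemma perimT_strips:
  assumes S: "S \<subseteq> Lam L"
  shows "int (card (fst ` S) + card ((fst \<circ> snd) ` S) + card (labZ L ` S))
    \<le> perimT L S + int (card (X.full S) + card (Y.full S) + card (Z.full S))"
proof -
  have X: "card {v\<in>S. fX L v \<in> S} = card (uplinks (zT L) S) + card (uplinks (yT L) S)"
    by (rule X.card_links[OF S]) (auto simp: fX_def T_defs Lam_def suc_pred_mod pred_suc_mod split: prod.splits if_splits)
  have Y: "card {v\<in>S. fY L v \<in> S} = card (uplinks (zT L) S) + card (uplinks (xT L) S)"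
    by (rule Y.card_links[OF S]) (auto simp: fY_def T_defs Lam_def suc_pred_mod pred_suc_mod split: prod.splits if_splits)
  have Z: "card {v\<in>S. fZ L v \<in> S} = card (uplinks (xT L) S) + card (uplinks (yT L) S)"
    by (rule Z.card_links[OF S]) (auto simp: fZ_def T_defs Lam_def suc_pred_mod pred_suc_mod split: prod.splits if_splits)
  show ?thesis
    using X.strips_le[OF S] Y.strips_le[OF S] Z.strips_le[OF S] X Y Z
    by (simp add: perimT_def linksT_def)
qed

text \<open>Were every \<open>x\<close>-strip met, the perimeter would reach \<open>k\<close>. The
  correction by full strips is at most \<open>g\<close> per direction, because a full strip holds
  \<open>2 * L\<close> sites.\<close>

lemma empty_x_strip:
  assumes S: "S \<subseteq> Lam L" and n: "card S = n" "n \<le> 2 * L * g" and k: "perimT L S < int k" "k + 2 * g \<le> 2 * L"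
    and small: "\<And>m. L + m < k + g \<Longrightarrow> m\<^sup>2 < 2 * n"
  obtains p where "p < L" "p \<notin> fst ` S"
proof (rule ccontr)
  assume "\<not> thesis"
  then have "p \<in> fst ` S" if "p < L" for p using \<open>\<And>p. p < L \<Longrightarrow> p \<notin> fst ` S \<Longrightarrow> thesis\<close> that by blast
  then have all: "fst ` S = {0..<L}" using S by (fastforce simp: Lam_def)
  then have a: "card (fst ` S) = L" by simp
  have full: "card (X.full S) \<le> g" "card (Y.full S) \<le> g" "card (Z.full S) \<le> g"
    using X.full_le[OF S] Y.full_le[OF S] Z.full_le[OF S] n L by (auto intro: order_trans dest: order_trans)
  have fin: "finite S" by (rule finite_sites[OF S])
  have sub: "Y.full S \<subseteq> (fst \<circ> snd) ` S" "Z.full S \<subseteq> labZ L ` S" by (auto simp: Y.full_def Z.full_def)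
  have le: "card (Y.full S) \<le> card ((fst \<circ> snd) ` S)" "card (Z.full S) \<le> card (labZ L ` S)"
    using sub fin by (auto intro!: card_mono)
  note P = perimT_strips[OF S]
  \<comment> \<open>A full strip in a second direction crosses all strips of the third, which gives
    \<open>2 * L\<close> strips with a correction of at most \<open>2 * g\<close>. If neither of the
    other directions has a full strip, too few \<open>y\<close>- and \<open>z\<close>-strips remain
    to hold \<open>n\<close> sites.\<close>
  consider l where "l \<in> Y.full S" | l where "l \<in> Z.full S" | "Y.full S = {}" "Z.full S = {}" by blast
  then show False
  proof cases
    case 1
    have l: "l < L" "{w\<in>Lam L. (fst \<circ> snd) w = l} \<subseteq> S" using 1 S by (auto simp: Y.full_def Lam_def)
    have "{0..<L} \<subseteq> labZ L ` S"
    proof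
      fix c assume "c \<in> {0..<L}"
      then have "labZ L ((c + L - l) mod L, l, False) = c" using l by (simp add: labZ_def mod_simps)
      moreover have "((c + L - l) mod L, l, False) \<in> S" using l L by (auto simp: Lam_def)
      ultimately show "c \<in> labZ L ` S" by (metis image_eqI)
    qed
    then have "L \<le> card (labZ L ` S)" using fin card_mono[of "labZ L ` S" "{0..<L}"] by simp
    then show False using P a le full k by linarith
  next
    case 2
    have l: "l < L" "{w\<in>Lam L. labZ L w = l} \<subseteq> S" using 2 L unfolding Z.full_def by (auto simp: labZ_def)
    have "{0..<L} \<subseteq> (fst \<circ> snd) ` S"
    proof
      fix c assume c: "c \<in> {0..<L}"
      then have "labZ L ((l + L - c) mod L, c, False) = l" using l by (simp add: labZ_def mod_simps)
      then have "((l + L - c) mod L, c, False) \<in> S" using l L c by (auto simp: Lam_def)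
      then show "c \<in> (fst \<circ> snd) ` S" by force
    qed
    then have "L \<le> card ((fst \<circ> snd) ` S)" using fin card_mono[of "(fst \<circ> snd) ` S" "{0..<L}"] by simp
    then show False using P a le full k by linarith
  next
    case 3
    let ?b = "card ((fst \<circ> snd) ` S)" and ?c = "card (labZ L ` S)"
    have "card S \<le> card ((labZ L ` S) \<times> ((fst \<circ> snd) ` S) \<times> (UNIV :: bool set))"
      by (rule card_inj_on_le[OF inj_on_subset[OF Z.inj S]]) (use fin in \<open>force, simp\<close>)
    then have "n \<le> 2 * ?b * ?c" by (simp add: card_cartesian_product n ac_simps)
    moreover have "L + (?b + ?c) < k + g" using P a full k 3 by simp
    then have "(?b + ?c)\<^sup>2 < 2 * n" by (rule small)
    moreover have "4 * (int ?b * int ?c) \<le> (int ?b + int ?c)\<^sup>2"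
      using zero_le_power2[of "int ?b - int ?c"] by (simp add: power2_eq_square algebra_simps)
    then have "int (4 * (?b * ?c)) \<le> int ((?b + ?c)\<^sup>2)" by simp
    then have "4 * (?b * ?c) \<le> (?b + ?c)\<^sup>2" by (simp only: of_nat_le_iff)
    ultimately show False by simp
  qed
qed

lemma empty_y_strip:
  assumes S: "S \<subseteq> Lam L" and n: "card S = n" "n \<le> 2 * L * g" and k: "perimT L S < int k" "k + 2 * g \<le> 2 * L"
    and small: "\<And>m. L + m < k + g \<Longrightarrow> m\<^sup>2 < 2 * n"
  obtains q where "q < L" "q \<notin> (fst \<circ> snd) ` S"
proof -
  have "fst \<circ> swap = fst \<circ> snd" by (auto simp: swap_def)
  then have "fst ` swap ` S = (fst \<circ> snd) ` S" by (metis image_comp)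
  moreover have "card (swap ` S) = n" using n by (simp add: card_image inj_on_subset[OF inj_swap])
  ultimately show thesis
    using empty_x_strip[OF swap_Lam[OF S] _ n(2) _ k(2) small] that k(1) by (metis perimT_swap)
qed

end

section \<open>Energy barriers on the torus\<close>

text \<open>The covering map from the plane to the torus, after a translation by
  \<open>(u, v)\<close>; the index \<open>z\<close> survives only through the orientation.\<close>

definition phi :: "nat \<Rightarrow> int \<Rightarrow> int \<Rightarrow> cell \<Rightarrow> site" where
  "phi L u v = (\<lambda>(x, y, z). (nat ((x + u) mod int L), nat ((y + v) mod int L), x + y + z = - 2))"

definition window :: "int \<Rightarrow> int \<Rightarrow> int \<Rightarrow> cell set" where
  "window l a b = {(x, y, z) \<in> cells. a \<le> x \<and> x < a + l \<and> b \<le> y \<and> y < b + l}"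

lemma window_cells: "window l a b \<subseteq> cells" by (auto simp: window_def)

lemma mod_eq_window:
  fixes x y a l :: int
  assumes "(x + u) mod l = (y + u) mod l" "a \<le> x" "x < a + l" "a \<le> y" "y < a + l"
  shows "x = y"
proof -
  have "(x + u - u) mod l = (y + u - u) mod l" using assms(1) by (intro mod_diff_cong) auto
  then have "l dvd x - y" by (simp add: mod_eq_dvd_iff)
  moreover have "\<bar>x - y\<bar> < l" using assms by linarith
  ultimately show ?thesis using dvd_imp_le_int[of "x - y" l] by (cases "x = y") auto
qed

lemma inj_on_phi: "inj_on (phi L u v) (window (int L) a b)"
proof (rule inj_onI)
  fix c c' assume c: "c \<in> window (int L) a b" "c' \<in> window (int L) a b" "phi L u v c = phi L u v c'"
  obtain x y z x' y' z' where cc: "c = (x, y, z)" "c' = (x', y', z')" by (cases c; cases c')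
  have L: "int L > 0" using c(1) by (auto simp: window_def)
  have "(x + u) mod int L = (x' + u) mod int L" "(y + v) mod int L = (y' + v) mod int L"
    "x + y + z = - 2 \<longleftrightarrow> x' + y' + z' = - 2"
    using c(3) L by (auto simp: phi_def cc nat_eq_iff)
  moreover from this have "x = x'" "y = y'"
    using mod_eq_window[of x u "int L" x' a] mod_eq_window[of y v "int L" y' b] c by (auto simp: window_def cc)
  ultimately show "c = c'" using c by (auto simp: window_def cc cells_def)
qed

lemma nat_mod_pred:
  assumes "0 < L"
  shows "nat ((x - 1) mod int L) = (nat (x mod int L) + L - 1) mod L"
proof -
  have "int ((nat (x mod int L) + L - 1) mod L) = (x mod int L + (int L - 1)) mod int L"
    using assms by (simp add: of_nat_mod of_nat_diff algebra_simps)
  also have "\<dots> = (x + (int L - 1)) mod int L" by (rule mod_add_left_eq)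
  also have "x + (int L - 1) = x - 1 + int L" by simp
  also have "(x - 1 + int L) mod int L = (x - 1) mod int L" by simp
  finally show ?thesis by (metis nat_int)
qed

lemma phi_step:
  assumes "0 < L" "c \<in> cells" "\<not> down (phi L u v c)"
  shows "phi L u v (dx c) = xT L (phi L u v c)" "phi L u v (dy c) = yT L (phi L u v c)"
    "phi L u v (dz c) = zT L (phi L u v c)"
proof -
  obtain x y z where c: "c = (x, y, z)" by (cases c)
  have up: "x + y + z = - 1" using assms by (auto simp: c cells_def phi_def)
  have "nat ((x - 1 + u) mod int L) = (nat ((x + u) mod int L) + L - 1) mod L"
    "nat ((y - 1 + v) mod int L) = (nat ((y + v) mod int L) + L - 1) mod L"
    using nat_mod_pred[OF assms(1), of "x + u"] nat_mod_pred[OF assms(1), of "y + v"] by (simp_all only: diff_add_eq)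
  moreover have "x - 1 + y + z = - 2" "x + (y - 1) + z = - 2" "x + y + (z - 1) = - 2" using up by linarith+
  ultimately show "phi L u v (dx c) = xT L (phi L u v c)" "phi L u v (dy c) = yT L (phi L u v c)"
    "phi L u v (dz c) = zT L (phi L u v c)"
    unfolding c phi_def d_defs T_defs prod.case by (simp_all only: simp_thms)
qed

lemma perimT_phi:
  assumes L: "0 < L" and S: "S \<subseteq> window (int L - 1) a b"
  shows "perimT L (phi L u v ` S) = perim S" "card (phi L u v ` S) = card S"
proof -
  \<comment> \<open>Enlarged by one row and one column, the window contains the lower neighbours of
    \<open>S\<close>, and \<open>phi\<close> is still injective on it. Hence wrapping around creates
    no new links.\<close>
  let ?W = "window (int L) (a - 1) (b - 1)"
  have W: "c \<in> ?W \<and> (\<not> down (phi L u v c) \<longrightarrow> dx c \<in> ?W \<and> dy c \<in> ?W \<and> dz c \<in> ?W)" if "c \<in> S" for c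
  proof -
    obtain x y z where c: "c = (x, y, z)" by (cases c)
    then have "x + y + z = - 1 \<or> x + y + z = - 2" "a \<le> x" "x < a + (int L - 1)" "b \<le> y" "y < b + (int L - 1)"
      using that S by (auto simp: window_def cells_def)
    then show ?thesis by (elim disjE) (simp_all add: c window_def cells_def phi_def d_defs)
  qed
  then have SW: "S \<subseteq> ?W"
    and dW: "\<And>c. c \<in> S \<Longrightarrow> \<not> down (phi L u v c) \<Longrightarrow> dx c \<in> ?W \<and> dy c \<in> ?W \<and> dz c \<in> ?W"
    by auto
  have inj: "inj_on (phi L u v) S" using inj_on_subset[OF inj_on_phi SW] .
  then show card: "card (phi L u v ` S) = card S" by (rule card_image)
  have up: "\<not> down (phi L u v c)" if "c \<in> cells" "d c \<in> cells" "d \<in> {dx, dy, dz}" for c d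
    using that by (cases c) (auto simp: phi_def d_defs cells_def)
  have "uplinks t (phi L u v ` S) = phi L u v ` {c\<in>S. d c \<in> S}"
    if dt: "(d, t) \<in> {(dx, xT L), (dy, yT L), (dz, zT L)}" for d t
  proof -
    have ph: "phi L u v (d c) = t (phi L u v c)" if "c \<in> S" "\<not> down (phi L u v c)" for c
      using dt that phi_step[OF L _ that(2)] S window_cells by blast
    have mem: "d c \<in> S \<longleftrightarrow> phi L u v (d c) \<in> phi L u v ` S" if "c \<in> S" "\<not> down (phi L u v c)" for c
      by (rule inj_on_image_mem_iff[OF inj_on_phi _ SW, symmetric]) (use dW[OF that] dt in auto)
    have dn: "c \<in> S \<Longrightarrow> d c \<in> S \<Longrightarrow> \<not> down (phi L u v c)" for c
      using up[of c d] dt S window_cells by blast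
    have "uplinks t (phi L u v ` S) = phi L u v ` {c\<in>S. \<not> down (phi L u v c) \<and> t (phi L u v c) \<in> phi L u v ` S}"
      unfolding uplinks_def by blast
    also have "{c\<in>S. \<not> down (phi L u v c) \<and> t (phi L u v c) \<in> phi L u v ` S} = {c\<in>S. d c \<in> S}"
      using ph mem dn by metis
    finally show ?thesis .
  qed
  then have cards: "card (uplinks t (phi L u v ` S)) = card {c\<in>S. d c \<in> S}"
    if "(d, t) \<in> {(dx, xT L), (dy, yT L), (dz, zT L)}" for d t
    using that by (metis (no_types, lifting) card_image inj inj_on_subset mem_Collect_eq subsetI)
  show "perimT L (phi L u v ` S) = perim S"
    using cards[of dx "xT L"] cards[of dy "yT L"] cards[of dz "zT L"]
    by (simp add: perimT_def perim_def linksT_def links_def card)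
qed

text \<open>The torus is cut open along a missed row and a missed column; coordinates before the cut
  are shifted by \<open>L\<close>.\<close>

lemma unwrap:
  assumes S: "S \<subseteq> Lam L" and p: "p < L" "p \<notin> fst ` S" and q: "q < L" "q \<notin> (fst \<circ> snd) ` S"
  obtains S' where "S' \<subseteq> window (int L - 1) (int p + 1) (int q + 1)" "phi L 0 0 ` S' = S"
proof
  let ?W = "window (int L - 1) (int p + 1) (int q + 1)"
  define S' where "S' = {c\<in>?W. phi L 0 0 c \<in> S}"
  show "S' \<subseteq> ?W" by (auto simp: S'_def)
  have "v \<in> phi L 0 0 ` S'" if v: "v \<in> S" for v
  proof -
    obtain i j s where vs: "v = (i, j, s)" by (cases v)
    have ij: "i < L" "j < L" "i \<noteq> p" "j \<noteq> q" using v S p q by (force simp: vs Lam_def)+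
    define x where "x = (if i < p then int i + int L else int i)"
    define y where "y = (if j < q then int j + int L else int j)"
    define c where "c = (x, y, (if s then - 2 else - 1) - x - y)"
    have "phi L 0 0 c = v" using ij by (auto simp: phi_def c_def x_def y_def vs)
    moreover have "c \<in> ?W" using ij p q by (auto simp: window_def c_def x_def y_def cells_def)
    ultimately show ?thesis using v by (force simp: S'_def)
  qed
  then show "phi L 0 0 ` S' = S" by (auto simp: S'_def)
qed

definition energy :: "nat \<Rightarrow> real \<Rightarrow> real \<Rightarrow> site set \<Rightarrow> real" where
  "energy L J h S = J * perimT L S - h * card S"

text \<open>A link inside \<open>S\<close> or inside \<open>T\<close> is inside the union, and one
  inside both is inside the intersection, so links are supermodular, while cardinality is
  modular.\<close>

lemma perimT_submodular:
  assumes "finite S" "finite T"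
  shows "perimT L (S \<union> T) + perimT L (S \<inter> T) \<le> perimT L S + perimT L T"
proof -
  have *: "card (uplinks d S) + card (uplinks d T) \<le> card (uplinks d (S \<union> T)) + card (uplinks d (S \<inter> T))" for d
  proof -
    have fin: "finite (uplinks d S)" "finite (uplinks d T)" "finite (uplinks d (S \<union> T))" "finite (uplinks d (S \<inter> T))"
      using assms by (auto simp: uplinks_def)
    have "card (uplinks d S) + card (uplinks d T) = card (uplinks d S \<union> uplinks d T) + card (uplinks d S \<inter> uplinks d T)"
      using fin by (intro card_Un_Int)
    also have "\<dots> \<le> card (uplinks d (S \<union> T)) + card (uplinks d (S \<inter> T))"
      by (intro add_mono card_mono fin) (auto simp: uplinks_def)
    finally show ?thesis .
  qed
  have "linksT L S + linksT L T \<le> linksT L (S \<union> T) + linksT L (S \<inter> T)"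
    using *[of "xT L"] *[of "yT L"] *[of "zT L"] by (simp add: linksT_def)
  then show ?thesis using card_Un_Int[OF assms] by (simp add: perimT_def)
qed

lemma energy_submodular:
  assumes "finite S" "finite T" "0 \<le> J"
  shows "energy L J h (S \<union> T) + energy L J h (S \<inter> T) \<le> energy L J h S + energy L J h T"
proof -
  have "J * real_of_int (perimT L (S \<union> T) + perimT L (S \<inter> T)) \<le> J * real_of_int (perimT L S + perimT L T)"
    using perimT_submodular[OF assms(1,2), of L] assms(3) by (intro mult_left_mono) auto
  moreover have "h * real (card S + card T) = h * real (card (S \<union> T) + card (S \<inter> T))"
    using card_Un_Int[OF assms(1,2)] by simp
  ultimately show ?thesis by (simp add: energy_def algebra_simps)
qed

lemma energy_phi:
  assumes "0 < L" "S \<subseteq> window (int L - 1) a b"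
  shows "energy L J h (phi L u v ` S) = J * perim S - h * card S"
  using perimT_phi[OF assms] by (simp add: energy_def)

text \<open>Sites are only added, as all paths lead up to the full set. Both ends of a step stay
  below the level, because the conductance of an edge is governed by the higher end.\<close>

definition grow :: "nat \<Rightarrow> real \<Rightarrow> real \<Rightarrow> real \<Rightarrow> site set rel" where
  "grow L J h c = {(A, insert x A) | A x. A \<subseteq> Lam L \<and> x \<in> Lam L - A \<and>
     energy L J h A \<le> c \<and> energy L J h (insert x A) \<le> c}"

lemma grow_mono: "c \<le> c' \<Longrightarrow> grow L J h c \<subseteq> grow L J h c'"
  by (force simp: grow_def)

context
  fixes L :: nat and J h :: real
  assumes h: "0 < h" and J: "2 * h \<le> J"
    and delta: "delta_hex J h \<noteq> 1 / 2"
    and large: "(4 * J / h)\<^sup>2 \<le> real (card (Lam L))"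
begin

lemma L_pos: "0 < L"
proof -
  have "0 < J / h" using J_gt[OF h J delta large] by linarith
  then have "0 < (J / h)\<^sup>2" by (rule zero_less_power)
  then have "0 < (real L)\<^sup>2" using L_square[OF h J delta large] by linarith
  then show ?thesis by simp
qed

lemma critical_barrier:
  obtains n where "1 \<le> n" "n < 2 * L\<^sup>2"
    "\<And>S. S \<subseteq> Lam L \<Longrightarrow> card S = n \<Longrightarrow> Gamma_hex J h \<le> energy L J h S"
proof -
  obtain n k g :: nat where G: "Gamma_hex J h = J * k - h * n" "even (n + k)" "1 \<le> k"
    "6 * int n > (int k - 2)\<^sup>2 + 3" "n \<le> 2 * L * g" "k + 2 * g \<le> 2 * L"
    "\<And>m. L + m < k + g \<Longrightarrow> m\<^sup>2 < 2 * n" "n < 2 * L\<^sup>2" "1 \<le> n"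
    using critical_size[OF h J delta large] by metis
  have "Gamma_hex J h \<le> energy L J h S" if S: "S \<subseteq> Lam L" "card S = n" for S
  proof -
    have "int k \<le> perimT L S"
    proof (rule ccontr)
      assume "\<not> ?thesis"
      then have lt: "perimT L S < int k" by simp
      obtain p where p: "p < L" "p \<notin> fst ` S" using empty_x_strip[OF L_pos S G(5) lt G(6,7)] .
      obtain q where q: "q < L" "q \<notin> (fst \<circ> snd) ` S" using empty_y_strip[OF L_pos S G(5) lt G(6,7)] .
      obtain S' where S': "S' \<subseteq> window (int L - 1) (int p + 1) (int q + 1)" "phi L 0 0 ` S' = S"
        using unwrap[OF S(1) p q] .
      have pe: "perim S' = perimT L S" "card S' = n" using perimT_phi[OF L_pos S'(1), of 0 0] S' S by auto
      have fin: "finite S'" using pe(2) G(9) card_ge_0_finite by force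
      have sub: "S' \<subseteq> cells" using S' window_cells by blast
      have ev: "even (perim S' + int n)" using even_perim[of S'] pe by simp
      \<comment> \<open>Perimeter and area have the same parity, so a perimeter below
        \<open>k\<close> is at most \<open>k - 2\<close>, against the isoperimetric
        inequality.\<close>
      have "perim S' \<noteq> int k - 1"
      proof
        assume "perim S' = int k - 1"
        then have "int (n + k) = (perim S' + int n) + 1" by simp
        moreover have "odd ((perim S' + int n) + 1)" using ev by simp
        ultimately show False using G(2) by (metis even_of_nat)
      qed
      then have "perim S' \<le> int k - 2" using lt pe by linarith
      then have "(perim S')\<^sup>2 \<le> (int k - 2)\<^sup>2" using perim_nonneg[OF fin sub] by (intro power_mono) auto
      then show False using isoperimetric_cells[OF fin sub] pe G(4) by linarith
    qed
    then have "J * k \<le> J * perimT L S" using J h by (intro mult_left_mono) auto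
    then show ?thesis using S by (simp add: G(1) energy_def)
  qed
  then show thesis using G that by blast
qed

text \<open>As long as the overlap has nonnegative energy, adding a prefix of the droplet raises the
  energy by at most the energy of that prefix: never more than \<open>Gamma_hex\<close>, and a
  negative amount at the end.\<close>

lemma lower_energy_reachable:
  assumes S: "S \<subset> Lam L"
  obtains S' where "S \<subset> S'" "S' \<subseteq> Lam L" "energy L J h S' < energy L J h S"
    "(S, S') \<in> (grow L J h (energy L J h S + Gamma_hex J h))\<^sup>*"
proof -
  let ?G = "Gamma_hex J h" and ?F = "energy L J h"
  obtain T n p w where T: "grown J h ?G T n p" "J * p < h * n"
    "T \<subseteq> {(x, y, z). - w \<le> x \<and> x < - w + (int L - 1) \<and> - w \<le> y \<and> y < - w + (int L - 1)}"
    by (rule supercritical_shape[OF h J delta large])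
  obtain cs where cs: "growth J h ?G cs" "set cs = T" "length cs = n" and pT: "perim T \<le> p"
    using T(1) by (auto simp: grown_def)
  define e where "e k = J * perim (set (take k cs)) - h * k" for k
  have dist: "distinct cs" and cells: "set cs \<subseteq> cells" and eG: "\<And>k. k \<le> n \<Longrightarrow> e k \<le> ?G"
    and opt: "\<And>k S. k \<le> n \<Longrightarrow> S \<subseteq> cells \<Longrightarrow> finite S \<Longrightarrow> card S = k \<Longrightarrow> perim (set (take k cs)) \<le> perim S"
    using cs unfolding growth_def e_def by simp_all
  have "T \<subseteq> window (int L - 1) (- w) (- w)"
    using T(3) cells cs(2) by (auto simp: window_def)
  then have win: "set (take k cs) \<subseteq> window (int L - 1) (- w) (- w)" for k
    using cs(2) set_take_subset[of k cs] by simp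
  have "J * perim T \<le> J * p" using pT J h by (intro mult_left_mono) auto
  then have "e n < 0" using T(2) cs by (simp add: e_def)
  \<comment> \<open>Stopping at the first prefix of negative energy makes every piece with fewer
    than \<open>k0\<close> cells nonnegative, by optimality of the shorter prefixes.\<close>
  define k0 where "k0 = (LEAST k. e k < 0)"
  have k0: "e k0 < 0" "k0 \<le> n"
    unfolding k0_def by (rule LeastI[of "\<lambda>k. e k < 0", OF \<open>e n < 0\<close>]) (rule Least_le[of "\<lambda>k. e k < 0", OF \<open>e n < 0\<close>])
  have pos: "0 \<le> e k" if "k < k0" for k
    using not_less_Least[of k "\<lambda>k. e k < 0"] that unfolding k0_def by simp
  have cardt: "card (set (take k cs)) = k" if "k \<le> k0" for k
    using that k0 dist cs(3) by (simp add: distinct_card distinct_take)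
  have low: "0 \<le> J * perim S - h * card S" if "S \<subseteq> set (take k0 cs)" "card S < k0" for S
  proof -
    have "finite S" using that(1) by (rule finite_subset) simp
    moreover have "S \<subseteq> cells" using that(1) cells set_take_subset[of k0 cs] by blast
    ultimately have "perim (set (take (card S) cs)) \<le> perim S" using that(2) k0 by (intro opt) auto
    then have "J * perim (set (take (card S) cs)) \<le> J * perim S" using J h by (intro mult_left_mono) auto
    then show ?thesis using pos[OF that(2)] by (simp add: e_def)
  qed
  \<comment> \<open>Translations preserve orientation, so a missing site can only be covered by a
    cell of its own kind. A droplet with a single orientation would have no links and thus no
    negative energy.\<close>
  have both: "\<exists>(a, b, c) \<in> set (take k0 cs). (a + b + c = - 2) = s" for s
  proof (rule ccontr)
    assume c: "\<not> ?thesis"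
    have sub: "set (take k0 cs) \<subseteq> cells" using cells set_take_subset[of k0 cs] by blast
    have type: "x + y + z = (if s then - 1 else - 2)" if m: "(x, y, z) \<in> set (take k0 cs)" for x y z
    proof -
      have "(x + y + z = - 2) \<noteq> s" using c m by blast
      moreover have "(x, y, z) \<in> cells" using m sub by blast
      ultimately show ?thesis by (cases s) (auto simp: cells_def)
    qed
    have "dx c \<notin> set (take k0 cs)" "dy c \<notin> set (take k0 cs)" "dz c \<notin> set (take k0 cs)"
      if "c \<in> set (take k0 cs)" for c
    proof -
      obtain x y z where xyz: "c = (x, y, z)" by (cases c)
      note t = type[of x y z] type[of "x - 1" y z] type[of x "y - 1" z] type[of x y "z - 1"]
      show "dx c \<notin> set (take k0 cs)" "dy c \<notin> set (take k0 cs)" "dz c \<notin> set (take k0 cs)"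
        using t that unfolding xyz d_defs prod.case by linarith+
    qed
    then have "links (set (take k0 cs)) = 0" by (auto simp: links_def)
    then have "e k0 = (3 * J - h) * k0" using cardt[of k0] by (simp add: e_def perim_def algebra_simps)
    moreover have "0 \<le> (3 * J - h) * k0" using h J by (intro mult_nonneg_nonneg) auto
    ultimately show False using k0 by simp
  qed
  obtain i j s where x: "(i, j, s) \<in> Lam L - S" using S by auto
  obtain a b c where abc: "(a, b, c) \<in> set (take k0 cs)" "(a + b + c = - 2) = s" using both[of s] by auto
  define u v where "u = int i - a" and "v = int j - b"
  have phx: "phi L u v (a, b, c) = (i, j, s)" using x abc by (auto simp: phi_def u_def v_def Lam_def)
  define W where "W k = phi L u v ` set (take k cs)" for k
  have WL: "W k \<subseteq> Lam L" for k using L_pos by (auto simp: W_def phi_def Lam_def nat_less_iff)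
  have FW: "?F (W k) = e k" if "k \<le> k0" for k
    using energy_phi[OF L_pos win] cardt[OF that] by (simp add: W_def e_def)
  have FI: "?F (S \<union> W k) \<le> ?F S + e k" if "k \<le> k0" for k
  proof -
    define V where "V = {c\<in>set (take k cs). phi L u v c \<in> S}"
    have V: "S \<inter> W k = phi L u v ` V" by (auto simp: V_def W_def)
    have sub: "V \<subseteq> set (take k cs)" by (auto simp: V_def)
    have sub': "set (take k cs) \<subseteq> set (take k0 cs)" by (rule set_take_subset_set_take[OF that])
    \<comment> \<open>At \<open>k = k0\<close> the overlap is a proper part of the droplet because
      the translate covers the site \<open>(i, j, s)\<close> outside \<open>S\<close>.\<close>
    have "card V < k0"
    proof (cases "k = k0")
      case True
      have "(a, b, c) \<notin> V" using x phx by (auto simp: V_def)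
      then have "V \<subset> set (take k0 cs)" using abc sub True by blast
      then have "card V < card (set (take k0 cs))" by (intro psubset_card_mono) auto
      then show ?thesis using cardt by simp
    next
      case False
      have "card V \<le> card (set (take k cs))" by (intro card_mono sub) simp
      then show ?thesis using cardt[OF that] False that by simp
    qed
    then have "0 \<le> ?F (S \<inter> W k)"
      using low[of V] sub sub' energy_phi[OF L_pos order_trans[OF sub win], of J h u v] unfolding V by simp
    moreover have "finite S" "finite (W k)" using S finite_sites[of S] by (auto simp: W_def)
    ultimately show ?thesis using energy_submodular[of S "W k" J L h] FW[OF that] J h by simp
  qed
  have Fle: "?F (S \<union> W k) \<le> ?F S + ?G" if "k \<le> k0" for k using FI[OF that] eG[of k] that k0 by simp
  have path: "(S, S \<union> W k) \<in> (grow L J h (?F S + ?G))\<^sup>*" if "k \<le> k0" for k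
    using that
  proof (induction k)
    case 0 then show ?case by (simp add: W_def)
  next
    case (Suc k)
    have W: "W (Suc k) = insert (phi L u v (cs ! k)) (W k)"
      using Suc.prems k0 cs(3) by (simp add: W_def take_Suc_conv_app_nth)
    show ?case
    proof (cases "phi L u v (cs ! k) \<in> S \<union> W k")
      case True
      then have "S \<union> W (Suc k) = S \<union> W k" using W by auto
      then show ?thesis using Suc by simp
    next
      case False
      have "phi L u v (cs ! k) \<in> Lam L" using WL[of "Suc k"] W by auto
      then have "(S \<union> W k, insert (phi L u v (cs ! k)) (S \<union> W k)) \<in> grow L J h (?F S + ?G)"
        unfolding grow_def using False S WL[of k] Fle[of k] Fle[of "Suc k"] Suc.prems W
        by (intro CollectI exI[of _ "S \<union> W k"] exI[of _ "phi L u v (cs ! k)"] conjI refl) auto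
      then show ?thesis using Suc W by (simp add: rtrancl.rtrancl_into_rtrancl)
    qed
  qed
  show thesis
  proof (rule that[of "S \<union> W k0"])
    have "(i, j, s) \<in> W k0" using phx abc unfolding W_def by (metis image_eqI)
    then show "S \<subset> S \<union> W k0" using x by blast
    show "?F (S \<union> W k0) < ?F S" using FI[of k0] k0 by simp
  qed (use S WL path in auto)
qed

text \<open>Each stage ends at a lower energy, so the barrier of the next stage stays below the
  level allowed initially.\<close>

lemma grow_to_Lam:
  assumes "S \<subseteq> Lam L"
  shows "(S, Lam L) \<in> (grow L J h (energy L J h S + Gamma_hex J h))\<^sup>*"
  using assms
proof (induction "card (Lam L - S)" arbitrary: S rule: less_induct)
  case less
  show ?case
  proof (cases "S = Lam L")
    case False
    then have "S \<subset> Lam L" using less.prems by blast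
    then obtain S' where S': "S \<subset> S'" "S' \<subseteq> Lam L" "energy L J h S' < energy L J h S"
      "(S, S') \<in> (grow L J h (energy L J h S + Gamma_hex J h))\<^sup>*"
      by (rule lower_energy_reachable)
    have "card (Lam L - S') < card (Lam L - S)"
      using S' finite_Lam[of L] by (intro psubset_card_mono) auto
    then have "(S', Lam L) \<in> (grow L J h (energy L J h S' + Gamma_hex J h))\<^sup>*"
      by (rule less.hyps[OF _ S'(2)])
    then have "(S', Lam L) \<in> (grow L J h (energy L J h S + Gamma_hex J h))\<^sup>*"
      using rtrancl_mono[OF grow_mono[of "energy L J h S' + Gamma_hex J h" "energy L J h S + Gamma_hex J h" L J h]] S'(3)
      by auto
    then show ?thesis using S'(4) by simp
  qed simp
qed

end

section \<open>The Hamiltonian\<close>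

definition conf :: "nat \<Rightarrow> site set \<Rightarrow> config" where
  "conf L S = (\<lambda>x. if x \<in> Lam L then if x \<in> S then 1 else - 1 else 0)"

definition plus_sites :: "nat \<Rightarrow> config \<Rightarrow> site set" where
  "plus_sites L \<sigma> = {x\<in>Lam L. \<sigma> x = 1}"

lemma conf_plus_sites:
  assumes "\<sigma> \<in> configs L"
  shows "conf L (plus_sites L \<sigma>) = \<sigma>"
proof
  fix x
  have "x \<in> Lam L \<Longrightarrow> \<sigma> x = - 1 \<or> \<sigma> x = 1" "x \<notin> Lam L \<Longrightarrow> \<sigma> x = 0"
    using assms unfolding configs_def by blast+
  then show "conf L (plus_sites L \<sigma>) x = \<sigma> x" by (cases "x \<in> Lam L") (auto simp: conf_def plus_sites_def)
qed

lemma plus_sites_conf: "S \<subseteq> Lam L \<Longrightarrow> plus_sites L (conf L S) = S"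
  by (auto simp: conf_def plus_sites_def)

lemma conf_in_configs: "conf L S \<in> configs L"
  by (auto simp: conf_def configs_def)

lemma configs_eq: "configs L = conf L ` Pow (Lam L)"
proof -
  have "\<sigma> \<in> conf L ` Pow (Lam L)" if "\<sigma> \<in> configs L" for \<sigma>
    by (rule image_eqI[of _ _ "plus_sites L \<sigma>"]) (simp_all add: conf_plus_sites[OF that], simp add: plus_sites_def)
  then show ?thesis using conf_in_configs by blast
qed

lemma finite_configs: "finite (configs L)"
  by (simp add: configs_eq finite_Lam)

lemma conf_insert:
  assumes "x \<in> Lam L" "x \<notin> S"
  shows "conf L (insert x S) = flip (conf L S) x"
  using assms by (auto simp: conf_def flip_def)

definition ups :: "nat \<Rightarrow> site set" where "ups L = {v\<in>Lam L. \<not> down v}"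
definition downs :: "nat \<Rightarrow> site set" where "downs L = {v\<in>Lam L. down v}"

lemma bij_betw_T:
  assumes "d \<in> {xT L, yT L, zT L}"
  shows "bij_betw d (ups L) (downs L)"
proof -
  have "bij_betw (xT L) (ups L) (downs L)"
    by (rule bij_betw_byWitness[where f' = "\<lambda>(p, q, s). (Suc p mod L, q, False)"])
      (auto simp: ups_def downs_def xT_def Lam_def suc_pred_mod pred_suc_mod)
  moreover have "bij_betw (yT L) (ups L) (downs L)"
    by (rule bij_betw_byWitness[where f' = "\<lambda>(p, q, s). (p, Suc q mod L, False)"])
      (auto simp: ups_def downs_def yT_def Lam_def suc_pred_mod pred_suc_mod)
  moreover have "bij_betw (zT L) (ups L) (downs L)"
    by (rule bij_betw_byWitness[where f' = "\<lambda>(p, q, s). (p, q, False)"])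
      (auto simp: ups_def downs_def zT_def Lam_def)
  ultimately show ?thesis using assms by blast
qed

definition edge :: "(site \<Rightarrow> site) \<Rightarrow> site \<Rightarrow> site set" where "edge d v = {v, d v}"

lemma edges_eq: "edges L = edge (xT L) ` ups L \<union> edge (yT L) ` ups L \<union> edge (zT L) ` ups L"
proof (intro equalityI subsetI)
  fix e assume "e \<in> edges L"
  then obtain x y where e: "e = {x, y}" "x \<in> Lam L" "y \<in> Lam L" "hex_adj L x y" by (auto simp: edges_def)
  obtain a b s c d t where xy: "x = (a, b, s)" "y = (c, d, t)" by (cases x; cases y)
  consider "\<not> s" "t" "up_down_adj L (a, b) (c, d)" | "s" "\<not> t" "up_down_adj L (c, d) (a, b)"
    using e(4) by (auto simp: hex_adj_def xy)
  then show "e \<in> edge (xT L) ` ups L \<union> edge (yT L) ` ups L \<union> edge (zT L) ` ups L"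
  proof cases
    case 1
    then have "y = xT L x \<or> y = yT L x \<or> y = zT L x" "x \<in> ups L"
      using e by (auto simp: up_down_adj_def xy T_defs ups_def)
    then show ?thesis by (auto simp: edge_def e)
  next
    case 2
    then have "x = xT L y \<or> x = yT L y \<or> x = zT L y" "y \<in> ups L"
      using e by (auto simp: up_down_adj_def xy T_defs ups_def)
    then show ?thesis by (auto simp: edge_def e)
  qed
next
  fix e assume "e \<in> edge (xT L) ` ups L \<union> edge (yT L) ` ups L \<union> edge (zT L) ` ups L"
  then obtain d v where dv: "d \<in> {xT L, yT L, zT L}" "v \<in> ups L" "e = {v, d v}" by (auto simp: edge_def)
  have "d v \<in> downs L" using bij_betw_T[OF dv(1)] dv(2) by (auto simp: bij_betw_def)
  moreover have "hex_adj L v (d v)"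
    using dv by (cases v) (auto simp: hex_adj_def up_down_adj_def T_defs ups_def)
  moreover have "v \<in> Lam L" "d v \<in> Lam L" using calculation(1) dv(2) by (auto simp: ups_def downs_def)
  ultimately show "e \<in> edges L" unfolding edges_def dv(3) by blast
qed

text \<open>For \<open>L = 1\<close> the three neighbours of a face coincide, and the set
  \<open>edges L\<close> would contain one edge in place of three.\<close>

lemma T_distinct:
  assumes "2 \<le> L" "v \<in> ups L"
  shows "xT L v \<noteq> yT L v" "xT L v \<noteq> zT L v" "yT L v \<noteq> zT L v"
  using assms pred_mod[of "fst v" L] pred_mod[of "fst (snd v)" L]
  by (auto simp: T_defs ups_def Lam_def split: if_splits)

lemma edge_eq_iff:
  assumes "d \<in> {xT L, yT L, zT L}" "d' \<in> {xT L, yT L, zT L}" "v \<in> ups L" "w \<in> ups L"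
  shows "edge d v = edge d' w \<longleftrightarrow> v = w \<and> d v = d' w"
proof -
  have "d v \<in> downs L" "d' w \<in> downs L" using bij_betw_T assms by (auto simp: bij_betw_def)
  then show ?thesis using assms by (auto simp: edge_def ups_def downs_def doubleton_eq_iff)
qed

lemma sum_edges:
  fixes F :: "site set \<Rightarrow> real"
  assumes "2 \<le> L"
  shows "(\<Sum>e\<in>edges L. F e) = (\<Sum>v\<in>ups L. F (edge (xT L) v)) + (\<Sum>v\<in>ups L. F (edge (yT L) v)) + (\<Sum>v\<in>ups L. F (edge (zT L) v))"
proof -
  have fin: "finite (ups L)" by (simp add: ups_def finite_Lam)
  have inj: "inj_on (edge d) (ups L)" if "d \<in> {xT L, yT L, zT L}" for d
    using edge_eq_iff[OF that that] by (auto simp: inj_on_def)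
  have dis: "edge d ` ups L \<inter> edge d' ` ups L = {}"
    if "d \<in> {xT L, yT L, zT L}" "d' \<in> {xT L, yT L, zT L}" "\<And>v. v \<in> ups L \<Longrightarrow> d v \<noteq> d' v" for d d'
    using edge_eq_iff[OF that(1,2)] that(3) by blast
  note T = T_distinct[OF assms]
  have "(edge (xT L) ` ups L \<union> edge (yT L) ` ups L) \<inter> edge (zT L) ` ups L = {}"
    using dis[of "xT L" "zT L"] dis[of "yT L" "zT L"] T by blast
  moreover have "edge (xT L) ` ups L \<inter> edge (yT L) ` ups L = {}"
    using dis[of "xT L" "yT L"] T by blast
  ultimately show ?thesis
    unfolding edges_eq using fin inj by (simp add: sum.union_disjoint sum.reindex)
qed

lemma card_ups: "card (ups L) = L\<^sup>2"
proof -
  have "ups L = {0..<L} \<times> {0..<L} \<times> {False}" by (auto simp: ups_def Lam_def)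
  then show ?thesis by (simp add: card_cartesian_product power2_eq_square)
qed

lemma sum_edge_conf:
  assumes d: "d \<in> {xT L, yT L, zT L}" and S: "S \<subseteq> Lam L"
  shows "(\<Sum>v\<in>ups L. \<Prod>x\<in>edge d v. real_of_int (conf L S x))
    = 4 * real (card (uplinks d S)) - 2 * real (card S) + (real L)\<^sup>2"
proof -
  have fin: "finite (ups L)" "finite (downs L)" by (simp_all add: ups_def downs_def finite_Lam)
  define i :: "site \<Rightarrow> real" where "i v = of_bool (v \<in> S)" for v
  have bij: "bij_betw d (ups L) (downs L)" by (rule bij_betw_T[OF d])
  \<comment> \<open>Expansion of \<open>(2 * i v - 1) * (2 * i (d v) - 1)\<close>.\<close>
  have "(\<Prod>x\<in>edge d v. real_of_int (conf L S x)) = 4 * (i v * i (d v)) - 2 * i v - 2 * i (d v) + 1"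
    if "v \<in> ups L" for v
  proof -
    have "d v \<in> downs L" using bij that by (auto simp: bij_betw_def)
    then have "v \<noteq> d v" "v \<in> Lam L" "d v \<in> Lam L" using that by (auto simp: ups_def downs_def)
    then show ?thesis by (auto simp: edge_def conf_def i_def)
  qed
  then have "(\<Sum>v\<in>ups L. \<Prod>x\<in>edge d v. real_of_int (conf L S x))
      = (\<Sum>v\<in>ups L. 4 * (i v * i (d v)) - 2 * i v - 2 * i (d v) + 1)"
    by (intro sum.cong) auto
  also have "\<dots> = 4 * (\<Sum>v\<in>ups L. i v * i (d v)) - 2 * (\<Sum>v\<in>ups L. i v) - 2 * (\<Sum>v\<in>ups L. i (d v)) + (real L)\<^sup>2"
    by (simp add: sum.distrib sum_subtractf sum_distrib_left card_ups)
  also have "(\<Sum>v\<in>ups L. i (d v)) = (\<Sum>v\<in>downs L. i v)"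
    by (rule sum.reindex_bij_betw[OF bij])
  also have "(\<Sum>v\<in>ups L. i v * i (d v)) = card (uplinks d S)"
  proof -
    have "uplinks d S = {v\<in>ups L. v \<in> S \<and> d v \<in> S}" using S by (auto simp: uplinks_def ups_def)
    moreover have "(\<Sum>v\<in>ups L. i v * i (d v)) = (\<Sum>v\<in>ups L. of_bool (v \<in> S \<and> d v \<in> S))"
      by (intro sum.cong) (auto simp: i_def)
    ultimately show ?thesis using fin by (simp add: Int_def)
  qed
  also have "4 * real (card (uplinks d S)) - 2 * (\<Sum>v\<in>ups L. i v) - 2 * (\<Sum>v\<in>downs L. i v) + (real L)\<^sup>2
      = 4 * real (card (uplinks d S)) - 2 * ((\<Sum>v\<in>ups L. i v) + (\<Sum>v\<in>downs L. i v)) + (real L)\<^sup>2" by simp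
  also have "(\<Sum>v\<in>ups L. i v) + (\<Sum>v\<in>downs L. i v) = (\<Sum>v\<in>Lam L. i v)"
  proof -
    have "Lam L = ups L \<union> downs L" "ups L \<inter> downs L = {}" by (auto simp: ups_def downs_def)
    then show ?thesis using fin by (simp add: sum.union_disjoint)
  qed
  also have "(\<Sum>v\<in>Lam L. i v) = card S"
    using S finite_Lam[of L] by (simp add: i_def Int_absorb1)
  finally show ?thesis .
qed

lemma Ham_conf:
  assumes "2 \<le> L" and S: "S \<subseteq> Lam L"
  shows "Ham L J h (conf L S) = energy L J h S + (h - 3 / 2 * J) * (real L)\<^sup>2"
proof -
  have "(\<Sum>x\<in>Lam L. real_of_int (conf L S x)) = (\<Sum>x\<in>Lam L. 2 * of_bool (x \<in> S) - 1)"
    by (intro sum.cong) (auto simp: conf_def)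
  also have "\<dots> = 2 * real (card S) - 2 * (real L)\<^sup>2"
    using S finite_Lam[of L] by (simp add: sum_subtractf sum_distrib_left[symmetric] Int_absorb1 card_Lam)
  finally have m: "(\<Sum>x\<in>Lam L. real_of_int (conf L S x)) = 2 * real (card S) - 2 * (real L)\<^sup>2" .
  show ?thesis
    unfolding Ham_def m sum_edges[OF assms(1)]
    by (simp add: sum_edge_conf[OF _ S] energy_def perimT_def linksT_def algebra_simps)
qed

lemma perimT_nonneg:
  assumes S: "S \<subseteq> Lam L" 
  shows "0 \<le> perimT L S"
proof -
  have fin: "finite S" by (rule finite_sites[OF S])
  have "2 * card (uplinks d S) \<le> card S" if d: "d \<in> {xT L, yT L, zT L}" for d
  proof -
    have "uplinks d S \<subseteq> ups L" using S by (auto simp: uplinks_def ups_def)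
    then have inj: "inj_on d (uplinks d S)" using bij_betw_T[OF d] by (meson bij_betw_def inj_on_subset)
    have "card (uplinks d S \<union> d ` uplinks d S) \<le> card S"
      using fin by (intro card_mono) (auto simp: uplinks_def)
    moreover have "uplinks d S \<inter> d ` uplinks d S = {}"
      using bij_betw_T[OF d] \<open>uplinks d S \<subseteq> ups L\<close> by (fastforce simp: bij_betw_def ups_def downs_def)
    moreover have "finite (uplinks d S)" using fin by (simp add: uplinks_def)
    ultimately show ?thesis by (simp add: card_Un_disjoint card_image[OF inj])
  qed
  from this[of "xT L"] this[of "yT L"] this[of "zT L"] show ?thesis
    by (simp add: perimT_def linksT_def)
qed

lemma perimT_Lam: "perimT L (Lam L) = 0"
proof -
  have "uplinks d (Lam L) = ups L" if "d \<in> {xT L, yT L, zT L}" for d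
    using bij_betw_T[OF that] by (auto simp: uplinks_def ups_def downs_def bij_betw_def)
  then show ?thesis by (simp add: perimT_def linksT_def card_ups card_Lam)
qed

text \<open>The margin \<open>h\<close> concentrates the stationary mass at all-plus and gives the
  holding probability there.\<close>

lemma energy_gap_Lam:
  assumes "0 < h" "0 \<le> J" "S \<subset> Lam L"
  shows "energy L J h (Lam L) + h \<le> energy L J h S"
proof -
  have "card S < card (Lam L)" using assms finite_Lam by (intro psubset_card_mono) auto
  then have "real (card S) + 1 \<le> real (card (Lam L))" by linarith
  then have "h * (real (card S) + 1) \<le> h * real (card (Lam L))" using assms by (intro mult_left_mono) auto
  moreover have "0 \<le> J * perimT L S" using perimT_nonneg[of S L] assms by auto
  ultimately show ?thesis by (simp add: energy_def perimT_Lam algebra_simps)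
qed

lemma card_plus_sites_flip_le:
  assumes "\<sigma> \<in> configs L" "x \<in> Lam L"
  shows "card (plus_sites L (flip \<sigma> x)) \<le> card (plus_sites L \<sigma>) + 1"
proof -
  have fin: "finite (plus_sites L \<sigma>)" using finite_Lam by (simp add: plus_sites_def)
  have "plus_sites L (flip \<sigma> x) \<subseteq> insert x (plus_sites L \<sigma>)" by (auto simp: plus_sites_def flip_def)
  then have "card (plus_sites L (flip \<sigma> x)) \<le> card (insert x (plus_sites L \<sigma>))" using fin by (intro card_mono) auto
  also have "\<dots> \<le> card (plus_sites L \<sigma>) + 1" using card_insert_le_m1 fin by (simp add: card_insert_if)
  finally show ?thesis .
qed

section \<open>Reversible Markov chains\<close>

text \<open>The first-order condition of the variational argument: at \<open>t = - a / c\<close> the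
  linear term would dominate.\<close>

lemma quadratic_nonneg_imp_zero:
  fixes a b :: real
  assumes "\<And>t. 0 \<le> a * t + b * t\<^sup>2"
  shows "a = 0"
proof (rule ccontr)
  assume "a \<noteq> 0"
  define c where "c = \<bar>b\<bar> + 1"
  have c: "c > 0" "b < c" "c \<noteq> 0" by (auto simp: c_def)
  have "0 \<le> a * (- a / c) + b * (- a / c)\<^sup>2" by (rule assms)
  also have "a * (- a / c) + b * (- a / c)\<^sup>2 = (a\<^sup>2 / c\<^sup>2) * (b - c)"
    using c by (simp add: power2_eq_square field_simps)
  also have "\<dots> < 0" using c \<open>a \<noteq> 0\<close> by (intro mult_pos_neg) auto
  finally show False by simp
qed

text \<open>The weight \<open>w\<close> is not normalised, so that detailed balance can be checked
  without the partition function.\<close>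

locale reversible_chain =
  fixes X :: "'a set" and w :: "'a \<Rightarrow> real" and P :: "'a \<Rightarrow> 'a \<Rightarrow> real"
  assumes finX: "finite X" and X2: "2 \<le> card X"
    and w_pos: "x \<in> X \<Longrightarrow> 0 < w x"
    and P_nonneg: "x \<in> X \<Longrightarrow> y \<in> X \<Longrightarrow> 0 \<le> P x y"
    and P_row: "x \<in> X \<Longrightarrow> (\<Sum>y\<in>X. P x y) = 1"
    and reversible: "x \<in> X \<Longrightarrow> y \<in> X \<Longrightarrow> w x * P x y = w y * P y x"
begin

definition ip :: "('a \<Rightarrow> real) \<Rightarrow> ('a \<Rightarrow> real) \<Rightarrow> real" where
  "ip f g = (\<Sum>x\<in>X. w x * f x * g x)"

definition Pop :: "('a \<Rightarrow> real) \<Rightarrow> 'a \<Rightarrow> real" where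
  "Pop f x = (\<Sum>y\<in>X. P x y * f y)"

abbreviation one :: "'a \<Rightarrow> real" where "one \<equiv> (\<lambda>_. 1)"

definition eigs :: "real set" where
  "eigs = {l. \<exists>f. (\<exists>x\<in>X. f x \<noteq> 0) \<and> (\<forall>x\<in>X. Pop f x = l * f x)}"

text \<open>For \<open>s = 1\<close> this is twice the Dirichlet form; the choice \<open>s = - 1\<close> controls the eigenvalues near \<open>- 1\<close>.\<close>

definition dirichlet :: "real \<Rightarrow> ('a \<Rightarrow> real) \<Rightarrow> real" where
  "dirichlet s f = (\<Sum>x\<in>X. \<Sum>y\<in>X. w x * P x y * (f x - s * f y)\<^sup>2)"

lemma ip_comm: "ip f g = ip g f"
  by (simp add: ip_def ac_simps)

lemma ip_add: "ip (\<lambda>x. f x + g x) k = ip f k + ip g k" "ip k (\<lambda>x. f x + g x) = ip k f + ip k g"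
  by (simp_all add: ip_def algebra_simps sum.distrib)

lemma ip_diff: "ip (\<lambda>x. f x - g x) k = ip f k - ip g k" "ip k (\<lambda>x. f x - g x) = ip k f - ip k g"
  by (simp_all add: ip_def algebra_simps sum_subtractf)

lemma ip_scale: "ip (\<lambda>x. c * f x) k = c * ip f k" "ip k (\<lambda>x. c * f x) = c * ip k f"
  by (simp_all add: ip_def sum_distrib_left ac_simps)

lemma ip_sum:
  assumes "finite I"
  shows "ip (\<lambda>x. \<Sum>i\<in>I. f i x) k = (\<Sum>i\<in>I. ip (f i) k)" "ip k (\<lambda>x. \<Sum>i\<in>I. f i x) = (\<Sum>i\<in>I. ip k (f i))"
  unfolding ip_def by (subst sum.swap, simp add: sum_distrib_left sum_distrib_right)+

lemma ip_cong: "(\<And>x. x \<in> X \<Longrightarrow> f x = f' x) \<Longrightarrow> (\<And>x. x \<in> X \<Longrightarrow> g x = g' x) \<Longrightarrow> ip f g = ip f' g'"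
  unfolding ip_def by (intro sum.cong) auto

lemma ip_nonneg: "0 \<le> ip f f"
  unfolding ip_def by (intro sum_nonneg) (auto simp: mult.assoc less_imp_le[OF w_pos])

lemma ip_ge_term: "x \<in> X \<Longrightarrow> w x * (f x)\<^sup>2 \<le> ip f f"
  unfolding ip_def power2_eq_square
  using member_le_sum[of x X "\<lambda>x. w x * f x * f x"] finX by (auto simp: mult.assoc less_imp_le[OF w_pos])

lemma ip_eq_0: "ip f f = 0 \<Longrightarrow> x \<in> X \<Longrightarrow> f x = 0"
  using ip_ge_term[of x f] w_pos[of x] by (auto simp: mult_le_0_iff)

lemma ip_pos: "x \<in> X \<Longrightarrow> f x \<noteq> 0 \<Longrightarrow> 0 < ip f f"
  using ip_eq_0[of f x] ip_nonneg[of f] by fastforce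

lemma Pop_add: "Pop (\<lambda>x. f x + g x) x = Pop f x + Pop g x"
  by (simp add: Pop_def algebra_simps sum.distrib)

lemma Pop_scale: "Pop (\<lambda>x. c * f x) x = c * Pop f x"
  by (simp add: Pop_def sum_distrib_left ac_simps)

lemma Pop_one: "x \<in> X \<Longrightarrow> Pop one x = 1"
  by (simp add: Pop_def P_row)

lemma Pop_cong: "(\<And>x. x \<in> X \<Longrightarrow> f x = f' x) \<Longrightarrow> Pop f x = Pop f' x"
  unfolding Pop_def by (intro sum.cong) auto

lemma Pop_selfadjoint: "ip f (Pop g) = ip (Pop f) g"
proof -
  have "ip f (Pop g) = (\<Sum>x\<in>X. \<Sum>y\<in>X. (w x * P x y) * f x * g y)"
    by (simp add: ip_def Pop_def sum_distrib_left ac_simps)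
  also have "\<dots> = (\<Sum>x\<in>X. \<Sum>y\<in>X. (w y * P y x) * f x * g y)"
    by (intro sum.cong refl) (simp add: reversible)
  also have "\<dots> = (\<Sum>y\<in>X. \<Sum>x\<in>X. (w y * P y x) * f x * g y)" by (rule sum.swap)
  also have "\<dots> = ip (Pop f) g"
    by (simp add: ip_def Pop_def sum_distrib_left sum_distrib_right ac_simps)
  finally show ?thesis .
qed

lemma ip_Pop_expand:
  "(\<Sum>x\<in>X. \<Sum>y\<in>X. w x * P x y * (f x)\<^sup>2) = ip f f"
  "(\<Sum>x\<in>X. \<Sum>y\<in>X. w x * P x y * (f y)\<^sup>2) = ip f f"
  "(\<Sum>x\<in>X. \<Sum>y\<in>X. w x * P x y * (f x * f y)) = ip f (Pop f)"
proof -
  show a: "(\<Sum>x\<in>X. \<Sum>y\<in>X. w x * P x y * (f x)\<^sup>2) = ip f f" for f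
  proof -
    have row: "(\<Sum>y\<in>X. w x * P x y * c) = w x * c" if "x \<in> X" for x c
      using P_row[OF that] by (simp add: sum_distrib_right[symmetric] sum_distrib_left[symmetric])
    show ?thesis unfolding ip_def by (intro sum.cong) (simp_all add: row power2_eq_square)
  qed
  have "(\<Sum>x\<in>X. \<Sum>y\<in>X. w x * P x y * (f y)\<^sup>2) = (\<Sum>x\<in>X. \<Sum>y\<in>X. w y * P y x * (f y)\<^sup>2)"
    by (intro sum.cong refl) (simp add: reversible)
  also have "\<dots> = (\<Sum>y\<in>X. \<Sum>x\<in>X. w y * P y x * (f y)\<^sup>2)" by (rule sum.swap)
  finally show "(\<Sum>x\<in>X. \<Sum>y\<in>X. w x * P x y * (f y)\<^sup>2) = ip f f" by (simp add: a)
  show "(\<Sum>x\<in>X. \<Sum>y\<in>X. w x * P x y * (f x * f y)) = ip f (Pop f)"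
    by (simp add: ip_def Pop_def sum_distrib_left ac_simps)
qed

lemma dirichlet_eq: "dirichlet s f = (1 + s\<^sup>2) * ip f f - 2 * s * ip f (Pop f)"
proof -
  have "dirichlet s f = (\<Sum>x\<in>X. \<Sum>y\<in>X. w x * P x y * (f x)\<^sup>2 + s\<^sup>2 * (w x * P x y * (f y)\<^sup>2) - 2 * s * (w x * P x y * (f x * f y)))"
    unfolding dirichlet_def by (intro sum.cong refl) (simp add: power2_eq_square algebra_simps)
  then show ?thesis
    by (simp only: sum.distrib sum_subtractf sum_distrib_left[symmetric] ip_Pop_expand) (simp add: algebra_simps)
qed

lemma dirichlet_nonneg: "0 \<le> dirichlet s f"
  unfolding dirichlet_def using w_pos P_nonneg by (intro sum_nonneg mult_nonneg_nonneg) (auto intro: less_imp_le)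

lemma term_le_dirichlet:
  assumes "x \<in> X" "y \<in> X"
  shows "w x * P x y * (f x - s * f y)\<^sup>2 \<le> dirichlet s f"
proof -
  let ?F = "\<lambda>x y. w x * P x y * (f x - s * f y)\<^sup>2"
  have nn: "0 \<le> ?F x y" if "x \<in> X" "y \<in> X" for x y using that w_pos P_nonneg by (simp add: less_imp_le)
  have "?F x y \<le> (\<Sum>y\<in>X. ?F x y)" using member_le_sum[of y X "?F x"] assms finX nn by simp
  also have "\<dots> \<le> dirichlet s f" unfolding dirichlet_def
    using assms finX nn by (intro member_le_sum[of x X "\<lambda>x. \<Sum>y\<in>X. ?F x y"] sum_nonneg) auto
  finally show ?thesis .
qed

lemma eigs_orthogonal:
  assumes "\<And>x. x \<in> X \<Longrightarrow> Pop f x = l * f x" "\<And>x. x \<in> X \<Longrightarrow> Pop g x = k * g x" "l \<noteq> k"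
  shows "ip f g = 0"
proof -
  have "l * ip f g = ip (Pop f) g" using ip_cong[of "Pop f" "\<lambda>x. l * f x" g g] assms(1) by (simp add: ip_scale)
  also have "\<dots> = ip f (Pop g)" by (simp add: Pop_selfadjoint)
  also have "\<dots> = k * ip f g" using ip_cong[of f f "Pop g" "\<lambda>x. k * g x"] assms(2) by (simp add: ip_scale)
  finally show ?thesis using assms(3) by simp
qed

text \<open>Bessel's inequality for each point mass, summed over \<open>X\<close>, bounds the size
  of an orthonormal family without choosing a basis.\<close>

lemma orthonormal_card_le:
  assumes "finite I" and on: "\<And>i j. i \<in> I \<Longrightarrow> j \<in> I \<Longrightarrow> ip (e i) (e j) = (if i = j then 1 else 0)"
  shows "card I \<le> card X"
proof -
  have bessel: "w x * (\<Sum>i\<in>I. (e i x)\<^sup>2) \<le> 1" if x: "x \<in> X" for x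
  proof -
    define d where "d = (\<lambda>y. if y = x then 1 else 0 :: real)"
    \<comment> \<open>The projection of the point mass \<open>d\<close> onto the span of the family,
      with coefficients \<open>ip d (e i)\<close>.\<close>
    define u where "u = (\<lambda>y. \<Sum>i\<in>I. (w x * e i x) * e i y)"
    have d: "ip d f = w x * f x" for f
      using x finX by (simp add: ip_def d_def if_distrib[of "\<lambda>z. _ * z * _"] sum.delta cong: if_cong)
    have du: "ip d u = (\<Sum>i\<in>I. (w x * e i x)\<^sup>2)"
      by (simp add: d u_def sum_distrib_left power2_eq_square ac_simps)
    have ipu: "ip u k = (\<Sum>i\<in>I. (w x * e i x) * ip (e i) k)" for k
      unfolding u_def by (simp add: ip_sum[OF assms(1)] ip_scale)
    have "ip (e i) u = w x * e i x" if "i \<in> I" for i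
    proof -
      have "ip (e i) u = (\<Sum>j\<in>I. (w x * e j x) * ip (e i) (e j))"
        unfolding u_def by (simp add: ip_sum[OF assms(1)] ip_scale)
      also have "\<dots> = (\<Sum>j\<in>I. if j = i then w x * e j x else 0)"
        using that by (intro sum.cong) (auto simp: on)
      finally show ?thesis using assms(1) that by simp
    qed
    then have "ip u u = (\<Sum>i\<in>I. (w x * e i x)\<^sup>2)"
      using ipu[of u] by (simp add: power2_eq_square)
    then have "ip (\<lambda>y. d y - u y) (\<lambda>y. d y - u y) = w x - (\<Sum>i\<in>I. (w x * e i x)\<^sup>2)"
      using du d[of d] by (simp add: ip_diff ip_comm[of u d]) (simp add: d_def)
    then have "(\<Sum>i\<in>I. (w x * e i x)\<^sup>2) \<le> w x" using ip_nonneg[of "\<lambda>y. d y - u y"] by simp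
    then have "w x * (w x * (\<Sum>i\<in>I. (e i x)\<^sup>2)) \<le> w x * 1"
      by (simp add: power_mult_distrib sum_distrib_left power2_eq_square ac_simps)
    then show ?thesis using w_pos[OF x] by (simp only: mult_le_cancel_left_pos)
  qed
  have "real (card I) = (\<Sum>i\<in>I. ip (e i) (e i))" using on by simp
  also have "\<dots> = (\<Sum>x\<in>X. w x * (\<Sum>i\<in>I. (e i x)\<^sup>2))"
    unfolding ip_def by (subst sum.swap) (simp add: sum_distrib_left power2_eq_square ac_simps)
  also have "\<dots> \<le> (\<Sum>x\<in>X. 1)" by (intro sum_mono bessel)
  finally show ?thesis by simp
qed

lemma finite_eigs: "finite eigs"
proof (rule ccontr)
  assume "infinite eigs"
  then obtain E where E: "E \<subseteq> eigs" "finite E" "card E = card X + 1"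
    using infinite_arbitrarily_large by metis
  have "\<exists>f. (\<exists>x\<in>X. f x \<noteq> 0) \<and> (\<forall>x\<in>X. Pop f x = l * f x)" if "l \<in> E" for l
    using E(1) that by (auto simp: eigs_def)
  then obtain f where f: "\<And>l. l \<in> E \<Longrightarrow> (\<exists>x\<in>X. f l x \<noteq> 0)" "\<And>l x. l \<in> E \<Longrightarrow> x \<in> X \<Longrightarrow> Pop (f l) x = l * f l x"
    by metis
  define e where "e l = (\<lambda>x. (1 / sqrt (ip (f l) (f l))) * f l x)" for l
  have "ip (e i) (e j) = (if i = j then 1 else 0)" if "i \<in> E" "j \<in> E" for i j
  proof (cases "i = j")
    case True
    have "0 < ip (f i) (f i)" using f(1)[OF that(1)] ip_pos by blast
    then show ?thesis unfolding e_def ip_scale by (simp add: True)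
  next
    case False
    then have "ip (f i) (f j) = 0" using f(2) that eigs_orthogonal[of "f i" i "f j" j] by blast
    then show ?thesis unfolding e_def ip_scale using False by simp
  qed
  then have "card E \<le> card X" by (rule orthonormal_card_le[OF E(2)])
  then show False using E(3) by simp
qed

text \<open>The Rayleigh quotient attains its maximum on the unit sphere orthogonal to the
  constants, and a maximiser is an eigenfunction. Functions are defined on the whole type, so they
  are set to zero outside \<open>X\<close> to make this sphere compact.\<close>

lemma variational_eigenvalue:
  obtains l where "l \<in> eigs" "\<And>f. ip f one = 0 \<Longrightarrow> ip f (Pop f) \<le> l * ip f f"
    "\<exists>f. ip f one = 0 \<and> (\<exists>x\<in>X. f x \<noteq> 0) \<and> (\<forall>x\<in>X. Pop f x = l * f x)"
proof -
  \<comment> \<open>A unit function satisfies \<open>w x * (f x)\<^sup>2 \<le> 1\<close>, so the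
    sphere lies in this product of intervals, which is compact by Tychonoff's theorem.\<close>
  define B where "B x = (if x \<in> X then {- (1 / sqrt (w x))..1 / sqrt (w x)} else {0})" for x
  define K where "K = PiE UNIV B \<inter> {f. ip f one = 0} \<inter> {f. ip f f = 1}"
  have cont: "continuous_on UNIV (\<lambda>f :: 'a \<Rightarrow> real. f x)" for x
    by (rule continuous_on_product_coordinates)
  have cont2: "continuous_on UNIV (\<lambda>f. ip f one)" "continuous_on UNIV (\<lambda>f. ip f f)" "continuous_on UNIV (\<lambda>f. ip f (Pop f))"
    unfolding ip_def Pop_def by (intro continuous_intros cont)+
  have "compact (PiE UNIV B)"
  proof -
    have "compactin (product_topology (\<lambda>i::'a. euclideanreal) UNIV) (PiE UNIV B)"
      unfolding compactin_PiE by (auto simp: B_def)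
    then show ?thesis by (simp add: euclidean_product_topology)
  qed
  moreover have "closed {f. ip f one = 0}" "closed {f. ip f f = 1}"
    using cont2 by (auto intro!: closed_Collect_eq continuous_on_const)
  ultimately have cpt: "compact K" unfolding K_def by (intro compact_Int_closed)
  have scale: "\<exists>g\<in>K. \<exists>c>0. (\<forall>x\<in>X. g x = c * f x) \<and> c\<^sup>2 * ip f f = 1"
    if f: "ip f one = 0" "x \<in> X" "f x \<noteq> 0" for f x
  proof -
    define c where "c = 1 / sqrt (ip f f)"
    define g where "g = (\<lambda>x. if x \<in> X then c * f x else 0)"
    have pos: "0 < ip f f" using ip_pos f by blast
    have c: "0 < c" "c\<^sup>2 * ip f f = 1" using pos by (auto simp: c_def power_divide)
    have gX: "\<And>x. x \<in> X \<Longrightarrow> g x = c * f x" by (simp add: g_def)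
    have g1: "ip g one = 0" using ip_cong[of g "\<lambda>x. c * f x" one one] gX f(1) by (simp add: ip_scale)
    have gg: "ip g g = 1"
      using ip_cong[of g "\<lambda>x. c * f x" g "\<lambda>x. c * f x"] gX c(2) by (simp add: ip_scale power2_eq_square)
    have "g x \<in> B x" for x
    proof (cases "x \<in> X")
      case True
      have "w x * (g x)\<^sup>2 \<le> 1" using ip_ge_term[OF True, of g] gg by simp
      then have "(g x)\<^sup>2 \<le> (1 / sqrt (w x))\<^sup>2" using w_pos[OF True] by (simp add: power_divide field_simps)
      then have "\<bar>g x\<bar> \<le> 1 / sqrt (w x)" by (rule power2_le_imp_le[of "\<bar>g x\<bar>", simplified]) (use w_pos[OF True] in auto)
      then show ?thesis using True by (auto simp: B_def)
    qed (simp add: g_def B_def)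
    then have "g \<in> K" using g1 gg by (auto simp: K_def)
    then show ?thesis using c gX by blast
  qed
  have "K \<noteq> {}"
  proof -
    obtain a where a: "a \<in> X" using X2 by (metis card.empty not_numeral_le_zero ex_in_conv)
    have "\<not> X \<subseteq> {a}" using X2 card_mono[of "{a}" X] by auto
    then obtain b where b: "b \<in> X" "b \<noteq> a" by blast
    define f where "f = (\<lambda>x. if x = a then w b else if x = b then - w a else 0)"
    have "ip f one = (\<Sum>x\<in>X. (if x = a then w a * w b else 0) + (if x = b then - (w b * w a) else 0))"
      unfolding ip_def f_def using b by (intro sum.cong) auto
    then have "ip f one = 0" using a b finX by (simp add: sum.distrib)
    moreover have "f a \<noteq> 0" using w_pos[OF b(1)] by (simp add: f_def)
    ultimately show ?thesis using scale[of f a] a by blast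
  qed
  then obtain f where f: "f \<in> K" "\<And>g. g \<in> K \<Longrightarrow> ip g (Pop g) \<le> ip f (Pop f)"
    using continuous_attains_sup[OF cpt _ continuous_on_subset[OF cont2(3)]] by (metis subset_UNIV)
  define l where "l = ip f (Pop f)"
  have f1: "ip f one = 0" "ip f f = 1" using f(1) by (auto simp: K_def)
  have max: "ip g (Pop g) \<le> l * ip g g" if g: "ip g one = 0" for g
  proof (cases "\<exists>x\<in>X. g x \<noteq> 0")
    case True
    then obtain k c where k: "k \<in> K" "0 < c" "\<forall>x\<in>X. k x = c * g x" "c\<^sup>2 * ip g g = 1"
      using scale[OF g] by blast
    have "ip k (Pop k) = ip (\<lambda>x. c * g x) (\<lambda>x. c * Pop g x)"
      using k(3) Pop_cong[of k "\<lambda>x. c * g x"] by (intro ip_cong) (auto simp: Pop_scale)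
    then have "c\<^sup>2 * ip g (Pop g) \<le> l" using f(2)[OF k(1)] by (simp add: ip_scale l_def power2_eq_square)
    also have "l = c\<^sup>2 * (l * ip g g)" using k(4) by (simp add: algebra_simps)
    finally show ?thesis using k(2) by simp
  next
    case False
    then show ?thesis by (simp add: ip_def)
  qed
  have one_Pop: "ip (Pop g) one = ip g one" for g
    using Pop_selfadjoint[of g one] ip_cong[of g g "Pop one" one] Pop_one by simp
  \<comment> \<open>The variation \<open>f + t * g\<close> shows that the residual is orthogonal to
    every admissible direction; being admissible itself, it vanishes.\<close>
  have ortho: "ip (\<lambda>x. Pop f x - l * f x) g = 0" if g: "ip g one = 0" for g
  proof -
    have "0 \<le> (2 * (l * ip f g - ip g (Pop f))) * t + (l * ip g g - ip g (Pop g)) * t\<^sup>2" for t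
    proof -
      define u where "u = (\<lambda>x. f x + t * g x)"
      have "ip u one = 0" using f1 g by (simp add: u_def ip_add ip_scale)
      then have "0 \<le> l * ip u u - ip u (Pop u)" using max[of u] by simp
      moreover have "ip u u = 1 + 2 * t * ip f g + t\<^sup>2 * ip g g"
        using f1 ip_comm[of g f] by (simp add: u_def ip_add ip_scale power2_eq_square algebra_simps)
      moreover have "ip u (Pop u) = l + 2 * t * ip g (Pop f) + t\<^sup>2 * ip g (Pop g)"
      proof -
        have "Pop u = (\<lambda>x. Pop f x + t * Pop g x)" by (rule ext) (simp add: u_def Pop_add Pop_scale)
        then show ?thesis
          using Pop_selfadjoint[of f g] ip_comm[of g "Pop f"]
          by (simp add: u_def ip_add ip_scale l_def[symmetric] power2_eq_square algebra_simps)
      qed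
      ultimately show ?thesis by (simp add: algebra_simps)
    qed
    then have "2 * (l * ip f g - ip g (Pop f)) = 0" by (rule quadratic_nonneg_imp_zero)
    then show ?thesis by (simp add: ip_diff ip_scale ip_comm[of g "Pop f"])
  qed
  define g where "g = (\<lambda>x. Pop f x - l * f x)"
  have "ip g one = 0" using f1 by (simp add: g_def ip_diff ip_scale one_Pop)
  then have "ip g g = 0" using ortho[of g] by (simp add: g_def)
  then have eig: "\<forall>x\<in>X. Pop f x = l * f x" using ip_eq_0[of g] by (auto simp: g_def)
  have ne: "\<exists>x\<in>X. f x \<noteq> 0"
  proof (rule ccontr)
    assume "\<not> ?thesis"
    then have "ip f f = 0" by (simp add: ip_def)
    then show False using f1 by simp
  qed
  show thesis
  proof (rule that[of l])
    show "l \<in> eigs" using eig ne by (auto simp: eigs_def)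
    show "ip g (Pop g) \<le> l * ip g g" if "ip g one = 0" for g by (rule max[OF that])
    show "\<exists>f. ip f one = 0 \<and> (\<exists>x\<in>X. f x \<noteq> 0) \<and> (\<forall>x\<in>X. Pop f x = l * f x)"
      using f1 eig ne by blast
  qed
qed

text \<open>Since \<open>eigs\<close> is a set, deleting its maximum gives the second eigenvalue
  counted with multiplicity only if 1 is simple. A Poincare inequality with some
  \<open>g > 0\<close> ensures this, and then the gap is itself an admissible constant.\<close>

lemma gap_bounds:
  assumes g: "0 < g" and poincare: "\<And>f. ip f one = 0 \<Longrightarrow> 2 * g * ip f f \<le> dirichlet 1 f"
  defines "gap \<equiv> 1 - Max (eigs - {Max eigs})"
  shows "g \<le> gap" and "\<And>f. ip f one = 0 \<Longrightarrow> 2 * gap * ip f f \<le> dirichlet 1 f"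
proof -
  have small: "l \<le> 1 - g" if l: "l \<in> eigs" "l \<noteq> 1" for l
  proof -
    obtain f x where f: "x \<in> X" "f x \<noteq> 0" "\<And>x. x \<in> X \<Longrightarrow> Pop f x = l * f x" using l(1) by (auto simp: eigs_def)
    have "ip f one = 0" by (rule eigs_orthogonal[OF f(3), of _ 1]) (use Pop_one l in auto)
    then have "2 * g * ip f f \<le> dirichlet 1 f" by (rule poincare)
    also have "ip f (Pop f) = l * ip f f" using ip_cong[of f f "Pop f" "\<lambda>x. l * f x"] f(3) by (simp add: ip_scale)
    then have "dirichlet 1 f = 2 * (1 - l) * ip f f" by (simp add: dirichlet_eq algebra_simps)
    finally have "2 * (g * ip f f) \<le> 2 * ((1 - l) * ip f f)" by (simp only: mult.assoc)
    then have "g * ip f f \<le> (1 - l) * ip f f" by simp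
    then show ?thesis using ip_pos[of x f] f by simp
  qed
  have one: "1 \<in> eigs"
  proof -
    have "X \<noteq> {}" using X2 by auto
    then show ?thesis by (auto simp: eigs_def Pop_one intro!: exI[of _ one])
  qed
  have max1: "Max eigs = 1"
    by (rule Max_eqI[OF finite_eigs _ one]) (use small g in force)
  obtain l where l: "l \<in> eigs" "\<And>f. ip f one = 0 \<Longrightarrow> ip f (Pop f) \<le> l * ip f f"
    "\<exists>f. ip f one = 0 \<and> (\<exists>x\<in>X. f x \<noteq> 0) \<and> (\<forall>x\<in>X. Pop f x = l * f x)"
    by (rule variational_eigenvalue) blast
  have "l \<noteq> 1"
  proof
    assume "l = 1"
    obtain f x where f: "ip f one = 0" "x \<in> X" "f x \<noteq> 0" "\<forall>x\<in>X. Pop f x = l * f x" using l(3) by blast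
    then have "ip f (Pop f) = ip f f" using \<open>l = 1\<close> ip_cong[of f f "Pop f" f] by simp
    then have "g * ip f f \<le> 0" using poincare[OF f(1)] by (simp add: dirichlet_eq)
    then show False using g ip_pos[of x f, OF f(2,3)] by (simp add: mult_le_0_iff)
  qed
  then have lin: "l \<in> eigs - {Max eigs}" using l(1) max1 by simp
  have fin: "finite (eigs - {Max eigs})" using finite_eigs by simp
  have "Max (eigs - {Max eigs}) \<in> eigs - {Max eigs}" using fin lin by (intro Max_in) auto
  then show "g \<le> gap" using small[of "Max (eigs - {Max eigs})"] max1 by (simp add: gap_def)
  fix f assume f: "ip f one = 0"
  have "l \<le> Max (eigs - {Max eigs})" using fin lin by (rule Max_ge)
  then have "l * ip f f \<le> Max (eigs - {Max eigs}) * ip f f" using ip_nonneg by (rule mult_right_mono)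
  then have "ip f (Pop f) \<le> (1 - gap) * ip f f" using l(2)[OF f] by (simp add: gap_def)
  then show "2 * gap * ip f f \<le> dirichlet 1 f" by (simp add: dirichlet_eq algebra_simps)
qed

end

section \<open>Powers of the transition matrix and distance to equilibrium\<close>

locale chain_powers = reversible_chain +
  fixes Q :: "nat \<Rightarrow> 'a \<Rightarrow> 'a \<Rightarrow> real"
  assumes Q_0: "Q 0 x y = (if x = y then 1 else 0)"
    and Q_Suc: "Q (Suc n) x y = (\<Sum>z\<in>X. Q n x z * P z y)"
begin

lemma Q_apply: "x \<in> X \<Longrightarrow> (\<Sum>y\<in>X. Q n x y * f y) = (Pop ^^ n) f x"
proof (induction n arbitrary: f)
  case 0
  then show ?case using 0 finX by (simp add: Q_0 if_distrib[of "\<lambda>z. z * _"] cong: if_cong)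
next
  case (Suc n)
  have "(\<Sum>y\<in>X. Q (Suc n) x y * f y) = (\<Sum>y\<in>X. \<Sum>z\<in>X. Q n x z * P z y * f y)"
    by (simp add: Q_Suc sum_distrib_right)
  also have "\<dots> = (\<Sum>z\<in>X. \<Sum>y\<in>X. Q n x z * P z y * f y)" by (rule sum.swap)
  also have "\<dots> = (\<Sum>z\<in>X. Q n x z * Pop f z)" by (simp add: Pop_def sum_distrib_left ac_simps)
  also have "\<dots> = (Pop ^^ n) (Pop f) x" by (rule Suc.IH[OF Suc.prems])
  finally show ?case by (simp add: funpow_swap1)
qed

lemma funpow_Pop_selfadjoint: "ip f ((Pop ^^ n) g) = ip ((Pop ^^ n) f) g"
  by (induction n arbitrary: g) (simp_all add: funpow_swap1 Pop_selfadjoint[symmetric], metis Pop_selfadjoint funpow_swap1)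

lemma ip_delta:
  assumes "x \<in> X"
  shows "ip (\<lambda>y. if y = x then 1 else 0) f = w x * f x"
  using assms finX by (simp add: ip_def if_distrib[of "\<lambda>z. _ * z * _"] sum.delta cong: if_cong)

lemma Q_delta:
  assumes "x \<in> X" "y \<in> X"
  shows "(Pop ^^ n) (\<lambda>z. if z = y then 1 else 0) x = Q n x y"
  using assms finX by (simp add: Q_apply[symmetric] if_distrib[of "\<lambda>z. _ * z"] sum.delta cong: if_cong)

lemma Q_reversible:
  assumes "x \<in> X" "y \<in> X"
  shows "w x * Q n x y = w y * Q n y x"
  using funpow_Pop_selfadjoint[of "\<lambda>z. if z = x then 1 else 0" n "\<lambda>z. if z = y then 1 else 0"] assms
  by (simp add: ip_delta Q_delta ip_comm[of "(Pop ^^ n) _"])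

lemma Q_nonneg: "x \<in> X \<Longrightarrow> y \<in> X \<Longrightarrow> 0 \<le> Q n x y"
  by (induction n arbitrary: y) (auto simp: Q_0 Q_Suc intro!: sum_nonneg mult_nonneg_nonneg P_nonneg)

lemma funpow_Pop_one: "x \<in> X \<Longrightarrow> (Pop ^^ n) one x = 1"
proof (induction n arbitrary: x)
  case (Suc n)
  then show ?case using Pop_cong[of "(Pop ^^ n) one" one x] by (simp add: Pop_one)
qed simp

lemma Q_row: "x \<in> X \<Longrightarrow> (\<Sum>y\<in>X. Q n x y) = 1"
  using Q_apply[of x n one] by (simp add: funpow_Pop_one)

lemma Q_le:
  assumes "x \<in> X" "y \<in> X"
  shows "w x * Q n x y \<le> w y"
proof -
  have "Q n y x \<le> (\<Sum>z\<in>X. Q n y z)" using assms finX Q_nonneg by (intro member_le_sum) auto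
  then have "w y * Q n y x \<le> w y * 1" using assms w_pos by (intro mult_left_mono) (auto simp: Q_row less_imp_le)
  then show ?thesis using Q_reversible[OF assms] by simp
qed

definition Z :: real where "Z = (\<Sum>x\<in>X. w x)"

lemma Z_pos: "0 < Z"
  unfolding Z_def using X2 finX w_pos by (intro sum_pos) auto

lemma Pop_orthogonal: "ip f one = 0 \<Longrightarrow> ip (Pop f) one = 0"
  using Pop_selfadjoint[of f one] ip_cong[of f f "Pop one" one] Pop_one by simp

text \<open>Polarisation turns the two-sided bound on the quadratic form of \<open>Pop\<close> into
  a norm bound, with no diagonalisation.\<close>

lemma contraction:
  fixes g :: real
  assumes g: "0 < g" "g \<le> 1"
    and gap: "\<And>f s. s \<in> {1, - 1} \<Longrightarrow> ip f one = 0 \<Longrightarrow> 2 * g * ip f f \<le> dirichlet s f"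
    and f: "ip f one = 0"
  shows "ip (Pop f) (Pop f) \<le> (1 - g)\<^sup>2 * ip f f"
proof -
  define c a b where "c = 1 - g" and "a = ip f f" and "b = ip (Pop f) (Pop f)"
  have c0: "0 \<le> c" and a0: "0 \<le> a" using g ip_nonneg by (auto simp: c_def a_def)
  have up: "ip u (Pop u) \<le> c * ip u u" and low: "- (c * ip u u) \<le> ip u (Pop u)" if "ip u one = 0" for u
    using gap[OF _ that, of 1] gap[OF _ that, of "- 1"] by (simp_all add: dirichlet_eq c_def algebra_simps)
  \<comment> \<open>The quadratic forms of \<open>f + t * Pop f\<close> and
    \<open>f - t * Pop f\<close> differ by \<open>4 * t * b\<close>. The best choice below is
    \<open>t = 1 / c\<close>.\<close>
  have key: "2 * t * b \<le> c * a + c * t\<^sup>2 * b" for t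
  proof -
    define u v where "u = (\<lambda>x. f x + t * Pop f x)" and "v = (\<lambda>x. f x + (- t) * Pop f x)"
    have o: "ip u one = 0" "ip v one = 0"
      using f Pop_orthogonal[OF f] unfolding u_def v_def ip_add ip_scale by simp_all
    have sq: "ip (\<lambda>x. f x + s * Pop f x) (\<lambda>x. f x + s * Pop f x) = a + 2 * s * ip f (Pop f) + s\<^sup>2 * b" for s
      unfolding ip_add ip_scale using ip_comm[of "Pop f" f] by (simp add: a_def b_def power2_eq_square algebra_simps)
    have pq: "ip (\<lambda>x. f x + s * Pop f x) (Pop (\<lambda>x. f x + s * Pop f x))
        = ip f (Pop f) + 2 * s * b + s\<^sup>2 * ip (Pop f) (Pop (Pop f))" for s
    proof -
      have "Pop (\<lambda>x. f x + s * Pop f x) = (\<lambda>x. Pop f x + s * Pop (Pop f) x)"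
        by (rule ext) (simp only: Pop_add Pop_scale)
      then show ?thesis
        unfolding ip_add ip_scale using Pop_selfadjoint[of f "Pop f"]
        by (simp add: ip_add ip_scale b_def power2_eq_square algebra_simps)
    qed
    have "ip u (Pop u) - ip v (Pop v) \<le> c * ip u u + c * ip v v"
      using up[OF o(1)] low[OF o(2)] by linarith
    then show ?thesis
      unfolding u_def v_def sq pq by (simp add: algebra_simps)
  qed
  have "b \<le> c\<^sup>2 * a"
  proof (cases "c = 0")
    case True
    then show ?thesis using key[of 1] by simp
  next
    case False
    then have c: "0 < c" using c0 by simp
    have "2 * (1 / c) * b \<le> c * a + c * (1 / c)\<^sup>2 * b" by (rule key)
    then have "b / c \<le> c * a" using c by (simp add: power2_eq_square field_simps)
    then show ?thesis using c by (simp add: power2_eq_square field_simps)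
  qed
  then show ?thesis by (simp add: a_def b_def c_def)
qed

lemma funpow_contraction:
  fixes g :: real
  assumes g: "0 < g" "g \<le> 1"
    and gap: "\<And>f s. s \<in> {1, - 1} \<Longrightarrow> ip f one = 0 \<Longrightarrow> 2 * g * ip f f \<le> dirichlet s f"
    and f: "ip f one = 0"
  shows "ip ((Pop ^^ n) f) one = 0 \<and> ip ((Pop ^^ n) f) ((Pop ^^ n) f) \<le> ((1 - g) ^ n)\<^sup>2 * ip f f"
proof (induction n)
  case 0 then show ?case using f by simp
next
  case (Suc n)
  then have o: "ip ((Pop ^^ n) f) one = 0" by simp
  have "ip ((Pop ^^ Suc n) f) ((Pop ^^ Suc n) f) \<le> (1 - g)\<^sup>2 * ip ((Pop ^^ n) f) ((Pop ^^ n) f)"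
    using contraction[OF g gap o] by simp
  also have "\<dots> \<le> (1 - g)\<^sup>2 * (((1 - g) ^ n)\<^sup>2 * ip f f)" using Suc by (intro mult_left_mono) auto
  finally show ?case using Pop_orthogonal[OF o] by (simp add: power_mult_distrib ac_simps)
qed

text \<open>The error at \<open>y\<close> is \<open>Pop ^^ n\<close> applied to the centred point
  mass at \<open>y\<close> and read off at \<open>x\<close>. The ratio of weights, bounded by
  \<open>R\<^sup>2\<close>, is the price for passing from the norm to a point value.\<close>

lemma mixing_upper:
  fixes g R :: real
  assumes g: "0 < g" "g \<le> 1"
    and gap: "\<And>f s. s \<in> {1, - 1} \<Longrightarrow> ip f one = 0 \<Longrightarrow> 2 * g * ip f f \<le> dirichlet s f"
    and R: "0 \<le> R" "\<And>x y. x \<in> X \<Longrightarrow> y \<in> X \<Longrightarrow> w y \<le> R\<^sup>2 * w x"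
    and x: "x \<in> X"
  shows "(\<Sum>y\<in>X. \<bar>Q n x y - w y / Z\<bar>) \<le> card X * (R * (1 - g) ^ n)"
proof -
  have "\<bar>Q n x y - w y / Z\<bar> \<le> R * (1 - g) ^ n" if y: "y \<in> X" for y
  proof -
    define d where "d = (\<lambda>z. if z = y then 1 else 0 :: real)"
    define f where "f = (\<lambda>z. d z - (w y / Z) * one z)"
    have ip11: "ip one one = Z" by (simp add: ip_def Z_def)
    have d: "ip d k = w y * k y" for k unfolding d_def by (rule ip_delta[OF y])
    have f1: "ip f one = 0" unfolding f_def ip_diff ip_scale d ip11 using Z_pos by simp
    have "ip f f = w y - (w y)\<^sup>2 / Z"
      unfolding f_def ip_diff ip_scale d ip11 using Z_pos by (simp add: ip_comm[of one d] d power2_eq_square) (simp add: d_def)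
    then have ff: "ip f f \<le> w y" using Z_pos by simp
    have "(Pop ^^ n) f x = (\<Sum>z\<in>X. Q n x z * d z) - (w y / Z) * (\<Sum>z\<in>X. Q n x z)"
      unfolding Q_apply[OF x, symmetric] f_def by (simp add: right_diff_distrib sum_subtractf sum_distrib_left sum_divide_distrib mult.commute)
    then have Qf: "(Pop ^^ n) f x = Q n x y - w y / Z"
      using Q_row[OF x] Q_apply[OF x] Q_delta[OF x y] by (simp add: d_def)
    have "w x * (Q n x y - w y / Z)\<^sup>2 \<le> ip ((Pop ^^ n) f) ((Pop ^^ n) f)"
      using ip_ge_term[OF x, of "(Pop ^^ n) f"] by (simp add: Qf)
    also have "\<dots> \<le> ((1 - g) ^ n)\<^sup>2 * ip f f" using funpow_contraction[OF g gap f1] by simp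
    also have "\<dots> \<le> ((1 - g) ^ n)\<^sup>2 * (R\<^sup>2 * w x)"
      using ff R(2)[OF x y] by (intro mult_left_mono) auto
    finally have "w x * (Q n x y - w y / Z)\<^sup>2 \<le> w x * (R * (1 - g) ^ n)\<^sup>2"
      by (simp add: power_mult_distrib ac_simps)
    then have "(Q n x y - w y / Z)\<^sup>2 \<le> (R * (1 - g) ^ n)\<^sup>2" using w_pos[OF x] by (simp only: mult_le_cancel_left_pos)
    then show ?thesis using R(1) g by (simp add: abs_le_square_iff[symmetric])
  qed
  then have "(\<Sum>y\<in>X. \<bar>Q n x y - w y / Z\<bar>) \<le> (\<Sum>y\<in>X. R * (1 - g) ^ n)" by (rule sum_mono)
  then show ?thesis by simp
qed

text \<open>By \<open>Q_le\<close> the law at any time, scaled by \<open>w x\<close>, lies below the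
  stationary weight, so each step loses at most one stationary flux out of \<open>A\<close>.\<close>

lemma escape_le:
  assumes A: "A \<subseteq> X" "x \<in> A"
  shows "w x * (\<Sum>y\<in>X - A. Q n x y) \<le> n * (\<Sum>z\<in>A. \<Sum>y\<in>X - A. w z * P z y)"
proof (induction n)
  case 0
  have "(\<Sum>y\<in>X - A. Q 0 x y) = 0" using A by (intro sum.neutral) (auto simp: Q_0)
  then show ?case by simp
next
  case (Suc n)
  have x: "x \<in> X" and finA: "finite A" using A finX finite_subset by auto
  let ?e = "\<lambda>z. \<Sum>y\<in>X - A. P z y"
  have e: "0 \<le> ?e z" "?e z \<le> 1" if "z \<in> X" for z
  proof -
    show "0 \<le> ?e z" using that P_nonneg by (intro sum_nonneg) auto
    have "?e z \<le> (\<Sum>y\<in>X. P z y)" using that P_nonneg finX by (intro sum_mono2) auto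
    then show "?e z \<le> 1" using P_row[OF that] by simp
  qed
  have "w x * (\<Sum>y\<in>X - A. Q (Suc n) x y) = w x * (\<Sum>z\<in>X. Q n x z * ?e z)"
    unfolding Q_Suc by (subst sum.swap) (simp add: sum_distrib_left)
  also have "\<dots> = (\<Sum>z\<in>X. w x * Q n x z * ?e z)" by (simp add: sum_distrib_left ac_simps)
  also have "\<dots> = (\<Sum>z\<in>X - A. w x * Q n x z * ?e z) + (\<Sum>z\<in>A. w x * Q n x z * ?e z)"
    using A finX by (intro sum.subset_diff) auto
  also have "\<dots> \<le> (\<Sum>z\<in>X - A. w x * Q n x z) + (\<Sum>z\<in>A. w z * ?e z)"
  proof (intro add_mono sum_mono)
    fix z assume z: "z \<in> X - A"
    have "0 \<le> w x * Q n x z" using z x Q_nonneg w_pos by (simp add: less_imp_le)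
    then show "w x * Q n x z * ?e z \<le> w x * Q n x z" using e[of z] z by (simp add: mult_left_le)
  next
    fix z assume z: "z \<in> A"
    then show "w x * Q n x z * ?e z \<le> w z * ?e z"
      using Q_le[OF x, of z] e[of z] A by (intro mult_right_mono) auto
  qed
  also have "\<dots> \<le> n * (\<Sum>z\<in>A. \<Sum>y\<in>X - A. w z * P z y) + (\<Sum>z\<in>A. \<Sum>y\<in>X - A. w z * P z y)"
    using Suc by (simp add: sum_distrib_left)
  finally show ?case by (simp add: algebra_simps)
qed

lemma mixing_lower:
  assumes A: "A \<subseteq> X" "x \<in> A"
  shows "2 * (1 - n * (\<Sum>z\<in>A. \<Sum>y\<in>X - A. w z * P z y) / w x - (\<Sum>y\<in>A. w y) / Z)
    \<le> (\<Sum>y\<in>X. \<bar>Q n x y - w y / Z\<bar>)"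
proof -
  have x: "x \<in> X" using A by auto
  let ?d = "\<lambda>y. Q n x y - w y / Z"
  have split: "(\<Sum>y\<in>X. F y) = (\<Sum>y\<in>X - A. F y) + (\<Sum>y\<in>A. F y)" for F :: "'a \<Rightarrow> real"
    using A finX by (intro sum.subset_diff) auto
  have "(\<Sum>y\<in>X. w y / Z) = 1" using Z_pos by (simp add: Z_def sum_divide_distrib[symmetric])
  then have "(\<Sum>y\<in>X. ?d y) = 0" using Q_row[OF x] by (simp add: sum_subtractf)
  then have "(\<Sum>y\<in>X - A. ?d y) = - (\<Sum>y\<in>A. ?d y)" using split[of ?d] by simp
  moreover have "\<bar>\<Sum>y\<in>X - A. ?d y\<bar> + \<bar>\<Sum>y\<in>A. ?d y\<bar> \<le> (\<Sum>y\<in>X. \<bar>?d y\<bar>)"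
    unfolding split[of "\<lambda>y. \<bar>?d y\<bar>"] by (intro add_mono sum_abs)
  ultimately have "2 * (\<Sum>y\<in>A. ?d y) \<le> (\<Sum>y\<in>X. \<bar>?d y\<bar>)" by linarith
  moreover have "(\<Sum>y\<in>A. ?d y) = 1 - (\<Sum>y\<in>X - A. Q n x y) - (\<Sum>y\<in>A. w y) / Z"
    using split[of "Q n x"] Q_row[OF x] by (simp add: sum_subtractf sum_divide_distrib)
  moreover have "(\<Sum>y\<in>X - A. Q n x y) \<le> n * (\<Sum>z\<in>A. \<Sum>y\<in>X - A. w z * P z y) / w x"
    using escape_le[OF A, of n] w_pos[OF x] by (simp add: field_simps)
  ultimately have "1 - n * (\<Sum>z\<in>A. \<Sum>y\<in>X - A. w z * P z y) / w x - (\<Sum>y\<in>A. w y) / Z \<le> (\<Sum>y\<in>X. \<bar>?d y\<bar>) / 2"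
    by argo
  then show ?thesis by argo
qed

end

text \<open>\<open>C\<close> is fixed before \<open>f\<close>, \<open>s\<close>,
  \<open>\<kappa>\<close> and \<open>D\<close>: it depends on the path only, which later makes it
  independent of \<beta>. With \<open>s = - 1\<close> the reference value changes sign from step to
  step, which squares do not see.\<close>

lemma rtrancl_bound:
  assumes "(x, y) \<in> R\<^sup>*"
  shows "\<exists>C\<ge>0. \<forall>(f :: 'a \<Rightarrow> real) s \<kappa> D. 0 \<le> \<kappa> \<longrightarrow> s\<^sup>2 = 1 \<longrightarrow> (\<forall>(u, v)\<in>R. \<kappa> * (f u - s * f v)\<^sup>2 \<le> D) \<longrightarrow>
    \<kappa> * (f y)\<^sup>2 \<le> D \<longrightarrow> \<kappa> * (f x)\<^sup>2 \<le> C * D"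
  using assms
proof (induction rule: converse_rtrancl_induct)
  case base
  show ?case by (intro exI[of _ 1]) auto
next
  case (step x z)
  then obtain C where C: "0 \<le> C" "\<And>(f :: 'a \<Rightarrow> real) s \<kappa> D. 0 \<le> \<kappa> \<Longrightarrow> s\<^sup>2 = 1 \<Longrightarrow>
    \<forall>(u, v)\<in>R. \<kappa> * (f u - s * f v)\<^sup>2 \<le> D \<Longrightarrow> \<kappa> * (f y)\<^sup>2 \<le> D \<Longrightarrow> \<kappa> * (f z)\<^sup>2 \<le> C * D" by blast
  have "\<kappa> * (f x)\<^sup>2 \<le> (2 * C + 2) * D"
    if H: "0 \<le> \<kappa>" "s\<^sup>2 = 1" "\<forall>(u, v)\<in>R. \<kappa> * (f u - s * f v)\<^sup>2 \<le> D" "\<kappa> * (f y)\<^sup>2 \<le> D" for f :: "'a \<Rightarrow> real" and s \<kappa> D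
  proof -
    have "(f x)\<^sup>2 \<le> 2 * (f x - s * f z)\<^sup>2 + 2 * (s * f z)\<^sup>2"
      using zero_le_power2[of "(f x - s * f z) - s * f z"] by (simp add: power2_eq_square algebra_simps)
    then have "(f x)\<^sup>2 \<le> 2 * (f x - s * f z)\<^sup>2 + 2 * (f z)\<^sup>2" by (simp add: power_mult_distrib H(2))
    then have "\<kappa> * (f x)\<^sup>2 \<le> \<kappa> * (2 * (f x - s * f z)\<^sup>2 + 2 * (f z)\<^sup>2)" using H(1) by (rule mult_left_mono)
    also have "\<dots> = 2 * (\<kappa> * (f x - s * f z)\<^sup>2) + 2 * (\<kappa> * (f z)\<^sup>2)" by (simp add: algebra_simps)
    also have "\<kappa> * (f x - s * f z)\<^sup>2 \<le> D" using H(3) step.hyps(1) by blast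
    also have "\<kappa> * (f z)\<^sup>2 \<le> C * D" by (rule C(2)[OF H])
    finally show ?thesis by (simp add: algebra_simps)
  qed
  then show ?case using C(1) by (intro exI[of _ "2 * C + 2"]) auto
qed

section \<open>The Metropolis dynamics\<close>

lemma flip_flip: "flip (flip \<sigma> x) x = \<sigma>"
  by (auto simp: flip_def)

lemma flip_in_configs:
  assumes "\<sigma> \<in> configs L" "x \<in> Lam L"
  shows "flip \<sigma> x \<in> configs L"
  using assms unfolding configs_def flip_def by fastforce

lemma flip_neq:
  assumes "\<sigma> \<in> configs L" "x \<in> Lam L"
  shows "flip \<sigma> x \<noteq> \<sigma>"
proof
  assume "flip \<sigma> x = \<sigma>"
  then have "flip \<sigma> x x = \<sigma> x" by simp
  then have "\<sigma> x = 0" by (simp add: flip_def)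
  moreover have "\<sigma> x \<in> {- 1, 1}" using assms unfolding configs_def by blast
  ultimately show False by auto
qed

definition weight :: "nat \<Rightarrow> real \<Rightarrow> real \<Rightarrow> real \<Rightarrow> config \<Rightarrow> real" where
  "weight L J h \<beta> \<sigma> = exp (- \<beta> * Ham L J h \<sigma>)"

text \<open>The conductance depends only on the higher of the two energies; this yields detailed
  balance and ties the dynamics to energy barriers.\<close>

lemma weight_metro_off:
  assumes "x \<in> Lam L"
  shows "weight L J h \<beta> \<sigma> * metro_off L J h \<beta> \<sigma> (flip \<sigma> x)
    = exp (- \<beta> * max (Ham L J h \<sigma>) (Ham L J h (flip \<sigma> x))) / card (Lam L)"
proof -
  have "metro_off L J h \<beta> \<sigma> (flip \<sigma> x) = exp (- \<beta> * max 0 (Ham L J h (flip \<sigma> x) - Ham L J h \<sigma>)) / card (Lam L)"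
    using assms by (auto simp: metro_off_def)
  moreover have "- \<beta> * Ham L J h \<sigma> + - \<beta> * max 0 (Ham L J h (flip \<sigma> x) - Ham L J h \<sigma>)
      = - \<beta> * max (Ham L J h \<sigma>) (Ham L J h (flip \<sigma> x))"
    by (simp add: max_def algebra_simps)
  ultimately show ?thesis by (simp add: weight_def exp_add[symmetric])
qed

text \<open>Used with \<open>b = 1\<close> for nonnegative diagonal entries and with
  \<open>b = 1 / 2\<close> for the holding probability at all-plus.\<close>

lemma sum_metro_off_le:
  assumes "0 < L" "0 \<le> b" "\<And>x. x \<in> Lam L \<Longrightarrow> exp (- \<beta> * max 0 (Ham L J h (flip \<sigma> x) - Ham L J h \<sigma>)) \<le> b"
  shows "(\<Sum>\<eta>\<in>configs L - {\<sigma>}. metro_off L J h \<beta> \<sigma> \<eta>) \<le> b"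
proof -
  let ?N = "real (card (Lam L))"
  have N: "0 < ?N" using assms(1) by (simp add: card_Lam)
  have "(\<Sum>\<eta>\<in>configs L - {\<sigma>}. metro_off L J h \<beta> \<sigma> \<eta>)
      \<le> (\<Sum>\<eta>\<in>configs L - {\<sigma>}. if \<eta> \<in> flip \<sigma> ` Lam L then b / ?N else 0)"
    using assms N by (intro sum_mono) (auto simp: metro_off_def divide_right_mono)
  also have "\<dots> \<le> (\<Sum>\<eta>\<in>flip \<sigma> ` Lam L. b / ?N)"
    using assms(2) N finite_Lam finite_configs
    by (simp add: sum.If_cases) (intro divide_right_mono mult_right_mono, auto intro!: card_mono)
  also have "\<dots> = card (flip \<sigma> ` Lam L) * (b / ?N)" by simp
  also have "\<dots> \<le> ?N * (b / ?N)"
    using assms(2) N finite_Lam by (intro mult_right_mono) (auto intro: card_image_le)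
  also have "\<dots> = b" using N by simp
  finally show ?thesis .
qed

lemma metro_off_nonneg: "0 \<le> metro_off L J h \<beta> \<sigma> \<eta>"
  by (simp add: metro_off_def)

lemma weight_metro_off_sym:
  "weight L J h \<beta> \<sigma> * metro_off L J h \<beta> \<sigma> \<eta> = weight L J h \<beta> \<eta> * metro_off L J h \<beta> \<eta> \<sigma>"
proof (cases "\<exists>x\<in>Lam L. \<eta> = flip \<sigma> x")
  case True
  then obtain x where x: "x \<in> Lam L" "\<eta> = flip \<sigma> x" by blast
  have s: "\<sigma> = flip \<eta> x" by (simp add: x flip_flip)
  show ?thesis
    using weight_metro_off[OF x(1), of J h \<beta> \<sigma>] weight_metro_off[OF x(1), of J h \<beta> \<eta>]
    unfolding x(2)[symmetric] s[symmetric] by (simp add: max.commute)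
next
  case False
  then have "\<not> (\<exists>x\<in>Lam L. \<sigma> = flip \<eta> x)" by (metis flip_flip)
  then show ?thesis using False by (simp add: metro_off_def)
qed

lemma metropolis_chain:
  assumes "0 < L" "0 \<le> \<beta>"
  shows "chain_powers (configs L) (weight L J h \<beta>) (metro L J h \<beta>) (metro_pow L J h \<beta>)"
proof
  show "finite (configs L)" by (rule finite_configs)
  have "inj_on (conf L) (Pow (Lam L))"
    by (rule inj_on_inverseI[of _ "plus_sites L"]) (auto simp: plus_sites_conf)
  then have "card (configs L) = 2 ^ card (Lam L)"
    unfolding configs_eq by (simp add: card_image card_Pow finite_Lam)
  moreover have "(2 :: nat) ^ 1 \<le> 2 ^ card (Lam L)" using assms(1) by (intro power_increasing) (auto simp: card_Lam)
  ultimately show "2 \<le> card (configs L)" by simp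
  show "0 < weight L J h \<beta> \<sigma>" for \<sigma> by (simp add: weight_def)
  show "0 \<le> metro L J h \<beta> \<sigma> \<eta>" for \<sigma> \<eta>
    using sum_metro_off_le[OF assms(1), of 1 \<beta> J h \<sigma>] assms(2) by (simp add: metro_def metro_off_nonneg)
  show "(\<Sum>\<eta>\<in>configs L. metro L J h \<beta> \<sigma> \<eta>) = 1" if "\<sigma> \<in> configs L" for \<sigma>
  proof -
    have "(\<Sum>\<eta>\<in>configs L. metro L J h \<beta> \<sigma> \<eta>)
        = metro L J h \<beta> \<sigma> \<sigma> + (\<Sum>\<eta>\<in>configs L - {\<sigma>}. metro L J h \<beta> \<sigma> \<eta>)"
      using that finite_configs by (rule sum.remove[rotated])
    also have "(\<Sum>\<eta>\<in>configs L - {\<sigma>}. metro L J h \<beta> \<sigma> \<eta>) = (\<Sum>\<eta>\<in>configs L - {\<sigma>}. metro_off L J h \<beta> \<sigma> \<eta>)"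
      by (intro sum.cong) (auto simp: metro_def)
    finally show ?thesis by (simp add: metro_def)
  qed
  show "weight L J h \<beta> \<sigma> * metro L J h \<beta> \<sigma> \<eta> = weight L J h \<beta> \<eta> * metro L J h \<beta> \<eta> \<sigma>" for \<sigma> \<eta>
    using weight_metro_off_sym by (auto simp: metro_def)
qed auto

section \<open>Poincare inequality for the Metropolis chain\<close>

context
  fixes L :: nat and J h :: real
  assumes h: "0 < h" and J: "2 * h \<le> J"
    and delta: "delta_hex J h \<noteq> 1 / 2"
    and large: "(4 * J / h)\<^sup>2 \<le> real (card (Lam L))"
begin

abbreviation (input) "X \<equiv> configs L"
abbreviation (input) "H \<equiv> Ham L J h"
abbreviation (input) "N \<equiv> real (card (Lam L))"
abbreviation (input) "G \<equiv> Gamma_hex J h"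
abbreviation (input) "allp \<equiv> conf L (Lam L)"
abbreviation (input) "allm \<equiv> conf L {}"
abbreviation (input) "wt \<equiv> weight L J h"
abbreviation (input) "ME \<equiv> metro L J h"
abbreviation (input) "form \<beta> \<equiv> reversible_chain.dirichlet X (wt \<beta>) (ME \<beta>)"
abbreviation (input) "scal \<beta> \<equiv> reversible_chain.ip X (wt \<beta>)"

lemma L_ge_2: "2 \<le> L"
proof -
  have "5 < real L"
    by (rule L_ge[OF h J delta large, of 2]) (use J_gt[OF h J delta large] in auto)
  then show ?thesis by simp
qed

lemma N_pos: "1 \<le> N"
proof -
  have "0 < card (Lam L)" using L_ge_2 by (simp add: card_Lam)
  then show ?thesis by linarith
qed

lemma powers_metropolis: "0 \<le> \<beta> \<Longrightarrow> chain_powers X (wt \<beta>) (ME \<beta>) (metro_pow L J h \<beta>)"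
  using L_ge_2 by (intro metropolis_chain) auto

lemma reversible_metropolis: "0 \<le> \<beta> \<Longrightarrow> reversible_chain X (wt \<beta>) (ME \<beta>)"
  using powers_metropolis chain_powers.axioms(1) by blast

lemma G_pos: "0 < G"
  using three_J_le_Gamma[OF h J] h J by linarith

lemma H_energy: "\<sigma> \<in> X \<Longrightarrow> H \<sigma> = energy L J h (plus_sites L \<sigma>) + (h - 3 / 2 * J) * (real L)\<^sup>2"
  using Ham_conf[OF L_ge_2, of "plus_sites L \<sigma>" J h] conf_plus_sites[of \<sigma> L] by (simp add: plus_sites_def)

lemma H_plus_gap:
  assumes "\<sigma> \<in> X" "\<sigma> \<noteq> allp"
  shows "H allp + h \<le> H \<sigma>"
proof -
  have "plus_sites L \<sigma> \<noteq> Lam L" using conf_plus_sites[OF assms(1)] assms(2) by auto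
  then have "plus_sites L \<sigma> \<subset> Lam L" by (auto simp: plus_sites_def)
  then have "energy L J h (Lam L) + h \<le> energy L J h (plus_sites L \<sigma>)"
    using energy_gap_Lam[of h J] h J by auto
  then show ?thesis using H_energy[OF assms(1)] Ham_conf[OF L_ge_2 order_refl, of J h] by simp
qed

lemma H_plus_le: "\<sigma> \<in> X \<Longrightarrow> H allp \<le> H \<sigma>"
  using H_plus_gap[of \<sigma>] h by (cases "\<sigma> = allp") auto

lemma path_step:
  assumes b: "0 \<le> \<beta>" and AB: "(A, B) \<in> grow L J h (H \<sigma> - (h - 3 / 2 * J) * (real L)\<^sup>2 + G)"
  shows "exp (- \<beta> * (H \<sigma> + G)) / N * (f (conf L A) - s * f (conf L B))\<^sup>2 \<le> form \<beta> s f"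
proof -
  interpret reversible_chain X "wt \<beta>" "ME \<beta>" using reversible_metropolis[OF b] .
  obtain x where x: "B = insert x A" "A \<subseteq> Lam L" "x \<in> Lam L" "x \<notin> A"
    "energy L J h A \<le> H \<sigma> - (h - 3 / 2 * J) * (real L)\<^sup>2 + G"
    "energy L J h B \<le> H \<sigma> - (h - 3 / 2 * J) * (real L)\<^sup>2 + G"
    using AB by (auto simp: grow_def)
  have f: "conf L B = flip (conf L A) x" using conf_insert[OF x(3,4)] x(1) by simp
  have H: "H (conf L A) \<le> H \<sigma> + G" "H (conf L B) \<le> H \<sigma> + G"
    using Ham_conf[OF L_ge_2, of A J h] Ham_conf[OF L_ge_2, of B J h] x by auto
  have ne: "conf L B \<noteq> conf L A" unfolding f by (rule flip_neq[OF conf_in_configs x(3)])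
  have "wt \<beta> (conf L A) * ME \<beta> (conf L A) (conf L B) = exp (- \<beta> * max (H (conf L A)) (H (conf L B))) / N"
    using weight_metro_off[OF x(3)] ne by (simp add: metro_def f)
  moreover have "\<beta> * max (H (conf L A)) (H (conf L B)) \<le> \<beta> * (H \<sigma> + G)"
    using H b by (intro mult_left_mono) auto
  then have "exp (- \<beta> * (H \<sigma> + G)) / N \<le> exp (- \<beta> * max (H (conf L A)) (H (conf L B))) / N"
    by (intro divide_right_mono) auto
  ultimately have k: "exp (- \<beta> * (H \<sigma> + G)) / N \<le> wt \<beta> (conf L A) * ME \<beta> (conf L A) (conf L B)" by simp
  show ?thesis
    using mult_right_mono[OF k, of "(f (conf L A) - s * f (conf L B))\<^sup>2"]
      term_le_dirichlet[OF conf_in_configs[of L A] conf_in_configs[of L B], where f = f and s = s] by simp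
qed

lemma path_bound:
  assumes \<sigma>: "\<sigma> \<in> X"
  shows "\<exists>C\<ge>0. \<forall>\<beta>\<ge>0. \<forall>f s. s\<^sup>2 = 1 \<longrightarrow> exp (- \<beta> * (H \<sigma> + G)) / N * (f allp)\<^sup>2 \<le> form \<beta> s f \<longrightarrow>
      exp (- \<beta> * (H \<sigma> + G)) / N * (f \<sigma>)\<^sup>2 \<le> C * form \<beta> s f"
proof -
  \<comment> \<open>The level \<open>H \<sigma> + G\<close> on the scale of \<open>energy\<close>,
    which differs from \<open>H\<close> by a constant.\<close>
  let ?c = "H \<sigma> - (h - 3 / 2 * J) * (real L)\<^sup>2 + G"
  have "plus_sites L \<sigma> \<subseteq> Lam L" by (auto simp: plus_sites_def)
  then have "(plus_sites L \<sigma>, Lam L) \<in> (grow L J h ?c)\<^sup>*"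
    using grow_to_Lam[OF h J delta large, of "plus_sites L \<sigma>"] H_energy[OF \<sigma>] by simp
  from rtrancl_bound[OF this] obtain C where C: "0 \<le> C"
    "\<And>(f :: site set \<Rightarrow> real) s \<kappa> D. 0 \<le> \<kappa> \<Longrightarrow> s\<^sup>2 = 1 \<Longrightarrow> \<forall>(u, v)\<in>grow L J h ?c. \<kappa> * (f u - s * f v)\<^sup>2 \<le> D \<Longrightarrow>
      \<kappa> * (f (Lam L))\<^sup>2 \<le> D \<Longrightarrow> \<kappa> * (f (plus_sites L \<sigma>))\<^sup>2 \<le> C * D" by blast
  have "exp (- \<beta> * (H \<sigma> + G)) / N * (f \<sigma>)\<^sup>2 \<le> C * form \<beta> s f"
    if "0 \<le> \<beta>" "s\<^sup>2 = 1" "exp (- \<beta> * (H \<sigma> + G)) / N * (f allp)\<^sup>2 \<le> form \<beta> s f" for \<beta> f s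
  proof -
    have "\<forall>(u, v)\<in>grow L J h ?c. exp (- \<beta> * (H \<sigma> + G)) / N * (f (conf L u) - s * f (conf L v))\<^sup>2 \<le> form \<beta> s f"
      using path_step[OF that(1)] by blast
    from C(2)[of _ s "\<lambda>S. f (conf L S)", OF _ that(2) this that(3)] show ?thesis
      by (simp add: conf_plus_sites[OF \<sigma>])
  qed
  then show ?thesis using C(1) by blast
qed

text \<open>A flip away from all-plus costs at least \<open>h\<close>, so for these \<beta> it is
  accepted with probability at most one half. The remaining self-loop is what rules out eigenvalues
  near \<open>- 1\<close>.\<close>

lemma metro_plus_plus:
  assumes "ln 2 / h \<le> \<beta>"
  shows "1 / 2 \<le> ME \<beta> allp allp"
proof -
  have hb: "ln 2 \<le> \<beta> * h" using assms h by (simp add: field_simps)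
  then have b: "0 \<le> \<beta>" using h ln_2_less_1 by (smt (verit) ln_gt_zero mult_neg_pos)
  have "(\<Sum>\<eta>\<in>X - {allp}. metro_off L J h \<beta> allp \<eta>) \<le> 1 / 2"
  proof (rule sum_metro_off_le)
    fix x assume x: "x \<in> Lam L"
    have "h \<le> H (flip allp x) - H allp"
      using H_plus_gap[OF flip_in_configs[OF conf_in_configs x] flip_neq[OF conf_in_configs x]] by simp
    then have "\<beta> * h \<le> \<beta> * max 0 (H (flip allp x) - H allp)" using b by (intro mult_left_mono) auto
    then have "exp (- \<beta> * max 0 (H (flip allp x) - H allp)) \<le> exp (- ln 2)" using hb by simp
    then show "exp (- \<beta> * max 0 (H (flip allp x) - H allp)) \<le> 1 / 2" by (simp add: exp_minus)
  qed (use L_ge_2 in auto)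
  then show ?thesis by (simp add: metro_def)
qed

text \<open>All-plus is the common end of all paths, so every value of \<open>f\<close> is compared
  with the value there. The case \<open>s = 1\<close> covers all \<beta> \<ge> 0 and serves the gap;
  \<open>s = - 1\<close> relies on the self-loop and serves the mixing time.\<close>

lemma poincare_constant:
  obtains c where "0 < c" "c \<le> 1"
    "\<And>\<beta> f s. 0 \<le> \<beta> \<Longrightarrow> s = 1 \<or> s = - 1 \<and> ln 2 / h \<le> \<beta> \<Longrightarrow> scal \<beta> f (\<lambda>_. 1) = 0 \<Longrightarrow>
      2 * (c * exp (- \<beta> * G)) * scal \<beta> f f \<le> form \<beta> s f"
proof -
  obtain C0 where C0: "\<And>\<sigma>. \<sigma> \<in> X \<Longrightarrow> 0 \<le> C0 \<sigma> \<and> (\<forall>\<beta>\<ge>0. \<forall>f s. s\<^sup>2 = 1 \<longrightarrow>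
      exp (- \<beta> * (H \<sigma> + G)) / N * (f allp)\<^sup>2 \<le> form \<beta> s f \<longrightarrow>
      exp (- \<beta> * (H \<sigma> + G)) / N * (f \<sigma>)\<^sup>2 \<le> C0 \<sigma> * form \<beta> s f)"
    using path_bound by metis
  define C where "C = (\<Sum>\<sigma>\<in>X. C0 \<sigma>) + 1"
  have Cpos: "1 \<le> C" unfolding C_def using C0 by (simp add: sum_nonneg)
  define c where "c = 1 / (2 * (N * C))"
  have NC: "1 \<le> N * C" using N_pos Cpos mult_mono[of 1 N 1 C] by simp
  have c: "0 < c" "c \<le> 1" using NC by (auto simp: c_def field_simps)
  have "2 * (c * exp (- \<beta> * G)) * scal \<beta> f f \<le> form \<beta> s f"
    if b: "0 \<le> \<beta>" and s: "s = 1 \<or> s = - 1 \<and> ln 2 / h \<le> \<beta>" and f: "scal \<beta> f (\<lambda>_. 1) = 0" for \<beta> f s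
  proof -
    interpret reversible_chain X "wt \<beta>" "ME \<beta>" using reversible_metropolis[OF b] .
    \<comment> \<open>For \<open>s = 1\<close> the form ignores constants, so the value at all-plus
      can be subtracted. For \<open>s = - 1\<close> it does not, and the self-loop controls that
      value instead.\<close>
    define a where "a = (if s = 1 then f allp else 0)"
    define k where "k = (\<lambda>x. f x - a * one x)"
    let ?D = "form \<beta> s f" and ?W = "\<Sum>\<sigma>\<in>X. wt \<beta> \<sigma> * (k \<sigma>)\<^sup>2"
    have kD: "form \<beta> s k = ?D" using s by (auto simp: dirichlet_def k_def a_def)
    have start: "exp (- \<beta> * (H \<sigma> + G)) / N * (k allp)\<^sup>2 \<le> ?D" if \<sigma>: "\<sigma> \<in> X" for \<sigma>
    proof (cases "s = 1")
      case True
      then show ?thesis using dirichlet_nonneg by (simp add: k_def a_def)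
    next
      case False
      then have s: "s = - 1" "ln 2 / h \<le> \<beta>" using s by auto
      have "\<beta> * H allp \<le> \<beta> * (H \<sigma> + G)" using H_plus_le[OF \<sigma>] G_pos b by (intro mult_left_mono) auto
      then have "exp (- \<beta> * (H \<sigma> + G)) \<le> wt \<beta> allp" by (simp add: weight_def)
      moreover have "exp (- \<beta> * (H \<sigma> + G)) / N \<le> exp (- \<beta> * (H \<sigma> + G))"
        using N_pos by (simp add: divide_le_eq mult_left_mono)
      moreover have "wt \<beta> allp * 1 \<le> wt \<beta> allp * (4 * ME \<beta> allp allp)"
        using metro_plus_plus[OF s(2)] w_pos[OF conf_in_configs] by (intro mult_left_mono) (auto simp: less_imp_le)
      ultimately have "exp (- \<beta> * (H \<sigma> + G)) / N \<le> wt \<beta> allp * (4 * ME \<beta> allp allp)" by linarith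
      then have "exp (- \<beta> * (H \<sigma> + G)) / N * (k allp)\<^sup>2 \<le> wt \<beta> allp * (4 * ME \<beta> allp allp) * (k allp)\<^sup>2"
        by (rule mult_right_mono) simp
      also have "\<dots> = wt \<beta> allp * ME \<beta> allp allp * (k allp - s * k allp)\<^sup>2"
        by (simp add: s(1) power2_eq_square)
      also have "\<dots> \<le> form \<beta> s k" by (rule term_le_dirichlet[OF conf_in_configs conf_in_configs])
      finally show ?thesis by (simp only: kD)
    qed
    have "s\<^sup>2 = 1" using s by auto
    then have "exp (- \<beta> * (H \<sigma> + G)) / N * (k \<sigma>)\<^sup>2 \<le> C0 \<sigma> * ?D" if "\<sigma> \<in> X" for \<sigma>
      using C0[OF that] b start[OF that] kD by metis
    then have "(\<Sum>\<sigma>\<in>X. exp (- \<beta> * (H \<sigma> + G)) / N * (k \<sigma>)\<^sup>2) \<le> (\<Sum>\<sigma>\<in>X. C0 \<sigma> * ?D)" by (rule sum_mono)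
    also have "\<dots> \<le> C * ?D" using dirichlet_nonneg by (simp add: C_def sum_distrib_right distrib_right)
    also have "(\<Sum>\<sigma>\<in>X. exp (- \<beta> * (H \<sigma> + G)) / N * (k \<sigma>)\<^sup>2) = exp (- \<beta> * G) / N * ?W"
      by (simp add: sum_distrib_left weight_def distrib_left exp_diff exp_add exp_minus field_simps)
    finally have "N * (exp (- \<beta> * G) / N * ?W) \<le> N * (C * ?D)" using N_pos by (intro mult_left_mono) auto
    then have "exp (- \<beta> * G) * ?W \<le> N * (C * ?D)" using N_pos by simp
    then have W: "2 * (c * exp (- \<beta> * G)) * ?W \<le> ?D" using NC by (simp add: c_def field_simps)
    \<comment> \<open>As \<open>f\<close> is orthogonal to the constants, subtracting a constant can
      only increase the norm.\<close>
    have "ip k k = ip f f + a\<^sup>2 * ip one one"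
      unfolding k_def ip_diff ip_scale using f ip_comm[of one f] by (simp add: power2_eq_square)
    then have "ip f f \<le> ip k k" using ip_nonneg[of one] by simp
    also have "ip k k = ?W" by (simp add: ip_def power2_eq_square mult.assoc)
    finally have "2 * (c * exp (- \<beta> * G)) * ip f f \<le> 2 * (c * exp (- \<beta> * G)) * ?W"
      using c by (intro mult_left_mono) auto
    then show ?thesis using W by linarith
  qed
  then show thesis using that c by blast
qed

text \<open>A flip changes the number of plus sites by one, so leaving \<open>A\<close> means
  arriving at exactly \<open>n\<close> of them, where the energy is at least \<open>G\<close> above
  that of all-minus.\<close>

lemma metastable_set:
  obtains A where "A \<subseteq> X" "allm \<in> A" "allp \<in> X - A"
    "\<And>\<beta> \<sigma> \<eta>. 0 \<le> \<beta> \<Longrightarrow> \<sigma> \<in> A \<Longrightarrow> \<eta> \<in> X - A \<Longrightarrow>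
      wt \<beta> \<sigma> * ME \<beta> \<sigma> \<eta> \<le> exp (- \<beta> * G) * wt \<beta> allm"
proof -
  obtain n where n: "1 \<le> n" "n < 2 * L\<^sup>2" "\<And>S. S \<subseteq> Lam L \<Longrightarrow> card S = n \<Longrightarrow> G \<le> energy L J h S"
    using critical_barrier[OF h J delta large] by blast
  define A where "A = {\<sigma>\<in>X. card (plus_sites L \<sigma>) < n}"
  have Hm: "H allm = (h - 3 / 2 * J) * (real L)\<^sup>2"
    using Ham_conf[OF L_ge_2, of "{}" J h] by (simp add: energy_def perimT_def linksT_def uplinks_def)
  have "wt \<beta> \<sigma> * ME \<beta> \<sigma> \<eta> \<le> exp (- \<beta> * G) * wt \<beta> allm"
    if b: "0 \<le> \<beta>" and s: "\<sigma> \<in> A" and e: "\<eta> \<in> X - A" for \<beta> \<sigma> \<eta>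
  proof (cases "\<exists>x\<in>Lam L. \<eta> = flip \<sigma> x")
    case True
    then obtain x where x: "x \<in> Lam L" "\<eta> = flip \<sigma> x" by blast
    have \<sigma>: "\<sigma> \<in> X" "card (plus_sites L \<sigma>) < n" and \<eta>: "\<eta> \<in> X" "n \<le> card (plus_sites L \<eta>)"
      using s e by (auto simp: A_def)
    have "card (plus_sites L \<eta>) = n" using card_plus_sites_flip_le[OF \<sigma>(1) x(1)] \<sigma>(2) \<eta>(2) x(2) by simp
    then have "G \<le> energy L J h (plus_sites L \<eta>)" by (intro n(3)) (auto simp: plus_sites_def)
    then have "H allm + G \<le> max (H \<sigma>) (H \<eta>)" using H_energy[OF \<eta>(1)] Hm by simp
    then have "\<beta> * (H allm + G) \<le> \<beta> * max (H \<sigma>) (H \<eta>)" using b by (rule mult_left_mono)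
    then have le: "exp (- \<beta> * max (H \<sigma>) (H \<eta>)) \<le> exp (- \<beta> * G) * wt \<beta> allm"
      by (simp add: weight_def exp_add[symmetric] algebra_simps)
    have "ME \<beta> \<sigma> \<eta> = metro_off L J h \<beta> \<sigma> \<eta>" using s e by (auto simp: metro_def)
    then have "wt \<beta> \<sigma> * ME \<beta> \<sigma> \<eta> = exp (- \<beta> * max (H \<sigma>) (H \<eta>)) / N"
      using weight_metro_off[OF x(1), of J h \<beta> \<sigma>] x(2) by simp
    also have "\<dots> \<le> exp (- \<beta> * max (H \<sigma>) (H \<eta>))" using N_pos by (simp add: divide_le_eq)
    finally show ?thesis using le by simp
  next
    case False
    then have "ME \<beta> \<sigma> \<eta> = 0" using s e by (auto simp: metro_def metro_off_def)
    then show ?thesis by (simp add: weight_def)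
  qed
  moreover have "allm \<in> A" using n(1) conf_in_configs[of L "{}"] plus_sites_conf[of "{}" L] by (simp add: A_def)
  moreover have "allp \<in> X - A" using n(2) conf_in_configs[of L "Lam L"] plus_sites_conf[of "Lam L" L]
    by (simp add: A_def card_Lam)
  moreover have "A \<subseteq> X" by (auto simp: A_def)
  ultimately show thesis using that by blast
qed

section \<open>Bounds on the spectral gap\<close>

lemma eigs_eq: "0 \<le> \<beta> \<Longrightarrow> reversible_chain.eigs X (ME \<beta>) = metro_eigs L J h \<beta>"
  by (simp add: reversible_chain.eigs_def[OF reversible_metropolis] reversible_chain.Pop_def[OF reversible_metropolis] metro_eigs_def)

lemma gap_lower:
  obtains c where "0 < c" "c \<le> 1" "\<And>\<beta>. 0 < \<beta> \<Longrightarrow> c * exp (- \<beta> * G) \<le> spectral_gap L J h \<beta>"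
proof -
  obtain c where c: "0 < c" "c \<le> 1"
    "\<And>\<beta> f s. 0 \<le> \<beta> \<Longrightarrow> s = 1 \<or> s = - 1 \<and> ln 2 / h \<le> \<beta> \<Longrightarrow> scal \<beta> f (\<lambda>_. 1) = 0 \<Longrightarrow>
      2 * (c * exp (- \<beta> * G)) * scal \<beta> f f \<le> form \<beta> s f"
    by (rule poincare_constant) blast
  have "c * exp (- \<beta> * G) \<le> spectral_gap L J h \<beta>" if b: "0 < \<beta>" for \<beta>
    unfolding spectral_gap_def eigs_eq[OF less_imp_le[OF b], symmetric]
    by (rule reversible_chain.gap_bounds(1)[OF reversible_metropolis]) (use b c in auto)
  then show thesis using that c by blast
qed

lemma weight_allp_ge:
  assumes "0 \<le> \<beta>" "\<sigma> \<in> X"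
  shows "wt \<beta> \<sigma> \<le> wt \<beta> allp"
  using H_plus_le[OF assms(2)] assms(1) by (simp add: weight_def mult_left_mono)

lemma flux_le:
  assumes A: "A \<subseteq> X" and D: "0 \<le> D" and W: "\<And>\<sigma> \<eta>. \<sigma> \<in> A \<Longrightarrow> \<eta> \<in> X - A \<Longrightarrow> W \<sigma> \<eta> \<le> D"
  shows "(\<Sum>\<sigma>\<in>A. \<Sum>\<eta>\<in>X - A. W \<sigma> \<eta>) \<le> (real (card X))\<^sup>2 * D"
proof -
  have "(\<Sum>\<sigma>\<in>A. \<Sum>\<eta>\<in>X - A. W \<sigma> \<eta>) \<le> (\<Sum>\<sigma>\<in>A. \<Sum>\<eta>\<in>X - A. D)" by (intro sum_mono W)
  also have "\<dots> = (real (card A) * real (card (X - A))) * D" by simp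
  also have "\<dots> \<le> (real (card X) * real (card X)) * D"
    using A D finite_configs by (intro mult_right_mono mult_mono) (auto intro: card_mono)
  finally show ?thesis by (simp add: power2_eq_square)
qed

lemma gap_upper:
  "\<exists>c. \<forall>\<beta>>0. spectral_gap L J h \<beta> \<le> c * exp (- \<beta> * G)"
proof -
  obtain A where A: "A \<subseteq> X" "allm \<in> A" "allp \<in> X - A"
    "\<And>\<beta> \<sigma> \<eta>. 0 \<le> \<beta> \<Longrightarrow> \<sigma> \<in> A \<Longrightarrow> \<eta> \<in> X - A \<Longrightarrow>
      wt \<beta> \<sigma> * ME \<beta> \<sigma> \<eta> \<le> exp (- \<beta> * G) * wt \<beta> allm"
    using metastable_set by blast
  obtain c where c: "0 < c" "c \<le> 1"
    "\<And>\<beta> f s. 0 \<le> \<beta> \<Longrightarrow> s = 1 \<or> s = - 1 \<and> ln 2 / h \<le> \<beta> \<Longrightarrow> scal \<beta> f (\<lambda>_. 1) = 0 \<Longrightarrow>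
      2 * (c * exp (- \<beta> * G)) * scal \<beta> f f \<le> form \<beta> s f"
    by (rule poincare_constant) blast
  \<comment> \<open>Two factors \<open>card X\<close> count the pairs in the Dirichlet form, the
    third comes from the variance of the test function.\<close>
  have "spectral_gap L J h \<beta> \<le> (real (card X)) ^ 3 * exp (- \<beta> * G)" if b: "0 < \<beta>" for \<beta>
  proof -
    have b0: "0 \<le> \<beta>" using b by simp
    interpret chain_powers X "wt \<beta>" "ME \<beta>" "metro_pow L J h \<beta>" using powers_metropolis[OF b0] .
    let ?w = "wt \<beta>" and ?P = "ME \<beta>" and ?g = "spectral_gap L J h \<beta>"
    define i where "i = (\<lambda>\<sigma>. of_bool (\<sigma> \<in> A) :: real)"
    define a where "a = (\<Sum>\<sigma>\<in>A. ?w \<sigma>)"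
    \<comment> \<open>The test function is the indicator of the metastable set, centred to be
      orthogonal to the constants.\<close>
    define f where "f = (\<lambda>\<sigma>. i \<sigma> - (a / Z) * one \<sigma>)"
    have finA: "finite A" using A(1) finX finite_subset by blast
    have iw: "ip i k = (\<Sum>\<sigma>\<in>A. ?w \<sigma> * k \<sigma>)" for k
    proof -
      have "ip i k = (\<Sum>\<sigma>\<in>X. if \<sigma> \<in> A then ?w \<sigma> * k \<sigma> else 0)"
        unfolding ip_def by (intro sum.cong) (auto simp: i_def)
      then show ?thesis using A(1) finX by (simp add: sum.inter_restrict[symmetric] Int_absorb1)
    qed
    have ii: "ip i i = a" unfolding iw by (simp add: i_def a_def)
    have i1: "ip i one = a" unfolding iw by (simp add: a_def)
    have oo: "ip one one = Z" by (simp add: ip_def Z_def)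
    have f1: "ip f one = 0" unfolding f_def ip_diff ip_scale i1 oo using Z_pos by simp
    have ff: "ip f f = a * (Z - a) / Z"
      unfolding f_def ip_diff ip_scale ii i1 oo using Z_pos ip_comm[of one i] i1
      by (simp add: power2_eq_square field_simps)
    have "allm \<in> X" "allp \<in> X" by (simp_all add: conf_in_configs)
    have am: "?w allm \<le> a" unfolding a_def
      using A(1,2) finA w_pos by (intro member_le_sum) (auto intro: less_imp_le)
    have "Z = (\<Sum>\<sigma>\<in>X - A. ?w \<sigma>) + a" unfolding Z_def a_def using A(1) finX by (intro sum.subset_diff) auto
    moreover have "?w allp \<le> (\<Sum>\<sigma>\<in>X - A. ?w \<sigma>)"
      using A(3) finX w_pos by (intro member_le_sum) (auto intro: less_imp_le)
    ultimately have Za: "?w allp \<le> Z - a" by simp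
    have "Z \<le> (\<Sum>\<sigma>\<in>X. ?w allp)" unfolding Z_def by (intro sum_mono weight_allp_ge[OF b0])
    then have ZX: "Z \<le> card X * ?w allp" by simp
    have wm: "0 < ?w allm" and wp: "0 < ?w allp" using w_pos conf_in_configs by blast+
    have X0: "0 < real (card X)" using X2 by simp
    \<comment> \<open>All-plus has the largest weight and so carries at least the fraction
      \<open>1 / card X\<close> of \<open>Z\<close>. This bounds the variance from below by the
      weight of all-minus, up to the same factor.\<close>
    have "Z / card X \<le> ?w allp" using ZX X0 by (simp add: divide_le_eq mult.commute)
    then have "?w allm * (Z / card X) \<le> a * (Z - a)"
      using am Za wm X0 Z_pos by (intro mult_mono) auto
    then have "?w allm / card X \<le> ip f f" unfolding ff using Z_pos X0 by (simp add: field_simps)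
    moreover have g0: "0 \<le> ?g"
      unfolding spectral_gap_def eigs_eq[OF b0, symmetric]
      by (rule order_trans[OF _ gap_bounds(1)[of "c * exp (- \<beta> * G)"]]) (use c b0 in auto)
    ultimately have "2 * ?g * (?w allm / card X) \<le> 2 * ?g * ip f f" by (intro mult_left_mono) auto
    also have "\<dots> \<le> dirichlet 1 f"
      unfolding spectral_gap_def eigs_eq[OF b0, symmetric]
      by (rule gap_bounds(2)[of "c * exp (- \<beta> * G)"]) (use c b0 f1 in auto)
    also have "dirichlet 1 f = (\<Sum>\<sigma>\<in>X. \<Sum>\<eta>\<in>X. ?w \<sigma> * ?P \<sigma> \<eta> * (i \<sigma> - i \<eta>)\<^sup>2)"
      by (simp add: dirichlet_def f_def)
    also have "\<dots> \<le> (\<Sum>\<sigma>\<in>X. \<Sum>\<eta>\<in>X. exp (- \<beta> * G) * ?w allm)"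
    proof (intro sum_mono)
      fix \<sigma> \<eta> assume se: "\<sigma> \<in> X" "\<eta> \<in> X"
      consider "\<sigma> \<in> A \<longleftrightarrow> \<eta> \<in> A" | "\<sigma> \<in> A" "\<eta> \<in> X - A" | "\<eta> \<in> A" "\<sigma> \<in> X - A" using se by blast
      then show "?w \<sigma> * ?P \<sigma> \<eta> * (i \<sigma> - i \<eta>)\<^sup>2 \<le> exp (- \<beta> * G) * ?w allm"
      proof cases
        case 1
        then show ?thesis using wm by (simp add: i_def)
      next
        case 2
        then show ?thesis using A(4)[OF b0, of \<sigma> \<eta>] by (simp add: i_def)
      next
        case 3
        then show ?thesis using A(4)[OF b0, of \<eta> \<sigma>] reversible[OF se] by (simp add: i_def)
      qed
    qed
    also have "\<dots> = (real (card X))\<^sup>2 * (exp (- \<beta> * G) * ?w allm)" by (simp add: power2_eq_square)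
    finally have "2 * ?g * (?w allm / card X) * card X \<le> (real (card X))\<^sup>2 * (exp (- \<beta> * G) * ?w allm) * card X"
      using X0 by (intro mult_right_mono) auto
    then have "?w allm * (2 * ?g) \<le> ?w allm * ((real (card X)) ^ 3 * exp (- \<beta> * G))"
      using X0 by (simp add: power2_eq_square power3_eq_cube ac_simps)
    then have "2 * ?g \<le> (real (card X)) ^ 3 * exp (- \<beta> * G)" using wm by (simp only: mult_le_cancel_left_pos)
    then show ?thesis using g0 by simp
  qed
  then show ?thesis by blast
qed

section \<open>Bounds on the mixing time\<close>

lemma tv_dist_eq:
  assumes "0 \<le> \<beta>"
  shows "tv_dist L J h \<beta> n \<sigma> = 1 / 2 * (\<Sum>\<eta>\<in>X. \<bar>metro_pow L J h \<beta> n \<sigma> \<eta> - wt \<beta> \<eta> / chain_powers.Z X (wt \<beta>)\<bar>)"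
  unfolding tv_dist_def gibbs_def chain_powers.Z_def[OF powers_metropolis[OF assms]] weight_def by simp

text \<open>The second conjunct records that \<open>tmix\<close> is itself an admissible time, so
  that a lower bound on all admissible times applies to it.\<close>

lemma mixing_time_upper:
  assumes \<epsilon>: "0 < \<epsilon>"
  obtains K where "0 < K"
    "\<forall>\<beta>\<ge>max 1 (ln 2 / h). real (tmix L J h \<beta> \<epsilon>) \<le> K * \<beta> * exp (\<beta> * G) \<and>
       (\<forall>\<sigma>\<in>X. tv_dist L J h \<beta> (tmix L J h \<beta> \<epsilon>) \<sigma> \<le> \<epsilon>)"
proof -
  obtain c where c: "0 < c" "c \<le> 1"
    "\<And>\<beta> f s. 0 \<le> \<beta> \<Longrightarrow> s = 1 \<or> s = - 1 \<and> ln 2 / h \<le> \<beta> \<Longrightarrow> scal \<beta> f (\<lambda>_. 1) = 0 \<Longrightarrow>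
      2 * (c * exp (- \<beta> * G)) * scal \<beta> f f \<le> form \<beta> s f"
    by (rule poincare_constant) blast
  define D where "D = (\<Sum>\<sigma>\<in>X. \<bar>H \<sigma>\<bar>)"
  have D: "\<bar>H \<sigma>\<bar> \<le> D" if "\<sigma> \<in> X" for \<sigma>
    unfolding D_def using that finite_configs by (intro member_le_sum) auto
  have D0: "0 \<le> D" unfolding D_def by (intro sum_nonneg) auto
  \<comment> \<open>Chosen so that \<open>exp (- (\<beta> * E))\<close> absorbs
    \<open>card X / \<epsilon> * exp (\<beta> * D)\<close> for every \<beta> \<ge> 1; the absolute
    value makes multiplication by \<beta> harmless.\<close>
  define E where "E = \<bar>ln (card X / \<epsilon>)\<bar> + D"
  have E0: "0 \<le> E" using D0 by (simp add: E_def)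
  define K where "K = E / c + 1"
  have X0: "0 < real (card X)" using reversible_chain.X2[OF reversible_metropolis[of 0]] by simp
  have main: "real (tmix L J h \<beta> \<epsilon>) \<le> K * \<beta> * exp (\<beta> * G) \<and> (\<forall>\<sigma>\<in>X. tv_dist L J h \<beta> (tmix L J h \<beta> \<epsilon>) \<sigma> \<le> \<epsilon>)"
    if b: "max 1 (ln 2 / h) \<le> \<beta>" for \<beta>
  proof -
    have b1: "1 \<le> \<beta>" "0 \<le> \<beta>" "ln 2 / h \<le> \<beta>" using b by auto
    interpret chain_powers X "wt \<beta>" "ME \<beta>" "metro_pow L J h \<beta>" using powers_metropolis[OF b1(2)] .
    define g where "g = c * exp (- \<beta> * G)"
    have "exp (- \<beta> * G) \<le> 1" using b1 G_pos by simp
    then have g: "0 < g" "g \<le> 1" using c mult_mono[of c 1 "exp (- \<beta> * G)" 1] by (auto simp: g_def)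
    define t where "t = \<beta> * E / g"
    define n where "n = nat \<lceil>t\<rceil>"
    have t0: "0 \<le> t" using b1 E0 g by (simp add: t_def)
    have n: "t \<le> real n" "real n \<le> t + 1" using t0 by (auto simp: n_def)
    have tv: "tv_dist L J h \<beta> n \<sigma> \<le> \<epsilon>" if \<sigma>: "\<sigma> \<in> X" for \<sigma>
    proof -
      have R: "wt \<beta> \<eta> \<le> (exp (\<beta> * D))\<^sup>2 * wt \<beta> \<xi>" if "\<xi> \<in> X" "\<eta> \<in> X" for \<xi> \<eta>
      proof -
        have "H \<xi> - H \<eta> \<le> 2 * D" using D[OF that(1)] D[OF that(2)] by linarith
        then have "\<beta> * (H \<xi> - H \<eta>) \<le> \<beta> * (2 * D)" using b1 by (intro mult_left_mono) auto
        then have "- \<beta> * H \<eta> \<le> \<beta> * D + \<beta> * D + - \<beta> * H \<xi>" by (simp add: algebra_simps)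
        then have "exp (- \<beta> * H \<eta>) \<le> exp (\<beta> * D + \<beta> * D + - \<beta> * H \<xi>)" by (simp only: exp_le_cancel_iff)
        then show ?thesis by (simp only: weight_def power2_eq_square exp_add)
      qed
      have "(1 - g) ^ n \<le> exp (- g) ^ n" using g exp_ge_add_one_self[of "- g"] by (intro power_mono) auto
      also have "\<dots> = exp (- (real n * g))" by (simp add: exp_of_nat_mult[symmetric])
      also have "\<dots> \<le> exp (- (\<beta> * E))"
        using n(1) g by (simp add: t_def field_simps)
      finally have p: "(1 - g) ^ n \<le> exp (- (\<beta> * E))" .
      have "ln (card X / \<epsilon>) \<le> \<bar>ln (card X / \<epsilon>)\<bar> * 1" by simp
      also have "\<dots> \<le> \<bar>ln (card X / \<epsilon>)\<bar> * \<beta>" using b1 by (intro mult_left_mono) auto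
      finally have "ln (card X / \<epsilon>) + \<beta> * D + - (\<beta> * E) \<le> 0" by (simp add: E_def algebra_simps)
      then have "exp (ln (card X / \<epsilon>) + \<beta> * D + - (\<beta> * E)) \<le> 1" by simp
      then have q: "card X / \<epsilon> * exp (\<beta> * D) * exp (- (\<beta> * E)) \<le> 1"
        using X0 \<epsilon> by (simp only: exp_add exp_ln divide_pos_pos)
      have "tv_dist L J h \<beta> n \<sigma> \<le> 1 / 2 * (card X * (exp (\<beta> * D) * (1 - g) ^ n))"
        unfolding tv_dist_eq[OF b1(2)]
        by (intro mult_left_mono mixing_upper[OF g _ _ R \<sigma>]) (use c b1 in \<open>auto simp: g_def\<close>)
      also have "\<dots> \<le> 1 / 2 * (card X * (exp (\<beta> * D) * exp (- (\<beta> * E))))"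
        using p by (intro mult_left_mono) auto
      also have "\<dots> \<le> \<epsilon>" using q \<epsilon> by (simp add: field_simps)
      finally show ?thesis .
    qed
    have "tmix L J h \<beta> \<epsilon> \<le> n" unfolding tmix_def using tv by (intro Least_le) auto
    moreover have "\<forall>\<sigma>\<in>X. tv_dist L J h \<beta> (tmix L J h \<beta> \<epsilon>) \<sigma> \<le> \<epsilon>"
      unfolding tmix_def using tv by (intro LeastI[of "\<lambda>n. \<forall>\<sigma>\<in>X. tv_dist L J h \<beta> n \<sigma> \<le> \<epsilon>" n]) auto
    moreover have "real n \<le> K * \<beta> * exp (\<beta> * G)"
    proof -
      have "t = E / c * \<beta> * exp (\<beta> * G)" using c by (simp add: t_def g_def exp_minus field_simps)
      moreover have "1 * 1 \<le> \<beta> * exp (\<beta> * G)" using b1 G_pos by (intro mult_mono) auto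
      ultimately show ?thesis using n(2) by (simp add: K_def algebra_simps)
    qed
    ultimately show ?thesis by linarith
  qed
  have "0 < K" using E0 c by (simp add: K_def add_nonneg_pos)
  then show thesis using main by (intro that[of K]) blast+
qed

lemma mixing_time_lower:
  assumes \<epsilon>: "\<epsilon> < 1"
  obtains c where "0 < c"
    "\<forall>\<^sub>F \<beta> in at_top. \<forall>t. (\<forall>\<sigma>\<in>X. tv_dist L J h \<beta> t \<sigma> \<le> \<epsilon>) \<longrightarrow> c * exp (\<beta> * G) \<le> real t"
proof -
  obtain A where A: "A \<subseteq> X" "allm \<in> A" "allp \<in> X - A"
    "\<And>\<beta> \<sigma> \<eta>. 0 \<le> \<beta> \<Longrightarrow> \<sigma> \<in> A \<Longrightarrow> \<eta> \<in> X - A \<Longrightarrow>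
      wt \<beta> \<sigma> * ME \<beta> \<sigma> \<eta> \<le> exp (- \<beta> * G) * wt \<beta> allm"
    using metastable_set by blast
  define M where "M = real (card X)"
  have M0: "0 < M" using reversible_chain.X2[OF reversible_metropolis[of 0]] by (simp add: M_def)
  \<comment> \<open>Half of \<open>1 - \<epsilon>\<close> pays for the stationary mass of
    \<open>A\<close>, which vanishes as \<beta> grows; the other half remains for the escape from
    \<open>A\<close>, with \<open>M\<^sup>2\<close> bounding the number of pairs in the
    flux.\<close>
  define c where "c = (1 - \<epsilon>) / 2 / M\<^sup>2"
  have c0: "0 < c" using \<epsilon> M0 by (simp add: c_def)
  have "((\<lambda>\<beta>. M * exp (- (\<beta> * h))) \<longlongrightarrow> M * 0) at_top"
    by (intro tendsto_intros filterlim_compose[OF exp_at_bot] filterlim_compose[OF filterlim_uminus_at_bot_at_top]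
        filterlim_at_top_mult_tendsto_pos[OF tendsto_const h filterlim_ident, simplified mult.commute])
  then have "\<forall>\<^sub>F \<beta> in at_top. M * exp (- (\<beta> * h)) < (1 - \<epsilon>) / 2"
    using \<epsilon> by (intro order_tendstoD(2)) auto
  then have "\<forall>\<^sub>F \<beta> in at_top. \<forall>t. (\<forall>\<sigma>\<in>X. tv_dist L J h \<beta> t \<sigma> \<le> \<epsilon>) \<longrightarrow> c * exp (\<beta> * G) \<le> real t"
    using eventually_ge_at_top[of 0]
  proof eventually_elim
    case (elim \<beta>)
    then have b: "0 \<le> \<beta>" and small: "M * exp (- (\<beta> * h)) < (1 - \<epsilon>) / 2" by auto
    interpret chain_powers X "wt \<beta>" "ME \<beta>" "metro_pow L J h \<beta>" using powers_metropolis[OF b] .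
    let ?w = "wt \<beta>"
    show ?case
    proof (intro allI impI)
      fix t assume tv: "\<forall>\<sigma>\<in>X. tv_dist L J h \<beta> t \<sigma> \<le> \<epsilon>"
      have wm: "0 < ?w allm" using w_pos conf_in_configs by blast
      define F where "F = (\<Sum>z\<in>A. \<Sum>y\<in>X - A. ?w z * ME \<beta> z y)"
      have "F \<le> M\<^sup>2 * (exp (- \<beta> * G) * ?w allm)"
        unfolding F_def M_def using A(4)[OF b] wm by (intro flux_le[OF A(1)]) auto
      then have "F / ?w allm \<le> M\<^sup>2 * exp (- \<beta> * G)" using wm by (simp add: field_simps)
      then have fl: "t * F / ?w allm \<le> t * (M\<^sup>2 * exp (- \<beta> * G))"
        using mult_left_mono[of "F / ?w allm" "M\<^sup>2 * exp (- \<beta> * G)" "real t"] by simp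
      have "(\<Sum>y\<in>A. ?w y) \<le> (\<Sum>y\<in>A. exp (- (\<beta> * h)) * ?w allp)"
      proof (rule sum_mono)
        fix y assume "y \<in> A"
        then have "H allp + h \<le> H y" using A by (intro H_plus_gap) auto
        then have "\<beta> * (H allp + h) \<le> \<beta> * H y" using b by (rule mult_left_mono)
        then show "?w y \<le> exp (- (\<beta> * h)) * ?w allp" by (simp add: weight_def exp_add[symmetric] algebra_simps)
      qed
      also have "\<dots> = card A * (exp (- (\<beta> * h)) * ?w allp)" by simp
      also have "\<dots> \<le> M * (exp (- (\<beta> * h)) * Z)"
      proof (intro mult_mono)
        show "?w allp \<le> Z" unfolding Z_def using finX w_pos conf_in_configs by (intro member_le_sum) (auto intro: less_imp_le)
        show "real (card A) \<le> M" using A(1) finX by (simp add: M_def card_mono)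
      qed (use Z_pos M0 w_pos conf_in_configs in \<open>auto intro: less_imp_le\<close>)
      finally have "(\<Sum>y\<in>A. ?w y) / Z \<le> M * exp (- (\<beta> * h))" using Z_pos by (simp add: field_simps)
      moreover have "1 - t * F / ?w allm - (\<Sum>y\<in>A. ?w y) / Z \<le> \<epsilon>"
        using mixing_lower[OF A(1,2), of t] tv conf_in_configs[of L "{}"] unfolding F_def tv_dist_eq[OF b] by force
      ultimately have "(1 - \<epsilon>) / 2 \<le> t * (M\<^sup>2 * exp (- \<beta> * G))" using fl small by (simp add: field_simps)
      then have "(1 - \<epsilon>) / 2 / M\<^sup>2 \<le> t * exp (- \<beta> * G)" using M0 by (simp add: field_simps)
      then have "c * exp (\<beta> * G) \<le> t * exp (- \<beta> * G) * exp (\<beta> * G)" unfolding c_def by (intro mult_right_mono) auto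
      also have "\<dots> = t" by (simp add: exp_minus)
      finally show "c * exp (\<beta> * G) \<le> real t" .
    qed
  qed
  then show thesis using that c0 by blast
qed

lemma mixing_time_limit:
  assumes \<epsilon>: "0 < \<epsilon>" "\<epsilon> < 1"
  shows "((\<lambda>\<beta>. ln (real (tmix L J h \<beta> \<epsilon>)) / \<beta>) \<longlongrightarrow> G) at_top"
proof -
  obtain K where K: "0 < K"
    "\<forall>\<beta>\<ge>max 1 (ln 2 / h). real (tmix L J h \<beta> \<epsilon>) \<le> K * \<beta> * exp (\<beta> * G) \<and>
       (\<forall>\<sigma>\<in>X. tv_dist L J h \<beta> (tmix L J h \<beta> \<epsilon>) \<sigma> \<le> \<epsilon>)"
    by (rule mixing_time_upper[OF \<epsilon>(1)])
  obtain c where c: "0 < c"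
    "\<forall>\<^sub>F \<beta> in at_top. \<forall>t. (\<forall>\<sigma>\<in>X. tv_dist L J h \<beta> t \<sigma> \<le> \<epsilon>) \<longrightarrow> c * exp (\<beta> * G) \<le> real t"
    by (rule mixing_time_lower[OF \<epsilon>(2)])
  have ev: "\<forall>\<^sub>F \<beta> in at_top. ln c / \<beta> + G \<le> ln (real (tmix L J h \<beta> \<epsilon>)) / \<beta> \<and>
      ln (real (tmix L J h \<beta> \<epsilon>)) / \<beta> \<le> ln K / \<beta> + ln \<beta> / \<beta> + G"
    using c(2) eventually_ge_at_top[of "max 1 (ln 2 / h)"]
  proof eventually_elim
    case (elim \<beta>)
    let ?t = "real (tmix L J h \<beta> \<epsilon>)"
    have "1 \<le> \<beta>" using elim(2) by (rule order_trans[OF max.cobounded1])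
    then have b: "0 < \<beta>" by simp
    note up = K(2)[rule_format, OF elim(2)]
    have u: "?t \<le> K * \<beta> * exp (\<beta> * G)" using up by blast
    have l: "c * exp (\<beta> * G) \<le> ?t" using elim(1) up by blast
    have pos: "0 < c * exp (\<beta> * G)" using c by simp
    then have t: "0 < ?t" using l by linarith
    have "ln c + \<beta> * G = ln (c * exp (\<beta> * G))" using c by (simp add: ln_mult)
    also have "\<dots> \<le> ln ?t" using l pos by simp
    finally have "(ln c + \<beta> * G) / \<beta> \<le> ln ?t / \<beta>" using b by (simp add: divide_right_mono)
    moreover have "ln ?t \<le> ln (K * \<beta> * exp (\<beta> * G))" using u t by simp
    then have "ln ?t \<le> ln K + ln \<beta> + \<beta> * G" using K(1) b by (simp add: ln_mult)
    then have "ln ?t / \<beta> \<le> (ln K + ln \<beta> + \<beta> * G) / \<beta>" using b by (simp add: divide_right_mono)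
    ultimately show ?case using b by (simp add: add_divide_distrib)
  qed
  have inv: "((\<lambda>\<beta>. k / \<beta>) \<longlongrightarrow> 0) at_top" for k :: real
    by (rule tendsto_divide_0[OF tendsto_const]) (rule filterlim_at_top_imp_at_infinity[OF filterlim_ident])
  have "((\<lambda>\<beta>. ln c / \<beta> + G) \<longlongrightarrow> 0 + G) at_top" by (intro tendsto_intros inv)
  then have lo: "((\<lambda>\<beta>. ln c / \<beta> + G) \<longlongrightarrow> G) at_top" by simp
  have "((\<lambda>\<beta>. ln K / \<beta> + ln \<beta> / \<beta> + G) \<longlongrightarrow> 0 + 0 + G) at_top"
    by (intro tendsto_intros inv ln_x_over_x_tendsto_0)
  then have up: "((\<lambda>\<beta>. ln K / \<beta> + ln \<beta> / \<beta> + G) \<longlongrightarrow> G) at_top" by simp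
  show ?thesis
    by (rule tendsto_sandwich[OF _ _ lo up]) (rule eventually_mono[OF ev], blast)+
qed

end

theorem theorem2p9:
  fixes L :: nat and J h :: real
  assumes "L \<ge> 1"
    and "0 < h" and "h < 1" and "J \<ge> 2 * h"
    and "J / (2 * h) - 1 / 2 \<notin> \<int>"
    and "delta_hex J h \<noteq> 1 / 2"
    and "real (card (Lam L)) \<ge> (4 * J / h)\<^sup>2"
  shows "(\<forall>\<epsilon>::real. 0 < \<epsilon> \<and> \<epsilon> < 1 \<longrightarrow>
            ((\<lambda>\<beta>. ln (real (tmix L J h \<beta> \<epsilon>)) / \<beta>) \<longlongrightarrow> Gamma_hex J h) at_top)
       \<and> (\<exists>c1 c2 :: real. \<exists>\<gamma>1 \<gamma>2 :: real \<Rightarrow> real.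
            0 < c1 \<and> c1 < c2 \<and> (\<gamma>1 \<longlongrightarrow> 0) at_top \<and> (\<gamma>2 \<longlongrightarrow> 0) at_top \<and>
            (\<forall>\<beta>>0. c1 * exp (- \<beta> * (Gamma_hex J h + \<gamma>1 \<beta>)) \<le> spectral_gap L J h \<beta> \<and>
                    spectral_gap L J h \<beta> \<le> c2 * exp (- \<beta> * (Gamma_hex J h - \<gamma>2 \<beta>))))"
proof (intro conjI allI impI)
  note hyps = assms(2,4,6,7)
  show "((\<lambda>\<beta>. ln (real (tmix L J h \<beta> \<epsilon>)) / \<beta>) \<longlongrightarrow> Gamma_hex J h) at_top" if "0 < \<epsilon> \<and> \<epsilon> < 1" for \<epsilon>
    using mixing_time_limit[OF hyps] that by simp
  obtain c1 where c1: "0 < c1" "\<And>\<beta>. 0 < \<beta> \<Longrightarrow> c1 * exp (- \<beta> * Gamma_hex J h) \<le> spectral_gap L J h \<beta>"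
    using gap_lower[OF hyps] by blast
  obtain c where c: "\<forall>\<beta>>0. spectral_gap L J h \<beta> \<le> c * exp (- \<beta> * Gamma_hex J h)"
    using gap_upper[OF hyps] by blast
  \<comment> \<open>The maximum makes the second constant strictly larger than the first.\<close>
  have "spectral_gap L J h \<beta> \<le> max c (c1 + 1) * exp (- \<beta> * Gamma_hex J h)" if "0 < \<beta>" for \<beta>
    by (rule order_trans[OF c[rule_format, OF that] mult_right_mono]) auto
  then have "\<forall>\<beta>>0. c1 * exp (- \<beta> * (Gamma_hex J h + 0)) \<le> spectral_gap L J h \<beta> \<and>
      spectral_gap L J h \<beta> \<le> max c (c1 + 1) * exp (- \<beta> * (Gamma_hex J h - 0))"
    using c1(2) by simp
  moreover have "c1 < max c (c1 + 1)" by simp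
  ultimately show "\<exists>c1 c2 :: real. \<exists>\<gamma>1 \<gamma>2 :: real \<Rightarrow> real.
            0 < c1 \<and> c1 < c2 \<and> (\<gamma>1 \<longlongrightarrow> 0) at_top \<and> (\<gamma>2 \<longlongrightarrow> 0) at_top \<and>
            (\<forall>\<beta>>0. c1 * exp (- \<beta> * (Gamma_hex J h + \<gamma>1 \<beta>)) \<le> spectral_gap L J h \<beta> \<and>
                    spectral_gap L J h \<beta> \<le> c2 * exp (- \<beta> * (Gamma_hex J h - \<gamma>2 \<beta>)))"
    using c1(1) by (intro exI[of _ c1] exI[of _ "max c (c1 + 1)"] exI[of _ "\<lambda>_. 0"] conjI tendsto_const)
qed

end
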